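(* Let $A$ be a Poisson $Z_0$-order which is an affine $\mathbb{C}$-algebra, and let $\mathcal{Z}=\mathrm{Maxspec}(Z_0)$. For each point $x\in\mathcal{Z}$, with corresponding maximal ideal $\mathfrak{m}_x$ of $Z_0$, define the finite dimensional algebra $A_x := A/\mathfrak{m}_xA$. If $x,y\in\mathcal{Z}$ belong to the same symplectic core $\mathcal{C}$, then $A_x$ and $A_y$ are isomorphic $\mathbb{C}$-algebras.
   Context: The base field is $\mathbb{C}$. A Poisson algebra is a commutative algebra with a Lie bracket $\{-,-\}$ that is a derivation in each variable. Poisson order: let $A$ be an affine (i.e. finitely generated, associative, unital) $\mathbb{C}$-algebra, finitely generated as a module over a central subalgebra $Z_0$ (so $Z_0$ is affine). Suppose there is a linear map $D: Z_0\to \mathrm{Der}_{\mathbb{C}}(A)$, $z\mapsto D_z$, such that (1) $Z_0$ is stable under $D_z$ for all $z\in Z_0$; (2) the bracket $\{z,z'\}=D_z(z')$ on $Z_0$ makes $Z_0$ a Poisson $\mathbb{C}$-algebra, that is, $D_{zz'}=zD_{z'}+z'D_z$ as derivations of $Z_0$ and $(Z_0,\{-,-\})$ is a Lie algebra. Then $A$ (with $D$) is called a Poisson $Z_0$-order. Symplectic cores: an ideal $J$ of $Z_0$ is Poisson if $\{Z_0,J\}\subseteq J$. For an ideal $I$ of $Z_0$, its Poisson core $\mathcal{P}(I)$ is the largest Poisson ideal of $Z_0$ contained in $I$. The symplectic cores are the equivalence classes of the equivalence relation on $\mathcal{Z}$ given by $\mathfrak{m}\sim\mathfrak{n}$ if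 and only if $\mathcal{P}(\mathfrak{m})=\mathcal{P}(\mathfrak{n})$. *)

theory Defs
  imports Complex_Main "HOL-Algebra.Algebra" "HOL-Algebra.Algebraic_Closure_Type"
begin

section \<open>Algebras over the complex numbers\<close>

abbreviation complex_ring :: "complex ring"
  where "complex_ring \<equiv> ring_of_type_algebra"

lemma complex_ring_simps [simp]:
  "carrier complex_ring = UNIV" "monoid.mult complex_ring = (*)" "one complex_ring = 1"
  "ring.zero complex_ring = 0" "add complex_ring = (+)"
  by (simp_all add: ring_of_type_algebra_def)

text \<open>The library locale \<^locale>\<open>algebra\<close> only covers commutative algebras. Here algebras are
  associative and unital, but need not be commutative.\<close>

locale c_algebra = module complex_ring A + ring A for A :: "(complex, 'a) module" (structure) +
  assumes smult_mult_left:
      "x \<in> carrier A \<Longrightarrow> y \<in> carrier A \<Longrightarrow> (c \<odot> x) \<otimes> y = c \<odot> (x \<otimes> y)"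
    and smult_mult_right:
      "x \<in> carrier A \<Longrightarrow> y \<in> carrier A \<Longrightarrow> x \<otimes> (c \<odot> y) = c \<odot> (x \<otimes> y)"

definition c_subalgebra :: "'a set \<Rightarrow> (complex, 'a) module \<Rightarrow> bool"
  where "c_subalgebra B A \<longleftrightarrow> subring B A \<and> submodule B complex_ring A"

definition central_subset :: "'a set \<Rightarrow> (complex, 'a) module \<Rightarrow> bool"
  where "central_subset B A \<longleftrightarrow>
    B \<subseteq> carrier A \<and> (\<forall>z\<in>B. \<forall>a\<in>carrier A. z \<otimes>\<^bsub>A\<^esub> a = a \<otimes>\<^bsub>A\<^esub> z)"

definition affine_c_algebra :: "(complex, 'a) module \<Rightarrow> bool"
  where "affine_c_algebra A \<longleftrightarrow> c_algebra A \<and>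
    (\<exists>S. finite S \<and> S \<subseteq> carrier A \<and> (\<forall>B. c_subalgebra B A \<and> S \<subseteq> B \<longrightarrow> B = carrier A))"

definition fg_module_over :: "'a set \<Rightarrow> (complex, 'a) module \<Rightarrow> bool"
  where "fg_module_over Z A \<longleftrightarrow>
    (\<exists>S. finite S \<and> S \<subseteq> carrier A \<and>
      (\<forall>a\<in>carrier A. \<exists>f\<in>S \<rightarrow> Z. a = (\<Oplus>\<^bsub>A\<^esub>s\<in>S. f s \<otimes>\<^bsub>A\<^esub> s)))"

definition c_alg_iso :: "(complex, 'a) module \<Rightarrow> (complex, 'b) module \<Rightarrow> ('a \<Rightarrow> 'b) set"
  where "c_alg_iso A B =
    {h \<in> ring_iso A B. \<forall>c. \<forall>a\<in>carrier A. h (c \<odot>\<^bsub>A\<^esub> a) = c \<odot>\<^bsub>B\<^esub> h a}"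

definition c_alg_isomorphic :: "(complex, 'a) module \<Rightarrow> (complex, 'b) module \<Rightarrow> bool"
  where "c_alg_isomorphic A B \<longleftrightarrow> c_alg_iso A B \<noteq> {}"

text \<open>The library's quotient ring \<^term>\<open>A Quot I\<close>, with the scalar multiplication
  \<open>c \<odot> (I +> a) = I +> (c \<odot> a)\<close>; the union over representatives follows
  \<^const>\<open>rcoset_mult\<close>.\<close>

definition quot_alg :: "(complex, 'a) module \<Rightarrow> 'a set \<Rightarrow> (complex, 'a set) module"
  where "quot_alg A I =
    \<lparr>carrier = carrier (A Quot I), monoid.mult = monoid.mult (A Quot I), one = one (A Quot I),
     ring.zero = ring.zero (A Quot I), add = add (A Quot I),
     module.smult = (\<lambda>c Y. \<Union>a\<in>Y. I +>\<^bsub>A\<^esub> (c \<odot>\<^bsub>A\<^esub> a))\<rparr>"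


section \<open>Poisson algebras and Poisson orders\<close>

locale poisson_algebra = c_algebra R + cring R for R :: "(complex, 'a) module" (structure) +
  fixes br :: "'a \<Rightarrow> 'a \<Rightarrow> 'a"
  assumes br_closed: "x \<in> carrier R \<Longrightarrow> y \<in> carrier R \<Longrightarrow> br x y \<in> carrier R"
    and br_add_left: "x \<in> carrier R \<Longrightarrow> y \<in> carrier R \<Longrightarrow> z \<in> carrier R \<Longrightarrow>
      br (x \<oplus> y) z = br x z \<oplus> br y z"
    and br_add_right: "x \<in> carrier R \<Longrightarrow> y \<in> carrier R \<Longrightarrow> z \<in> carrier R \<Longrightarrow>
      br x (y \<oplus> z) = br x y \<oplus> br x z"
    and br_smult_left: "x \<in> carrier R \<Longrightarrow> y \<in> carrier R \<Longrightarrow> br (c \<odot> x) y = c \<odot> br x y"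
    and br_smult_right: "x \<in> carrier R \<Longrightarrow> y \<in> carrier R \<Longrightarrow> br x (c \<odot> y) = c \<odot> br x y"
    and br_alternating: "x \<in> carrier R \<Longrightarrow> br x x = \<zero>"
    and br_jacobi: "x \<in> carrier R \<Longrightarrow> y \<in> carrier R \<Longrightarrow> z \<in> carrier R \<Longrightarrow>
      br x (br y z) \<oplus> br y (br z x) \<oplus> br z (br x y) = \<zero>"
    and br_leibniz_left: "x \<in> carrier R \<Longrightarrow> y \<in> carrier R \<Longrightarrow> z \<in> carrier R \<Longrightarrow>
      br (x \<otimes> y) z = x \<otimes> br y z \<oplus> y \<otimes> br x z"
    and br_leibniz_right: "x \<in> carrier R \<Longrightarrow> y \<in> carrier R \<Longrightarrow> z \<in> carrier R \<Longrightarrow>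
      br x (y \<otimes> z) = br x y \<otimes> z \<oplus> y \<otimes> br x z"

text \<open>Derivations are maps on the carrier; their values outside of it are irrelevant.\<close>

definition c_derivations :: "(complex, 'a) module \<Rightarrow> ('a \<Rightarrow> 'a) set"
  where "c_derivations A = {d. d \<in> carrier A \<rightarrow> carrier A \<and>
    (\<forall>a\<in>carrier A. \<forall>b\<in>carrier A. d (a \<oplus>\<^bsub>A\<^esub> b) = d a \<oplus>\<^bsub>A\<^esub> d b) \<and>
    (\<forall>c. \<forall>a\<in>carrier A. d (c \<odot>\<^bsub>A\<^esub> a) = c \<odot>\<^bsub>A\<^esub> d a) \<and>
    (\<forall>a\<in>carrier A. \<forall>b\<in>carrier A. d (a \<otimes>\<^bsub>A\<^esub> b) = d a \<otimes>\<^bsub>A\<^esub> b \<oplus>\<^bsub>A\<^esub> a \<otimes>\<^bsub>A\<^esub> d b)}"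

abbreviation sub_alg :: "(complex, 'a) module \<Rightarrow> 'a set \<Rightarrow> (complex, 'a) module"
  where "sub_alg A Z \<equiv> A\<lparr>carrier := Z\<rparr>"

text \<open>The map \<open>D\<close> sends \<open>z \<in> Z\<close> to the derivation \<open>D z\<close> of \<open>A\<close>, so that the curried map
  \<open>D\<close> itself, read on \<open>Z\<close>, is the bracket \<open>{z, z'} = D z z'\<close>.\<close>

locale poisson_order =
  fixes A :: "(complex, 'a) module" (structure)
    and Z :: "'a set"
    and D :: "'a \<Rightarrow> 'a \<Rightarrow> 'a"
  assumes affine: "affine_c_algebra A"
    and subalgebra_Z: "c_subalgebra Z A"
    and central_Z: "central_subset Z A"
    and fg_over_Z: "fg_module_over Z A"
    and D_derivation: "D \<in> Z \<rightarrow> c_derivations A"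
    and D_add: "z \<in> Z \<Longrightarrow> z' \<in> Z \<Longrightarrow> a \<in> carrier A \<Longrightarrow> D (z \<oplus> z') a = D z a \<oplus> D z' a"
    and D_smult: "z \<in> Z \<Longrightarrow> a \<in> carrier A \<Longrightarrow> D (c \<odot> z) a = c \<odot> D z a"
    and D_stable: "z \<in> Z \<Longrightarrow> z' \<in> Z \<Longrightarrow> D z z' \<in> Z"
    and D_poisson: "poisson_algebra (sub_alg A Z) D"


section \<open>Symplectic cores\<close>

definition maxspec :: "(complex, 'a) module \<Rightarrow> 'a set set"
  where "maxspec R = {m. maximalideal m R}"

definition poisson_ideal :: "(complex, 'a) module \<Rightarrow> ('a \<Rightarrow> 'a \<Rightarrow> 'a) \<Rightarrow> 'a set \<Rightarrow> bool"
  where "poisson_ideal R br J \<longleftrightarrow> ideal J R \<and> (\<forall>z\<in>carrier R. \<forall>j\<in>J. br z j \<in> J)"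

text \<open>The order on sets is inclusion. That the greatest element exists is
  \<open>poisson_core_greatest\<close> below.\<close>

definition poisson_core :: "(complex, 'a) module \<Rightarrow> ('a \<Rightarrow> 'a \<Rightarrow> 'a) \<Rightarrow> 'a set \<Rightarrow> 'a set"
  where "poisson_core R br I = (GREATEST J. poisson_ideal R br J \<and> J \<subseteq> I)"

definition core_rel :: "(complex, 'a) module \<Rightarrow> ('a \<Rightarrow> 'a \<Rightarrow> 'a) \<Rightarrow> ('a set \<times> 'a set) set"
  where "core_rel R br =
    {(m, n). m \<in> maxspec R \<and> n \<in> maxspec R \<and> poisson_core R br m = poisson_core R br n}"

definition symplectic_cores :: "(complex, 'a) module \<Rightarrow> ('a \<Rightarrow> 'a \<Rightarrow> 'a) \<Rightarrow> 'a set set set"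
  where "symplectic_cores R br = maxspec R // core_rel R br"

text \<open>Here \<^const>\<open>ideal_prod\<close> serves for the additive span \<open>m A\<close> of the products \<open>z a\<close> with
  \<open>z \<in> m\<close> and \<open>a \<in> A\<close>; the set \<open>m\<close> is an ideal of the central subalgebra, not of \<open>A\<close>.\<close>

definition fibre_alg :: "(complex, 'a) module \<Rightarrow> 'a set \<Rightarrow> (complex, 'a set) module"
  where "fibre_alg A m = quot_alg A (ideal_prod A m (carrier A))"


section \<open>The definitions are meaningful\<close>

lemma equiv_core_rel: "equiv (maxspec R) (core_rel R br)"
  by (rule equivI) (auto simp: core_rel_def refl_on_def sym_def trans_def)

context poisson_algebra
begin

lemma poisson_core_greatest:
  assumes "ideal I R"
  shows "poisson_ideal R br (poisson_core R br I)" (is ?thesis1)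
    and "poisson_core R br I \<subseteq> I" (is ?thesis2)
    and "\<And>J. poisson_ideal R br J \<Longrightarrow> J \<subseteq> I \<Longrightarrow> J \<subseteq> poisson_core R br I"
proof -
  define U where "U = \<Union>{J. poisson_ideal R br J \<and> J \<subseteq> I}"
  define G where "G = Idl U"
  have I_carr: "I \<subseteq> carrier R"
    using assms by (meson ideal.Icarr subsetI)
  have U_I: "U \<subseteq> I" by (auto simp: U_def)
  then have U_carr: "U \<subseteq> carrier R" using I_carr by blast
  have G: "ideal G R" unfolding G_def by (rule genideal_ideal[OF U_carr])
  then interpret G: ideal G R .
  have U_G: "U \<subseteq> G" unfolding G_def by (rule genideal_self[OF U_carr])
  have G_I: "G \<subseteq> I" unfolding G_def by (rule genideal_minimal[OF assms U_I])
  define K where "K = {x \<in> G. \<forall>z\<in>carrier R. br z x \<in> G}"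
  have "ideal K R"
  proof (rule idealI)
    show "ring R" by (rule ring_axioms)
    show "subgroup K (add_monoid R)"
    proof (rule add.subgroupI)
      show "K \<subseteq> carrier R" using G.a_subset by (auto simp: K_def)
      have "br z \<zero> = \<zero>" if "z \<in> carrier R" for z
        using br_smult_right[of z \<zero> 0] that br_closed[of z \<zero>] smult_l_null[unfolded complex_ring_simps]
        by simp
      then have "\<zero> \<in> K" using G.zero_closed by (simp add: K_def)
      then show "K \<noteq> {}" by blast
    next
      fix x assume x: "x \<in> K"
      then have xc: "x \<in> carrier R" using G.a_subset by (auto simp: K_def)
      have neg: "\<ominus> y = (-1) \<odot> y" if "y \<in> carrier R" for y
      proof -
        have "(-1) \<odot> y \<oplus> y = (-1) \<odot> y \<oplus> 1 \<odot> y"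
          using that smult_one[unfolded complex_ring_simps] by simp
        also have "\<dots> = ((-1) + 1) \<odot> y"
          using that smult_l_distr[unfolded complex_ring_simps, of "-1" 1 y] by simp
        also have "\<dots> = \<zero>" using that smult_l_null[unfolded complex_ring_simps, of y] by simp
        finally show ?thesis using that minus_equality smult_closed by simp
      qed
      have "br z (\<ominus> x) = \<ominus> br z x" if "z \<in> carrier R" for z
        using br_smult_right[of z x "-1"] that xc br_closed[of z x] neg by simp
      then have "\<ominus> x \<in> K" using x by (auto simp: K_def)
      then show "\<ominus> x \<in> K" .
    next
      fix x y assume x: "x \<in> K" and y: "y \<in> K"
      then have "x \<in> carrier R" "y \<in> carrier R" using G.a_subset by (auto simp: K_def)
      then show "x \<oplus> y \<in> K" using x y br_add_right by (auto simp: K_def)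
    qed
  next
    fix a x assume a: "a \<in> K" and x: "x \<in> carrier R"
    then have ac: "a \<in> carrier R" using G.a_subset by (auto simp: K_def)
    show "x \<otimes> a \<in> K"
      using a x ac br_leibniz_right[of _ x a] br_closed
      by (auto simp: K_def G.I_l_closed)
    then show "a \<otimes> x \<in> K" using m_comm[OF ac x] by simp
  qed
  moreover have "U \<subseteq> K"
  proof
    fix u assume "u \<in> U"
    then obtain J where J: "poisson_ideal R br J" "J \<subseteq> I" "u \<in> J" by (auto simp: U_def)
    then have "J \<subseteq> U" by (auto simp: U_def)
    then have JG: "J \<subseteq> G" using U_G by blast
    have "br z u \<in> J" if "z \<in> carrier R" for z
      using J that by (simp add: poisson_ideal_def)
    then show "u \<in> K" using J(3) JG by (auto simp: K_def)
  qed
  ultimately have "G \<subseteq> K" unfolding G_def by (rule genideal_minimal)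
  then have P: "poisson_ideal R br G" using G by (auto simp: poisson_ideal_def K_def)
  have max: "J \<subseteq> G" if "poisson_ideal R br J" "J \<subseteq> I" for J
    using that U_G by (auto simp: U_def)
  have core: "poisson_core R br I = G"
    unfolding poisson_core_def by (rule Greatest_equality) (use P G_I max in auto)
  show ?thesis1 ?thesis2 "\<And>J. poisson_ideal R br J \<Longrightarrow> J \<subseteq> I \<Longrightarrow> J \<subseteq> poisson_core R br I"
    using P G_I max by (simp_all add: core)
qed

end

context c_algebra
begin

lemma quot_alg_simps:
  "carrier (quot_alg A I) = carrier (A Quot I)"
  "monoid.mult (quot_alg A I) = monoid.mult (A Quot I)"
  "one (quot_alg A I) = one (A Quot I)"
  "ring.zero (quot_alg A I) = ring.zero (A Quot I)"
  "add (quot_alg A I) = add (A Quot I)"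
  by (simp_all add: quot_alg_def)

lemma quot_alg_smult:
  assumes "ideal I A" "a \<in> carrier A"
  shows "c \<odot>\<^bsub>quot_alg A I\<^esub> (I +> a) = I +> (c \<odot> a)"
proof -
  interpret I: ideal I A by fact
  have smult_I: "c \<odot> i \<in> I" if "i \<in> I" for i
  proof -
    have ic: "i \<in> carrier A" using that I.Icarr by simp
    have "c \<odot> i = (c \<odot> \<one>) \<otimes> i" using smult_mult_left[of \<one> i c] ic by simp
    also have "\<dots> \<in> I" using that smult_closed by (intro I.I_l_closed) simp_all
    finally show ?thesis .
  qed
  have indep: "I +> (c \<odot> b) = I +> (c \<odot> a)" if b: "b \<in> I +> a" for b
  proof -
    obtain i where i: "i \<in> I" "b = i \<oplus> a" using b by (auto simp: a_r_coset_def')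
    then have "i \<in> carrier A" using I.Icarr by simp
    then have "c \<odot> b = c \<odot> i \<oplus> c \<odot> a" using i assms smult_r_distr by simp
    then have "c \<odot> b \<in> I +> (c \<odot> a)" using smult_I[OF i(1)] by (auto simp: a_r_coset_def')
    then show ?thesis
      using a_repr_independence[of _ I "c \<odot> a"] assms(2) smult_closed I.a_subgroup by simp
  qed
  have "(\<Union>b\<in>I +> a. I +> (c \<odot> b)) = (\<Union>b\<in>I +> a. I +> (c \<odot> a))"
    by (rule SUP_cong[OF refl indep])
  also have "\<dots> = I +> (c \<odot> a)" using I.a_rcos_self[OF assms(2)] by auto
  finally show ?thesis by (simp add: quot_alg_def)
qed

end

lemma (in poisson_order) fibre_ideal:
  assumes "ideal m (sub_alg A Z)"
  shows "ideal (ideal_prod A m (carrier A)) A"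
proof -
  interpret c_algebra A using affine by (simp add: affine_c_algebra_def)
  interpret m: ideal m "sub_alg A Z" by fact
  have mZ: "m \<subseteq> Z" using m.a_subset by simp
  have ZA: "Z \<subseteq> carrier A" and comm: "\<And>z a. z \<in> Z \<Longrightarrow> a \<in> carrier A \<Longrightarrow> z \<otimes> a = a \<otimes> z"
    using central_Z by (auto simp: central_subset_def)
  have mA: "x \<in> carrier A" if "x \<in> m" for x using that mZ ZA by blast
  let ?P = "ideal_prod A m (carrier A)"
  have P_carr: "x \<in> carrier A" if "x \<in> ?P" for x
    using that by induct (auto intro: mA)
  have l: "a \<otimes> x \<in> ?P" if "x \<in> ?P" "a \<in> carrier A" for x a
    using that
  proof (induct rule: ideal_prod.induct)
    case (prod i j)
    then have ic: "i \<in> carrier A" and iZ: "i \<in> Z" using mA mZ by auto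
    have "a \<otimes> (i \<otimes> j) = (a \<otimes> i) \<otimes> j" using prod ic by (simp add: m_assoc)
    also have "a \<otimes> i = i \<otimes> a" using comm[OF iZ] prod by simp
    also have "(i \<otimes> a) \<otimes> j = i \<otimes> (a \<otimes> j)" using prod ic by (simp add: m_assoc)
    finally have "a \<otimes> (i \<otimes> j) = i \<otimes> (a \<otimes> j)" .
    then show ?case using prod by (auto intro: ideal_prod.prod)
  next
    case (sum s t)
    then show ?case using P_carr by (simp add: r_distr ideal_prod.sum)
  qed
  have r: "x \<otimes> a \<in> ?P" if "x \<in> ?P" "a \<in> carrier A" for x a
    using that
  proof (induct rule: ideal_prod.induct)
    case (prod i j)
    then show ?case using mA by (simp add: m_assoc ideal_prod.prod)
  next
    case (sum s t)
    then show ?case using P_carr by (simp add: l_distr ideal_prod.sum)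
  qed
  show ?thesis
  proof (rule idealI)
    show "ring A" by (rule ring_axioms)
    show "subgroup ?P (add_monoid A)"
    proof (rule add.subgroupI)
      have "\<zero> \<in> m" using additive_subgroup.zero_closed[OF m.is_additive_subgroup] by simp
      then have "\<zero> \<otimes> \<one> \<in> ?P" by (intro ideal_prod.prod) simp_all
      then show "?P \<noteq> {}" by auto
      fix x assume "x \<in> ?P"
      then show "\<ominus> x \<in> ?P" using l[of x "\<ominus> \<one>"] P_carr by (simp add: l_minus)
    qed (auto intro: P_carr ideal_prod.sum)
  qed (auto intro: l r)
qed

end

theory Submission
  imports Defs "HOL-Analysis.Continuum_Not_Denumerable" "Jordan_Normal_Form.Determinant"
begin

text \<open>Flowing formally along the Hamiltonian derivations turns a point of the spectrum of
  \<open>Z\<close> into a ring homomorphism from \<open>Z\<close> to the power series in the times of the flow, here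
  functions on words of elements of \<open>Z\<close> under the shuffle product. Its kernel is the Poisson core
  of the point, and the derivations of \<open>A\<close> trivialise \<open>A\<close> along it: over these series \<open>A\<close> becomes
  constant with fibre \<open>A\<^sub>x\<close>. Hence every point of the zero set of the core that lifts to a suitable
  algebra of series of countable dimension, and at which the rank of \<open>A\<close> has not jumped, has a fibre
  isomorphic to \<open>A\<^sub>x\<close>. A point that avoids countably many hypersurfaces lifts, and \<open>\<complex>\<close> being
  uncountable, some point avoids the hypersurfaces of both \<open>x\<close> and \<open>y\<close> when their cores agree.\<close>


section \<open>The shuffle algebra of word series\<close>

text \<open>Two points of one core need not be joined by any flow, and the flow from x is only
  formal, so x and y are never compared directly: each is compared with a third point p, generic on
  the zero set of the common core. Equality of the cores enters as equality of the kernels of the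
  two homomorphisms into series. The derivations do not commute, so coefficients are indexed by
  words, which record the order of differentiation; the Leibniz rule then forces the shuffle
  product. A character of series evaluates the formal flow at an actual end point. The full series
  ring is local, and its only character is the coefficient at the empty word, which leads back to x;
  hence the passage to a small subalgebra T. Countable dimension takes the place of finite
  generation throughout: it is inherited by subalgebras, at the price of countably many
  hypersurfaces to avoid. At a point that lifts to T, the coordinates on the fibre at x become
  coordinates at p with the same structure constants. They are independent where the determinant s
  of the Taylor matrix of a frame survives, and complete where a multiplier f from Nakayama's lemma
  does not vanish.\<close>

datatype 'a series = Series (coeff_at: "'a list \<Rightarrow> complex")

lemma series_eqI: "(\<And>w. coeff_at f w = coeff_at g w) \<Longrightarrow> f = g"
  by (cases f; cases g) (simp add: fun_eq_iff)

text \<open>The derivation of the series ring along the letter \<open>x\<close>;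
  \<open>shift_taylor\<close> matches it with \<open>der x\<close> on the algebra.\<close>

definition shift :: "'a \<Rightarrow> 'a series \<Rightarrow> 'a series"
  where "shift x f = Series (\<lambda>w. coeff_at f (x # w))"

lemma coeff_at_shift [simp]: "coeff_at (shift x f) w = coeff_at f (x # w)"
  by (simp add: shift_def)

text \<open>The shuffle product is the product for which taking the coefficient at the empty word is
  multiplicative and every shift is a derivation.\<close>

primrec shuffle_coeff :: "'a list \<Rightarrow> 'a series \<Rightarrow> 'a series \<Rightarrow> complex" where
  "shuffle_coeff [] f g = coeff_at f [] * coeff_at g []"
| "shuffle_coeff (x # w) f g = shuffle_coeff w (shift x f) g + shuffle_coeff w f (shift x g)"

instantiation series :: (type) comm_ring_1
begin

definition zero_series :: "'a series" where "0 = Series (\<lambda>_. 0)"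
definition one_series :: "'a series" where "1 = Series (\<lambda>w. if w = [] then 1 else 0)"
definition plus_series :: "'a series \<Rightarrow> 'a series \<Rightarrow> 'a series"
  where "f + g = Series (\<lambda>w. coeff_at f w + coeff_at g w)"
definition minus_series :: "'a series \<Rightarrow> 'a series \<Rightarrow> 'a series"
  where "f - g = Series (\<lambda>w. coeff_at f w - coeff_at g w)"
definition uminus_series :: "'a series \<Rightarrow> 'a series"
  where "- f = Series (\<lambda>w. - coeff_at f w)"
definition times_series :: "'a series \<Rightarrow> 'a series \<Rightarrow> 'a series"
  where "f * g = Series (\<lambda>w. shuffle_coeff w f g)"

instance
proof
  \<comment> \<open>The multiplicative laws are checked by induction on the word, for all series at
    once: they hold at the empty word, and linearity and the Leibniz rule carry them through a
    shift. No shuffles are enumerated.\<close>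
  have plus: "coeff_at (f + g) w = coeff_at f w + coeff_at g w" for f g :: "'a series" and w
    by (simp add: plus_series_def)
  have times: "coeff_at (f * g) w = shuffle_coeff w f g" for f g :: "'a series" and w
    by (simp add: times_series_def)
  have shift_plus: "shift x (f + g) = shift x f + shift x g" for f g :: "'a series" and x
    by (rule series_eqI) (simp add: plus)
  have shift_times: "shift x (f * g) = shift x f * g + f * shift x g" for f g :: "'a series" and x
    by (rule series_eqI) (simp add: plus times)
  have dist: "shuffle_coeff w (f + g) h = shuffle_coeff w f h + shuffle_coeff w g h"
    for f g h :: "'a series" and w
    by (induction w arbitrary: f g h) (simp_all add: plus shift_plus algebra_simps)
  have comm: "shuffle_coeff w f g = shuffle_coeff w g f" for f g :: "'a series" and w
    by (induction w arbitrary: f g) (simp_all add: algebra_simps)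
  have dist': "shuffle_coeff w h (f + g) = shuffle_coeff w h f + shuffle_coeff w h g"
    for f g h :: "'a series" and w
    by (simp add: comm[of w h] dist)
  have assoc: "shuffle_coeff w (f * g) h = shuffle_coeff w f (g * h)" for f g h :: "'a series" and w
    by (induction w arbitrary: f g h) (simp_all add: times shift_times dist dist')
  have shift_one: "shift x 1 = (0 :: 'a series)" for x
    by (rule series_eqI) (simp add: one_series_def zero_series_def)
  have zero: "shuffle_coeff w 0 f = 0" for f :: "'a series" and w
  proof (induction w arbitrary: f)
    case (Cons x w)
    have "shift x 0 = (0 :: 'a series)" by (rule series_eqI) (simp add: zero_series_def)
    then show ?case using Cons by simp
  qed (simp add: zero_series_def)
  have one: "shuffle_coeff w 1 f = coeff_at f w" for f :: "'a series" and w
    by (induction w arbitrary: f) (simp_all add: shift_one zero, simp add: one_series_def)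
  fix f g h :: "'a series"
  show "f * g * h = f * (g * h)" by (rule series_eqI) (simp add: times assoc)
  show "f * g = g * f" by (rule series_eqI) (simp add: times comm)
  show "1 * f = f" by (rule series_eqI) (simp add: times one)
  show "(f + g) * h = f * h + g * h" by (rule series_eqI) (simp add: times plus dist)
  show "(0 :: 'a series) \<noteq> 1"
    by (auto simp: zero_series_def one_series_def fun_eq_iff)
qed (auto intro!: series_eqI simp: plus_series_def minus_series_def uminus_series_def zero_series_def)

end

lemma coeff_at_simps [simp]:
  "coeff_at 0 w = 0" "coeff_at 1 w = (if w = [] then 1 else 0)"
  "coeff_at (f + g) w = coeff_at f w + coeff_at g w"
  "coeff_at (f - g) w = coeff_at f w - coeff_at g w"
  "coeff_at (- f) w = - coeff_at f w"
  by (simp_all add: zero_series_def one_series_def plus_series_def minus_series_def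
      uminus_series_def)

lemma coeff_at_mult_Nil [simp]: "coeff_at (f * g) [] = coeff_at f [] * coeff_at g []"
  by (simp add: times_series_def)

lemma coeff_at_mult_Cons [simp]:
  "coeff_at (f * g) (x # w) = coeff_at (shift x f * g) w + coeff_at (f * shift x g) w"
  by (simp add: times_series_def)

lemma shift_simps [simp]:
  "shift x 0 = 0" "shift x 1 = 0" "shift x (f + g) = shift x f + shift x g"
  "shift x (f - g) = shift x f - shift x g" "shift x (- f) = - shift x f"
  by (rule series_eqI; simp)+

lemma shift_mult [simp]: "shift x (f * g) = shift x f * g + f * shift x g"
  by (rule series_eqI) simp

definition const_series :: "complex \<Rightarrow> 'a series"
  where "const_series c = Series (\<lambda>w. if w = [] then c else 0)"

lemma coeff_at_const [simp]: "coeff_at (const_series c) w = (if w = [] then c else 0)"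
  by (simp add: const_series_def)

lemma shift_const [simp]: "shift x (const_series c) = 0"
  by (rule series_eqI) simp

lemma coeff_at_const_mult [simp]: "coeff_at (const_series c * f) w = c * coeff_at f w"
  by (induction w arbitrary: f) simp_all

lemma const_series_simps [simp]:
  "const_series 0 = 0" "const_series 1 = 1"
  by (rule series_eqI; simp)+

lemma const_series_add: "const_series (a + b) = const_series a + const_series b"
  and const_series_mult: "const_series (a * b) = const_series a * const_series b"
  by (rule series_eqI; simp)+

lemma coeff_at_sum [simp]: "coeff_at (sum f A) w = (\<Sum>a\<in>A. coeff_at (f a) w)"
  by (induction A rule: infinite_finite_induct) simp_all

text \<open>Taking, for one shift after the other, the largest shift-stable ideal inside a prime ideal
  yields prime ideals that miss a given series once the word is chosen well. This makes the
  shuffle algebra an integral domain.\<close>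

primrec iterated_core :: "'a list \<Rightarrow> 'a series set" where
  "iterated_core [] = {f. coeff_at f [] = 0}"
| "iterated_core (x # w) = {f. \<forall>n. (shift x ^^ n) f \<in> iterated_core w}"

section \<open>Iterated derivatives and the primality of iterated cores\<close>

lemma funpow_shift_add: "(shift x ^^ n) (f + g) = (shift x ^^ n) f + (shift x ^^ n) g"
  by (induction n) simp_all

lemma funpow_shift_zero [simp]: "(shift x ^^ n) 0 = 0"
  by (induction n) simp_all

lemma funpow_shift_mult:
  "(shift x ^^ n) (f * g) = (\<Sum>k\<le>n. of_nat (n choose k) * (shift x ^^ k) f * (shift x ^^ (n - k)) g)"
proof (induction n arbitrary: f g)
  case 0
  then show ?case by simp
next
  case (Suc n)
  define F where "F k = (shift x ^^ k) f" for k
  define G where "G k = (shift x ^^ k) g" for k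
  have "(shift x ^^ Suc n) (f * g) = (shift x ^^ n) (shift x f * g) + (shift x ^^ n) (f * shift x g)"
    by (simp add: funpow_Suc_right funpow_shift_add del: funpow.simps)
  also have "\<dots> = (\<Sum>k\<le>n. of_nat (n choose k) * F (Suc k) * G (n - k)) +
      (\<Sum>k\<le>n. of_nat (n choose k) * F k * G (Suc (n - k)))"
    by (simp add: Suc.IH F_def G_def funpow_Suc_right del: funpow.simps)
  also have "(\<Sum>k\<le>n. of_nat (n choose k) * F k * G (Suc (n - k))) =
      (\<Sum>k\<le>Suc n. of_nat (n choose k) * F k * G (Suc n - k))"
    by (simp add: Suc_diff_le binomial_eq_0)
  also have "\<dots> = F 0 * G (Suc n) + (\<Sum>k\<le>n. of_nat (n choose Suc k) * F (Suc k) * G (n - k))"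
    by (subst sum.atMost_Suc_shift) simp
  also have "(\<Sum>k\<le>n. of_nat (n choose k) * F (Suc k) * G (n - k)) + \<dots> =
      F 0 * G (Suc n) + (\<Sum>k\<le>n. of_nat (Suc n choose Suc k) * F (Suc k) * G (n - k))"
    by (simp add: algebra_simps sum.distrib)
  also have "\<dots> = (\<Sum>k\<le>Suc n. of_nat (Suc n choose k) * F k * G (Suc n - k))"
    by (subst sum.atMost_Suc_shift) simp
  finally show ?case by (simp add: F_def G_def)
qed

lemma iterated_core_ideal:
  "0 \<in> iterated_core w \<and> (\<forall>f g. f \<in> iterated_core w \<longrightarrow> g \<in> iterated_core w \<longrightarrow> f + g \<in> iterated_core w) \<and>
   (\<forall>f g. g \<in> iterated_core w \<longrightarrow> f * g \<in> iterated_core w)"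
proof (induction w)
  case Nil
  then show ?case by simp
next
  case (Cons x w)
  have sum: "(\<Sum>a\<in>A. h a) \<in> iterated_core w" if "\<And>a. a \<in> A \<Longrightarrow> h a \<in> iterated_core w"
    for A :: "nat set" and h
    using that Cons by (induction A rule: infinite_finite_induct) auto
  have "f * g \<in> iterated_core (x # w)" if g: "g \<in> iterated_core (x # w)" for f g
    using g Cons by (auto simp: funpow_shift_mult mult.assoc intro!: sum)
  then show ?case using Cons by (auto simp: funpow_shift_add)
qed

lemma iterated_core_zero: "0 \<in> iterated_core w"
  and iterated_core_add: "f \<in> iterated_core w \<Longrightarrow> g \<in> iterated_core w \<Longrightarrow> f + g \<in> iterated_core w"
  and iterated_core_mult: "g \<in> iterated_core w \<Longrightarrow> f * g \<in> iterated_core w"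
  by (simp_all add: iterated_core_ideal)

lemma iterated_core_sum:
  "(\<And>a. a \<in> A \<Longrightarrow> h a \<in> iterated_core w) \<Longrightarrow> (\<Sum>a\<in>A. h a) \<in> iterated_core w"
  by (induction A rule: infinite_finite_induct) (simp_all add: iterated_core_zero iterated_core_add)

text \<open>Makes the binomial coefficients of the Leibniz formula invertible scalars.
  Characteristic zero is essential here: in characteristic p the p-th shuffle power of a letter is
  zero.\<close>

lemma const_series_of_nat: "const_series (of_nat k) = of_nat k"
  by (induction k) (simp_all add: const_series_add)

lemma iterated_core_prime:
  "f * g \<in> iterated_core w \<Longrightarrow> f \<in> iterated_core w \<or> g \<in> iterated_core w"
proof (induction w arbitrary: f g)
  case Nil
  then show ?case by simp
next
  case (Cons x w)
  show ?case
  proof (rule ccontr)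
    \<comment> \<open>In the Leibniz formula for the first exponents at which the derivatives leave the ideal all
      terms but one lie in the ideal, and its binomial coefficient is invertible.\<close>
    assume neg: "\<not> ?thesis"
    have ex1: "\<exists>n. (shift x ^^ n) f \<notin> iterated_core w" using neg by (simp del: funpow.simps)
    have ex2: "\<exists>n. (shift x ^^ n) g \<notin> iterated_core w" using neg by (simp del: funpow.simps)
    define n where "n = (LEAST n. (shift x ^^ n) f \<notin> iterated_core w)"
    define m where "m = (LEAST n. (shift x ^^ n) g \<notin> iterated_core w)"
    have n: "(shift x ^^ n) f \<notin> iterated_core w"
      unfolding n_def by (rule LeastI_ex[OF ex1])
    have n': "(shift x ^^ k) f \<in> iterated_core w" if "k < n" for k
      using not_less_Least[OF that[unfolded n_def]] by blast
    have m: "(shift x ^^ m) g \<notin> iterated_core w"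
      unfolding m_def by (rule LeastI_ex[OF ex2])
    have m': "(shift x ^^ k) g \<in> iterated_core w" if "k < m" for k
      using not_less_Least[OF that[unfolded m_def]] by blast
    define t where "t k = of_nat (n + m choose k) * (shift x ^^ k) f * (shift x ^^ (n + m - k)) g" for k
    define r where "r = (\<Sum>k\<in>{..n + m} - {n}. t k)"
    have lower: "t k \<in> iterated_core w" if "k \<in> {..n + m} - {n}" for k
    proof (cases "k < n")
      case True
      have "t k = (of_nat (n + m choose k) * (shift x ^^ (n + m - k)) g) * (shift x ^^ k) f"
        by (simp only: t_def mult_ac)
      then show ?thesis by (simp only: iterated_core_mult[OF n'[OF True]])
    next
      case False
      then have "n + m - k < m" using that by auto
      then show ?thesis unfolding t_def by (intro iterated_core_mult m')
    qed
    have "(shift x ^^ (n + m)) (f * g) \<in> iterated_core w"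
      using Cons.prems by (simp del: funpow.simps)
    then have "(\<Sum>k\<le>n + m. t k) \<in> iterated_core w"
      by (simp only: funpow_shift_mult t_def)
    also have "(\<Sum>k\<le>n + m. t k) = t n + r"
      unfolding r_def by (rule sum.remove) auto
    finally have "t n + r \<in> iterated_core w" .
    moreover have "r \<in> iterated_core w"
      unfolding r_def by (rule iterated_core_sum) (rule lower)
    ultimately have "(t n + r) + (-1) * r \<in> iterated_core w"
      by (rule iterated_core_add[OF _ iterated_core_mult])
    then have t: "t n \<in> iterated_core w" by simp
    define c where "c = complex_of_nat (n + m choose n)"
    have tn: "t n = const_series c * ((shift x ^^ n) f * (shift x ^^ m) g)"
      by (simp add: t_def c_def const_series_of_nat mult.assoc)
    have "c \<noteq> 0" by (simp add: c_def)
    then have "const_series (inverse c) * t n = (shift x ^^ n) f * (shift x ^^ m) g"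
      by (simp add: tn mult.assoc[symmetric] const_series_mult[symmetric])
    then have "(shift x ^^ n) f * (shift x ^^ m) g \<in> iterated_core w"
      using iterated_core_mult[OF t, of "const_series (inverse c)"] by (simp del: funpow.simps)
    then show False using Cons.IH n m by blast
  qed
qed

lemma iterated_core_Cons_subset: "iterated_core (x # w) \<subseteq> iterated_core w"
proof
  fix f assume "f \<in> iterated_core (x # w)"
  then have "(shift x ^^ 0) f \<in> iterated_core w" unfolding iterated_core.simps by blast
  then show "f \<in> iterated_core w" by simp
qed

lemma iterated_core_subset_Nil: "iterated_core w \<subseteq> iterated_core []"
proof (induction w)
  case (Cons x w)
  then show ?case using iterated_core_Cons_subset by (rule subset_trans[rotated])
qed simp

text \<open>Concatenation yields one prime ideal inside those of both words, hence one that misses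
  both factors of a product.\<close>

lemma iterated_core_append:
  "iterated_core (u @ v) \<subseteq> iterated_core u" "iterated_core (u @ v) \<subseteq> iterated_core v"
proof -
  show "iterated_core (u @ v) \<subseteq> iterated_core u"
  proof (induction u)
    case Nil
    then show ?case using iterated_core_subset_Nil by simp
  next
    case (Cons x u)
    then show ?case by (simp add: subset_iff)
  qed
  show "iterated_core (u @ v) \<subseteq> iterated_core v"
  proof (induction u)
    case (Cons x u)
    then show ?case using iterated_core_Cons_subset[of x "u @ v"] by simp
  qed simp
qed

lemma iterated_core_coeff: "f \<in> iterated_core w \<Longrightarrow> coeff_at f w = 0"
proof (induction w arbitrary: f)
  case (Cons x w)
  then have "(shift x ^^ 1) f \<in> iterated_core w" unfolding iterated_core.simps by blast
  then show ?case using Cons.IH[of "shift x f"] by simp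
qed simp

instance series :: (type) idom
proof
  fix f g :: "'a series"
  assume "f \<noteq> 0" "g \<noteq> 0"
  then obtain u v where "coeff_at f u \<noteq> 0" "coeff_at g v \<noteq> 0"
    using series_eqI[of f 0] series_eqI[of g 0] by auto
  then have "f \<notin> iterated_core (u @ v)" "g \<notin> iterated_core (u @ v)"
    using iterated_core_coeff iterated_core_append by blast+
  then have "f * g \<notin> iterated_core (u @ v)" using iterated_core_prime by blast
  then show "f * g \<noteq> 0" using iterated_core_zero by metis
qed


section \<open>Vector spaces of countable dimension\<close>

lemma (in c_algebra) c_smult_closed [simp, intro]: "x \<in> carrier A \<Longrightarrow> c \<odot> x \<in> carrier A"
  and c_smult_add_left: "x \<in> carrier A \<Longrightarrow> (b + c) \<odot> x = b \<odot> x \<oplus> c \<odot> x"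
  and c_smult_add_right: "x \<in> carrier A \<Longrightarrow> y \<in> carrier A \<Longrightarrow> c \<odot> (x \<oplus> y) = c \<odot> x \<oplus> c \<odot> y"
  and c_smult_smult: "x \<in> carrier A \<Longrightarrow> b \<odot> (c \<odot> x) = (b * c) \<odot> x"
  and c_smult_one [simp]: "x \<in> carrier A \<Longrightarrow> 1 \<odot> x = x"
  and c_smult_zero_left [simp]: "x \<in> carrier A \<Longrightarrow> 0 \<odot> x = \<zero>"
  and c_smult_zero_right [simp]: "c \<odot> \<zero> = \<zero>"
  using smult_closed[of c x] smult_l_distr[of b c x] smult_r_distr[of c x y]
    smult_assoc1[of b c x] smult_one[of x] smult_l_null[of x] smult_r_null[of c]
  by simp_all

lemma (in c_algebra) c_smult_minus_one: "x \<in> carrier A \<Longrightarrow> (-1) \<odot> x = \<ominus> x"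
  using c_smult_add_left[of x "-1" 1] by (simp add: minus_equality)

lemma (in c_algebra) c_smult_finsum:
  "finite F \<Longrightarrow> f \<in> F \<rightarrow> carrier A \<Longrightarrow> c \<odot> (\<Oplus>i\<in>F. f i) = (\<Oplus>i\<in>F. c \<odot> f i)"
  using finsum_smult_ldistr[of F c f] by simp

text \<open>Gaussian elimination: multiples of a pivot \<open>y\<close> are subtracted to clear the
  last coordinate of the other vectors, and a relation among these lifts to all of
  \<open>F\<close>.\<close>

lemma linear_relation:
  fixes q :: "'x \<Rightarrow> nat \<Rightarrow> 'k::field"
  assumes "finite F" "n < card F"
  shows "\<exists>c. (\<exists>x\<in>F. c x \<noteq> 0) \<and> (\<forall>i<n. (\<Sum>x\<in>F. c x * q x i) = 0)"
  using assms
proof (induction n arbitrary: F q)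
  case 0
  then have "F \<noteq> {}" by auto
  then show ?case by (intro exI[of _ "\<lambda>_. 1"]) auto
next
  case (Suc n)
  show ?case
  proof (cases "\<forall>x\<in>F. q x n = 0")
    case True
    obtain c where "\<exists>x\<in>F. c x \<noteq> 0" "\<forall>i<n. (\<Sum>x\<in>F. c x * q x i) = 0"
      using Suc.IH[of F q] Suc.prems by auto
    then show ?thesis using True by (intro exI[of _ c]) (auto simp: less_Suc_eq)
  next
    case False
    then obtain y where y: "y \<in> F" "q y n \<noteq> 0" by auto
    define G where "G = F - {y}"
    have G: "finite G" "n < card G" "F = insert y G" "y \<notin> G"
      using Suc.prems y by (auto simp: G_def)
    obtain c where c: "\<exists>x\<in>G. c x \<noteq> 0"
      "\<And>i. i < n \<Longrightarrow> (\<Sum>x\<in>G. c x * (q x i - q x n / q y n * q y i)) = 0"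
      using Suc.IH[of G "\<lambda>x i. q x i - q x n / q y n * q y i"] G by auto
    \<comment> \<open>The coefficient of the pivot is chosen so that the last coordinate of the
      combination cancels.\<close>
    define d where "d x = (if x = y then - (\<Sum>x\<in>G. c x * q x n) / q y n else c x)" for x
    have sum: "(\<Sum>x\<in>F. d x * q x i) = (\<Sum>x\<in>G. c x * (q x i - q x n / q y n * q y i))" for i
    proof -
      have "(\<Sum>x\<in>F. d x * q x i) = d y * q y i + (\<Sum>x\<in>G. d x * q x i)"
        using G by simp
      also have "(\<Sum>x\<in>G. d x * q x i) = (\<Sum>x\<in>G. c x * q x i)"
        using G by (intro sum.cong) (auto simp: d_def)
      also have "d y * q y i + \<dots> = (\<Sum>x\<in>G. c x * (q x i - q x n / q y n * q y i))"
        by (simp add: d_def right_diff_distrib sum_subtractf sum_distrib_left sum_distrib_right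
            sum_divide_distrib mult_ac divide_inverse)
      finally show ?thesis .
    qed
    have "\<exists>x\<in>F. d x \<noteq> 0" using c(1) G by (auto simp: d_def)
    moreover have "(\<Sum>x\<in>F. d x * q x i) = 0" if "i < Suc n" for i
      using that c(2)[of i] y(2) unfolding sum by (cases "i = n") auto
    ultimately show ?thesis by blast
  qed
qed

text \<open>Countable dimension, phrased without a basis so that it passes to subalgebras at once.\<close>

definition uncountable_dependent :: "(complex, 'a) module \<Rightarrow> bool"
  where "uncountable_dependent R \<longleftrightarrow> (\<forall>\<Lambda> v. uncountable (\<Lambda> :: complex set) \<longrightarrow> v \<in> \<Lambda> \<rightarrow> carrier R \<longrightarrow>
    (\<exists>F c. finite F \<and> F \<subseteq> \<Lambda> \<and> (\<exists>l\<in>F. c l \<noteq> 0) \<and> (\<Oplus>\<^bsub>R\<^esub>l\<in>F. c l \<odot>\<^bsub>R\<^esub> v l) = \<zero>\<^bsub>R\<^esub>))"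

text \<open>No carrier condition occurs, so a set has the same span in a subalgebra as in the whole
  algebra, and closure properties follow by rule induction.\<close>

inductive_set c_span :: "(complex, 'a) module \<Rightarrow> 'a set \<Rightarrow> 'a set" for R B where
  zero: "\<zero>\<^bsub>R\<^esub> \<in> c_span R B"
| base: "b \<in> B \<Longrightarrow> b \<in> c_span R B"
| add: "x \<in> c_span R B \<Longrightarrow> y \<in> c_span R B \<Longrightarrow> x \<oplus>\<^bsub>R\<^esub> y \<in> c_span R B"
| smult: "x \<in> c_span R B \<Longrightarrow> c \<odot>\<^bsub>R\<^esub> x \<in> c_span R B"

section \<open>Linear combinations of an initial segment of a sequence\<close>

context c_algebra
begin

definition lincomb :: "(nat \<Rightarrow> 'a) \<Rightarrow> nat \<Rightarrow> (nat \<Rightarrow> complex) \<Rightarrow> 'a"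
  where "lincomb b n q = (\<Oplus>i\<in>{..<n}. q i \<odot> b i)"

lemma lincomb_closed [simp, intro]: "range b \<subseteq> carrier A \<Longrightarrow> lincomb b n q \<in> carrier A"
  unfolding lincomb_def by (rule finsum_closed) auto

lemma lincomb_add:
  assumes "range b \<subseteq> carrier A"
  shows "lincomb b n (\<lambda>i. q i + r i) = lincomb b n q \<oplus> lincomb b n r"
proof -
  have b: "b i \<in> carrier A" for i using assms by auto
  have "lincomb b n (\<lambda>i. q i + r i) = (\<Oplus>i\<in>{..<n}. q i \<odot> b i \<oplus> r i \<odot> b i)"
    unfolding lincomb_def by (rule finsum_cong') (use b in \<open>auto simp: c_smult_add_left\<close>)
  then show ?thesis unfolding lincomb_def using b by (simp add: finsum_addf Pi_def)
qed

lemma lincomb_smult: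
  assumes "range b \<subseteq> carrier A"
  shows "lincomb b n (\<lambda>i. c * q i) = c \<odot> lincomb b n q"
proof -
  have b: "b i \<in> carrier A" for i using assms by auto
  have "lincomb b n (\<lambda>i. c * q i) = (\<Oplus>i\<in>{..<n}. c \<odot> (q i \<odot> b i))"
    unfolding lincomb_def by (rule finsum_cong') (use b in \<open>auto simp: c_smult_smult\<close>)
  then show ?thesis unfolding lincomb_def using b by (simp add: c_smult_finsum Pi_def)
qed

lemma lincomb_cong: "range b \<subseteq> carrier A \<Longrightarrow> (\<And>i. i < n \<Longrightarrow> q i = r i) \<Longrightarrow> lincomb b n q = lincomb b n r"
  unfolding lincomb_def by (rule finsum_cong') auto

lemma lincomb_zero: "range b \<subseteq> carrier A \<Longrightarrow> lincomb b n (\<lambda>_. 0) = \<zero>"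
  unfolding lincomb_def by (subst finsum_cong'[of "{..<n}" _ "\<lambda>_. \<zero>"]) (auto intro!: c_smult_zero_left)

lemma lincomb_sum:
  assumes b: "range b \<subseteq> carrier A" and "finite F"
  shows "lincomb b n (\<lambda>i. \<Sum>x\<in>F. c x * q x i) = (\<Oplus>x\<in>F. c x \<odot> lincomb b n (q x))"
  using assms(2)
  by induction (use b in \<open>simp_all add: lincomb_zero lincomb_add lincomb_smult Pi_def\<close>)

lemma lincomb_Suc:
  "range b \<subseteq> carrier A \<Longrightarrow> lincomb b (Suc n) q = lincomb b n q \<oplus> q n \<odot> b n"
  unfolding lincomb_def
  by (subst lessThan_Suc, subst finsum_insert) (auto intro!: a_comm finsum_closed)

text \<open>Padding with zero coefficients brings two combinations to a common length.\<close>

lemma lincomb_mono: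
  assumes b: "range b \<subseteq> carrier A" and "n \<le> m"
  shows "lincomb b m (\<lambda>i. if i < n then q i else 0) = lincomb b n q"
  using assms(2)
proof (induction m rule: dec_induct)
  case base
  show ?case by (rule lincomb_cong[OF b]) simp
next
  case (step m)
  have "b m \<in> carrier A" using b by auto
  then show ?case using step lincomb_closed[OF b] by (simp add: lincomb_Suc[OF b])
qed

lemma lincomb_unit:
  assumes e: "range e \<subseteq> carrier A" and "j < d"
  shows "lincomb e d (\<lambda>i. if i = j then 1 else 0) = e j"
proof -
  have ej: "e j \<in> carrier A" using e by auto
  have "lincomb e d (\<lambda>i. if i = j then 1 else 0) =
      lincomb e d (\<lambda>i. if i < Suc j then (if i = j then 1 else 0) else 0)"
    by (rule lincomb_cong[OF e]) auto
  also have "\<dots> = lincomb e (Suc j) (\<lambda>i. if i = j then 1 else 0)"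
    by (rule lincomb_mono[OF e]) (use assms in simp)
  also have "\<dots> = lincomb e j (\<lambda>i. if i = j then 1 else 0) \<oplus> e j"
    using ej by (simp add: lincomb_Suc[OF e])
  also have "lincomb e j (\<lambda>i. if i = j then 1 else 0) = \<zero>"
    using lincomb_cong[OF e, of j "\<lambda>i. if i = j then 1 else 0" "\<lambda>_. 0"] lincomb_zero[OF e] by simp
  finally show ?thesis using ej by simp
qed

lemma c_span_lincomb:
  assumes b: "range b \<subseteq> carrier A" and "x \<in> c_span A (range b)"
  shows "\<exists>n q. x = lincomb b n q"
  using assms(2)
proof induction
  case zero
  then show ?case by (auto intro!: exI[of _ 0] simp: lincomb_def)
next
  case (base y)
  then obtain k where k: "y = b k" by auto
  then have "y = lincomb b (Suc k) (\<lambda>i. if i = k then 1 else 0)"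
    by (simp add: lincomb_unit[OF b])
  then show ?case by blast
next
  case (add x y)
  then obtain n q m r where x: "x = lincomb b n q" and y: "y = lincomb b m r" by blast
  let ?N = "max n m"
  have "x \<oplus> y = lincomb b ?N (\<lambda>i. (if i < n then q i else 0) + (if i < m then r i else 0))"
    using lincomb_mono[OF b, of n ?N q] lincomb_mono[OF b, of m ?N r] by (simp add: x y lincomb_add[OF b])
  then show ?case by blast
next
  case (smult x c)
  then show ?case using lincomb_smult[OF b] by metis
qed

lemma c_span_closed: "x \<in> c_span A B \<Longrightarrow> B \<subseteq> carrier A \<Longrightarrow> x \<in> carrier A"
  by (induction rule: c_span.induct) auto

text \<open>Each vector uses only an initial segment of the enumerated spanning set. Among
  uncountably many vectors infinitely many share one segment length k, and k + 1 vectors in k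
  coordinates are dependent.\<close>

lemma uncountable_dependentI:
  assumes "countable B" "B \<subseteq> carrier A" "carrier A \<subseteq> c_span A B"
  shows "uncountable_dependent A"
  unfolding uncountable_dependent_def
proof (intro allI impI)
  fix L :: "complex set" and v
  assume L: "uncountable L" and v: "v \<in> L \<rightarrow> carrier A"
  \<comment> \<open>Inserting zero makes the enumerated set nonempty without changing its
    span.\<close>
  define b where "b = from_nat_into (insert \<zero> B)"
  have range_b: "range b = insert \<zero> B"
    unfolding b_def by (rule range_from_nat_into) (use assms in auto)
  then have b: "range b \<subseteq> carrier A" using assms by auto
  have mono: "c_span A B \<subseteq> c_span A (insert \<zero> B)"
  proof
    fix x assume "x \<in> c_span A B"
    then show "x \<in> c_span A (insert \<zero> B)" by induction (auto intro: c_span.intros)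
  qed
  have "\<exists>n q. v l = lincomb b n q" if "l \<in> L" for l
  proof (rule c_span_lincomb[OF b])
    show "v l \<in> c_span A (range b)" using range_b mono v that assms(3) by auto
  qed
  then obtain n q where nq: "\<And>l. l \<in> L \<Longrightarrow> v l = lincomb b (n l) (q l)" by metis
  have "\<exists>k. infinite {l \<in> L. n l = k}"
  proof (rule ccontr)
    assume "\<nexists>k. infinite {l \<in> L. n l = k}"
    then have "countable (\<Union>k. {l \<in> L. n l = k})"
      by (intro countable_UN) (auto intro: countable_finite)
    moreover have "(\<Union>k. {l \<in> L. n l = k}) = L" by auto
    ultimately show False using L by simp
  qed
  then obtain k where "infinite {l \<in> L. n l = k}" by auto
  then obtain F where F: "finite F" "card F = Suc k" "F \<subseteq> {l \<in> L. n l = k}"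
    using infinite_arbitrarily_large by blast
  obtain c where c: "\<exists>x\<in>F. c x \<noteq> 0" "\<forall>i<k. (\<Sum>x\<in>F. c x * q x i) = 0"
    using linear_relation[of F k q] F by auto
  have "(\<Oplus>l\<in>F. c l \<odot> v l) = (\<Oplus>l\<in>F. c l \<odot> lincomb b k (q l))"
    by (rule finsum_cong') (use F nq b in auto)
  also have "\<dots> = lincomb b k (\<lambda>i. \<Sum>x\<in>F. c x * q x i)"
    by (rule lincomb_sum[OF b F(1), symmetric])
  also have "\<dots> = \<zero>" using lincomb_cong[OF b, of k _ "\<lambda>_. 0"] c(2) lincomb_zero[OF b] by simp
  finally have "(\<Oplus>l\<in>F. c l \<odot> v l) = \<zero>" .
  moreover have "F \<subseteq> L" using F(3) by auto
  ultimately show "\<exists>F c. finite F \<and> F \<subseteq> L \<and> (\<exists>l\<in>F. c l \<noteq> 0) \<and> (\<Oplus>l\<in>F. c l \<odot> v l) = \<zero>"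
    using F(1) c(1) by (intro exI[of _ F] exI[of _ c]) simp
qed

lemma finsum_sub_alg:
  assumes "c_subalgebra T A" "finite F" "f \<in> F \<rightarrow> T"
  shows "(\<Oplus>\<^bsub>sub_alg A T\<^esub>i\<in>F. f i) = (\<Oplus>i\<in>F. f i)"
proof -
  have T: "subring T A" using assms(1) by (simp add: c_subalgebra_def)
  then interpret T: ring "sub_alg A T" by (rule subring_is_ring)
  have sub: "T \<subseteq> carrier A" using subringE(1)[OF T] .
  show ?thesis using assms(2,3)
  proof (induction F)
    case (insert i F)
    have "f \<in> F \<rightarrow> carrier A" "f i \<in> carrier A" using insert sub by auto
    then show ?case using insert by (simp add: T.finsum_insert)
  qed simp
qed

lemma uncountable_dependent_subalgebra:
  assumes T: "c_subalgebra T A" and "uncountable_dependent A"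
  shows "uncountable_dependent (sub_alg A T)"
  unfolding uncountable_dependent_def
proof (intro allI impI)
  fix L :: "complex set" and v
  assume L: "uncountable L" and v: "v \<in> L \<rightarrow> carrier (sub_alg A T)"
  have sub: "T \<subseteq> carrier A" "\<And>c x. x \<in> T \<Longrightarrow> c \<odot> x \<in> T"
    using T submoduleE(1,4)[of T] by (auto simp: c_subalgebra_def)
  then have "v \<in> L \<rightarrow> carrier A" using v by auto
  from assms(2)[unfolded uncountable_dependent_def, rule_format, OF L this]
  obtain F c where F: "finite F" "F \<subseteq> L" "\<exists>l\<in>F. c l \<noteq> 0" "(\<Oplus>l\<in>F. c l \<odot> v l) = \<zero>"
    by auto
  have "(\<Oplus>\<^bsub>sub_alg A T\<^esub>l\<in>F. c l \<odot> v l) = (\<Oplus>l\<in>F. c l \<odot> v l)"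
    by (rule finsum_sub_alg[OF T F(1)]) (use v F(2) sub(2) in \<open>auto simp: Pi_def\<close>)
  then show "\<exists>F c. finite F \<and> F \<subseteq> L \<and> (\<exists>l\<in>F. c l \<noteq> 0) \<and>
      (\<Oplus>\<^bsub>sub_alg A T\<^esub>l\<in>F. c l \<odot>\<^bsub>sub_alg A T\<^esub> v l) = \<zero>\<^bsub>sub_alg A T\<^esub>"
    using F by (intro exI[of _ F] exI[of _ c]) simp
qed

end


section \<open>Characters of commutative algebras of countable dimension\<close>

context c_algebra
begin

lemma c_smult_eq_mult: "x \<in> carrier A \<Longrightarrow> c \<odot> x = (c \<odot> \<one>) \<otimes> x"
  by (simp add: smult_mult_left)

lemma scalar_mult: "(b * c) \<odot> \<one> = (b \<odot> \<one>) \<otimes> (c \<odot> \<one>)"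
  by (simp add: smult_mult_left c_smult_smult)

lemma scalar_diff: "(b - c) \<odot> \<one> = b \<odot> \<one> \<ominus> c \<odot> \<one>"
  using c_smult_add_left[of \<one> b "-c"] c_smult_smult[of \<one> "-1" c] c_smult_minus_one[of "c \<odot> \<one>"]
  by (simp add: a_minus_def)

text \<open>Words over a countable set are countable, and concatenation closes the monomials under
  multiplication. Words rather than exponents are used because the algebra may be
  noncommutative.\<close>

lemma countable_generated_subalgebra:
  assumes "countable G" "G \<subseteq> carrier A"
  shows "\<exists>B. countable B \<and> B \<subseteq> carrier A \<and> G \<subseteq> c_span A B \<and> c_subalgebra (c_span A B) A"
proof -
  define mon where "mon ws = foldr (\<otimes>) ws \<one>" for ws
  define B where "B = mon ` lists G"
  have mon_closed: "mon ws \<in> carrier A" if "ws \<in> lists G" for ws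
    using that assms(2) by (induction ws) (auto simp: mon_def)
  have mon_Cons: "mon (g # ws) = g \<otimes> mon ws" for g ws by (simp add: mon_def)
  have mon_append: "mon (us @ vs) = mon us \<otimes> mon vs" if "us \<in> lists G" "vs \<in> lists G" for us vs
    using that
  proof (induction us)
    case Nil
    then show ?case using mon_closed by (simp add: mon_def)
  next
    case (Cons g us)
    then have "g \<in> carrier A" using assms(2) by auto
    then show ?case using Cons mon_closed by (simp add: mon_Cons m_assoc)
  qed
  have B: "B \<subseteq> carrier A" using mon_closed by (auto simp: B_def)
  have closed: "x \<in> carrier A" if "x \<in> c_span A B" for x using c_span_closed[OF that B] .
  have "g \<in> B" if "g \<in> G" for g
  proof -
    have "g \<in> carrier A" using that assms(2) by auto
    then have "mon [g] = g" by (simp add: mon_def)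
    then show ?thesis using that by (metis B_def imageI Cons_in_lists_iff lists.Nil)
  qed
  then have G: "G \<subseteq> c_span A B" by (auto intro: c_span.base)
  have one: "\<one> \<in> c_span A B"
  proof (rule c_span.base)
    have "mon [] = \<one>" by (simp add: mon_def)
    then show "\<one> \<in> B" by (metis B_def imageI lists.Nil)
  qed
  have mult1: "mon ws \<otimes> y \<in> c_span A B" if "y \<in> c_span A B" "ws \<in> lists G" for ws y
    using that
  proof induction
    case (base b)
    then obtain vs where "vs \<in> lists G" "b = mon vs" by (auto simp: B_def)
    then have "mon ws \<otimes> b \<in> B" using base mon_append[of ws vs] by (metis B_def imageI append_in_lists_conv)
    then show ?case by (rule c_span.base)
  qed (use closed mon_closed in \<open>auto simp: r_distr smult_mult_right intro: c_span.intros\<close>)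
  have mult: "x \<otimes> y \<in> c_span A B" if "x \<in> c_span A B" "y \<in> c_span A B" for x y
    using that
  proof induction
    case (base b)
    then show ?case using mult1 by (auto simp: B_def)
  qed (use closed in \<open>auto simp: l_distr smult_mult_left intro: c_span.intros\<close>)
  have minus: "\<ominus> x \<in> c_span A B" if "x \<in> c_span A B" for x
    using c_span.smult[OF that, of "-1"] c_smult_minus_one closed[OF that] by simp
  have "subring (c_span A B) A"
    by (rule subringI) (use closed one mult minus in \<open>auto intro: c_span.add\<close>)
  moreover have "submodule (c_span A B) complex_ring A"
    by (rule submoduleI) (use closed minus in \<open>auto intro: c_span.intros\<close>)
  moreover have "countable B" unfolding B_def using assms(1) by simp
  ultimately show ?thesis using B G by (auto simp: c_subalgebra_def)
qed

end

definition character :: "(complex, 'a) module \<Rightarrow> ('a \<Rightarrow> complex) \<Rightarrow> bool"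
  where "character R \<chi> \<longleftrightarrow> \<chi> \<one>\<^bsub>R\<^esub> = 1 \<and>
    (\<forall>a\<in>carrier R. \<forall>b\<in>carrier R. \<chi> (a \<oplus>\<^bsub>R\<^esub> b) = \<chi> a + \<chi> b \<and> \<chi> (a \<otimes>\<^bsub>R\<^esub> b) = \<chi> a * \<chi> b) \<and>
    (\<forall>c. \<forall>a\<in>carrier R. \<chi> (c \<odot>\<^bsub>R\<^esub> a) = c * \<chi> a)"

locale comm_c_algebra = c_algebra R + cring R for R :: "(complex, 'a) module" (structure)
begin

text \<open>Horner's rule. The polynomials are type-class ones, so that degrees and the fundamental
  theorem of algebra apply to them, while the values lie in a record ring.\<close>

definition poly_eval :: "'a \<Rightarrow> complex poly \<Rightarrow> 'a"
  where "poly_eval u p = fold_coeffs (\<lambda>a r. a \<odot> \<one> \<oplus> u \<otimes> r) p \<zero>"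

lemma poly_eval_0 [simp]: "poly_eval u 0 = \<zero>"
  by (simp add: poly_eval_def)

lemma poly_eval_pCons [simp]:
  "u \<in> carrier R \<Longrightarrow> poly_eval u (pCons a p) = a \<odot> \<one> \<oplus> u \<otimes> poly_eval u p"
  by (cases "a = 0 \<and> p = 0") (auto simp: poly_eval_def fold_coeffs_pCons_not_0_0_eq)

lemma poly_eval_closed [simp, intro]: "u \<in> carrier R \<Longrightarrow> poly_eval u p \<in> carrier R"
  by (induction p) auto

lemma poly_eval_add: "u \<in> carrier R \<Longrightarrow> poly_eval u (p + q) = poly_eval u p \<oplus> poly_eval u q"
  by (induction p q rule: poly_induct2) (simp_all add: c_smult_add_left r_distr a_ac)

lemma poly_eval_smult: "u \<in> carrier R \<Longrightarrow> poly_eval u (smult c p) = c \<odot> poly_eval u p"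
  by (induction p) (simp_all add: c_smult_add_right c_smult_smult smult_mult_right)

lemma poly_eval_mult: "u \<in> carrier R \<Longrightarrow> poly_eval u (p * q) = poly_eval u p \<otimes> poly_eval u q"
proof (induction p)
  case (pCons a p)
  then show ?case
    by (simp add: poly_eval_add poly_eval_smult l_distr m_assoc c_smult_eq_mult[of "poly_eval u q"])
qed simp

lemma poly_eval_linear: "u \<in> carrier R \<Longrightarrow> poly_eval u [:- l, 1:] = u \<ominus> l \<odot> \<one>"
  using scalar_diff[of 0 l] by (simp add: a_minus_def a_comm)

text \<open>Over the complex numbers \<open>p\<close> splits into a nonzero constant, whose value is
  a unit, and linear factors, whose values avoid the prime by hypothesis.\<close>

lemma poly_eval_not_in_prime:
  assumes q: "primeideal q R" and u: "u \<in> carrier R"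
    and no: "\<And>l. u \<ominus> l \<odot> \<one> \<notin> q" and "p \<noteq> 0"
  shows "poly_eval u p \<notin> q"
  using \<open>p \<noteq> 0\<close>
proof (induction "degree p" arbitrary: p)
  case 0
  interpret q: primeideal q R by fact
  obtain a where a: "p = [:a:]" "a \<noteq> 0" using 0 by (metis degree_0_id pCons_eq_0_iff)
  show ?case
  proof
    assume "poly_eval u p \<in> q"
    then have "a \<odot> \<one> \<in> q" using u a by simp
    then have "(inverse a \<odot> \<one>) \<otimes> (a \<odot> \<one>) \<in> q" by (simp add: q.I_l_closed)
    then have "\<one> \<in> q" using a scalar_mult[of "inverse a" a] by simp
    then show False using q.I_notcarr q.one_imp_carrier by simp
  qed
next
  case (Suc n)
  interpret q: primeideal q R by fact
  have "\<not> constant (poly p)" using Suc.hyps(2) by (simp add: constant_degree)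
  then obtain z where "poly p z = 0" using fundamental_theorem_of_algebra by blast
  then obtain r where r: "p = [:- z, 1:] * r" by (metis dvdE poly_eq_0_iff_dvd)
  have "r \<noteq> 0" using r Suc.prems by auto
  moreover have "n = degree r" using Suc.hyps(2) \<open>r \<noteq> 0\<close> unfolding r by (subst (asm) degree_mult_eq) auto
  ultimately have IH: "poly_eval u r \<notin> q" using Suc.hyps(1) by blast
  show ?case
  proof
    assume "poly_eval u p \<in> q"
    then have "(u \<ominus> z \<odot> \<one>) \<otimes> poly_eval u r \<in> q"
      unfolding r poly_eval_mult[OF u] poly_eval_linear[OF u] .
    then show False using q.I_prime[of "u \<ominus> z \<odot> \<one>" "poly_eval u r"] no IH u by auto
  qed
qed

text \<open>If no \<open>u - l\<close> lies in \<open>q\<close>, then uncountably many of them divide one and the same \<open>t\<close>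
  modulo \<open>q\<close>. A linear relation between the quotients, cleared of denominators, is an algebraic
  equation for \<open>u\<close> modulo \<open>q\<close>, and its linear factors give the contradiction.\<close>

lemma scalar_mod_prime:
  assumes q: "primeideal q R" and dep: "uncountable_dependent R"
    and S: "countable S" "S \<inter> q = {}" "S \<subseteq> carrier R"
    and inv: "\<And>u. u \<in> carrier R \<Longrightarrow> u \<notin> q \<Longrightarrow> \<exists>i\<in>q. \<exists>v\<in>carrier R. i \<oplus> v \<otimes> u \<in> S"
    and u: "u \<in> carrier R"
  shows "\<exists>l. u \<ominus> l \<odot> \<one> \<in> q"
proof (rule ccontr)
  assume "\<nexists>l. u \<ominus> l \<odot> \<one> \<in> q"
  then have no: "u \<ominus> l \<odot> \<one> \<notin> q" for l by blast
  interpret q: primeideal q R by fact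
  have "\<exists>i v. i \<in> q \<and> v \<in> carrier R \<and> i \<oplus> v \<otimes> (u \<ominus> l \<odot> \<one>) \<in> S" for l
    using inv[of "u \<ominus> l \<odot> \<one>"] no[of l] u by auto
  then obtain i v where iv: "\<And>l. i l \<in> q" "\<And>l. v l \<in> carrier R"
      "\<And>l. i l \<oplus> v l \<otimes> (u \<ominus> l \<odot> \<one>) \<in> S"
    by metis
  define s where "s l = i l \<oplus> v l \<otimes> (u \<ominus> l \<odot> \<one>)" for l
  have "\<exists>t\<in>S. uncountable {l. s l = t}"
  proof (rule ccontr)
    assume "\<not> ?thesis"
    then have "countable (\<Union>t\<in>S. {l. s l = t})" using S(1) by (intro countable_UN) auto
    moreover have "(\<Union>t\<in>S. {l. s l = t}) = UNIV" using iv(3) by (auto simp: s_def)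
    ultimately show False using uncountable_UNIV_complex by simp
  qed
  then obtain t where t: "t \<in> S" "uncountable {l. s l = t}" by blast
  have tc: "t \<in> carrier R" using t S by auto
  have "v \<in> {l. s l = t} \<rightarrow> carrier R" using iv by auto
  from dep[unfolded uncountable_dependent_def, rule_format, OF t(2) this]
  obtain F c where F: "finite F" "F \<subseteq> {l. s l = t}" "\<exists>l\<in>F. c l \<noteq> 0" "(\<Oplus>l\<in>F. c l \<odot> v l) = \<zero>"
    by auto
  \<comment> \<open>\<open>Q k\<close> is \<open>P\<close> without its factor at \<open>k\<close>:
    modulo \<open>q\<close> the element \<open>v k\<close> is the fraction t / (u - k), and
    multiplying by \<open>P\<close> clears its denominator.\<close>
  define Q where "Q k = (\<Prod>j\<in>F - {k}. [:- j, 1:])" for k :: complex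
  define P where "P = (\<Prod>j\<in>F. [:- j, 1:])"
  have PQ: "P = [:- k, 1:] * Q k" if "k \<in> F" for k
    unfolding P_def Q_def using F(1) that by (simp add: prod.remove)
  have rel: "t \<otimes> poly_eval u (Q k) = poly_eval u P \<otimes> v k \<oplus> i k \<otimes> poly_eval u (Q k)" if "k \<in> F" for k
  proof -
    have t: "t = i k \<oplus> v k \<otimes> (u \<ominus> k \<odot> \<one>)" using that F(2) by (auto simp: s_def)
    have P: "poly_eval u P = (u \<ominus> k \<odot> \<one>) \<otimes> poly_eval u (Q k)"
      unfolding PQ[OF that] poly_eval_mult[OF u] poly_eval_linear[OF u] ..
    define w where "w = u \<ominus> k \<odot> \<one>"
    have w: "w \<in> carrier R" unfolding w_def using u by simp
    have ik: "i k \<in> carrier R" "v k \<in> carrier R" using iv q.Icarr by auto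
    show ?thesis unfolding P t w_def[symmetric]
      using w ik poly_eval_closed[OF u, of "Q k"] by algebra
  qed
  \<comment> \<open>The terms that carry some \<open>i k\<close> are collected in the error
    \<open>j\<close>, which stays in \<open>q\<close>.\<close>
  have "\<exists>j\<in>q. t \<otimes> poly_eval u (\<Sum>k\<in>G. smult (c k) (Q k)) =
      poly_eval u P \<otimes> (\<Oplus>k\<in>G. c k \<odot> v k) \<oplus> j" if "G \<subseteq> F" for G
    using finite_subset[OF that F(1)] that
  proof (induction G)
    case empty
    then show ?case using tc u by (intro bexI[of _ \<zero>]) auto
  next
    case (insert k G)
    then obtain j where j: "j \<in> q" "t \<otimes> poly_eval u (\<Sum>k\<in>G. smult (c k) (Q k)) =
      poly_eval u P \<otimes> (\<Oplus>k\<in>G. c k \<odot> v k) \<oplus> j" by auto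
    have jc: "j \<in> carrier R" "i k \<in> carrier R" "v k \<in> carrier R" using j iv q.Icarr by auto
    define C where "C = c k \<odot> \<one>"
    have C: "C \<in> carrier R" by (simp add: C_def)
    define x where "x = (\<Oplus>k\<in>G. c k \<odot> v k)"
    have x: "x \<in> carrier R" unfolding x_def using iv by (auto intro!: finsum_closed)
    define y where "y = poly_eval u (\<Sum>k\<in>G. smult (c k) (Q k))"
    have y: "y \<in> carrier R" unfolding y_def using u by simp
    have "t \<otimes> poly_eval u (\<Sum>k\<in>insert k G. smult (c k) (Q k)) = t \<otimes> (C \<otimes> poly_eval u (Q k) \<oplus> y)"
      using insert u c_smult_eq_mult[of "poly_eval u (Q k)" "c k"]
      by (simp add: poly_eval_add poly_eval_smult C_def y_def)
    also have "\<dots> = C \<otimes> (t \<otimes> poly_eval u (Q k)) \<oplus> t \<otimes> y"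
      using tc C y poly_eval_closed[OF u, of "Q k"] by algebra
    also have "\<dots> = C \<otimes> (poly_eval u P \<otimes> v k \<oplus> i k \<otimes> poly_eval u (Q k)) \<oplus> (poly_eval u P \<otimes> x \<oplus> j)"
      using rel[of k] j(2) insert by (simp add: x_def y_def)
    also have "\<dots> = poly_eval u P \<otimes> (C \<otimes> v k \<oplus> x) \<oplus> (C \<otimes> (i k \<otimes> poly_eval u (Q k)) \<oplus> j)"
      using C x jc poly_eval_closed[OF u, of "Q k"] poly_eval_closed[OF u, of P] by algebra
    also have "C \<otimes> v k \<oplus> x = (\<Oplus>k\<in>insert k G. c k \<odot> v k)"
      using insert iv c_smult_eq_mult[of "v k" "c k"] by (simp add: x_def C_def Pi_def)
    finally have eq: "t \<otimes> poly_eval u (\<Sum>k\<in>insert k G. smult (c k) (Q k)) =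
      poly_eval u P \<otimes> (\<Oplus>k\<in>insert k G. c k \<odot> v k) \<oplus> (C \<otimes> (i k \<otimes> poly_eval u (Q k)) \<oplus> j)" .
    have "i k \<otimes> poly_eval u (Q k) \<in> q" using iv(1) u by (simp add: q.I_r_closed)
    then have "C \<otimes> (i k \<otimes> poly_eval u (Q k)) \<oplus> j \<in> q"
      using j(1) C by (simp add: q.a_closed q.I_l_closed)
    then show ?case using eq by (rule bexI[rotated])
  qed
  from this[of F] obtain j where j: "j \<in> q" "t \<otimes> poly_eval u (\<Sum>k\<in>F. smult (c k) (Q k)) =
      poly_eval u P \<otimes> \<zero> \<oplus> j" using F(4) by auto
  then have "t \<otimes> poly_eval u (\<Sum>k\<in>F. smult (c k) (Q k)) \<in> q"
    using u q.Icarr by simp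
  then have in_q: "poly_eval u (\<Sum>k\<in>F. smult (c k) (Q k)) \<in> q"
    using q.I_prime[of t] tc u t(1) S(2) by blast
  obtain k where k: "k \<in> F" "c k \<noteq> 0" using F by auto
  \<comment> \<open>As in Lagrange interpolation, only one summand survives at the point
    \<open>k\<close>; its coefficient \<open>c k\<close> shows that the polynomial is not
    zero.\<close>
  have "poly (Q j) k = 0" if "j \<in> F" "j \<noteq> k" for j
    unfolding Q_def poly_prod using that k F(1) by (intro prod_zero) auto
  then have "poly (\<Sum>k\<in>F. smult (c k) (Q k)) k = c k * poly (Q k) k"
    unfolding poly_sum using k(1) F(1) by (subst sum.remove[of _ k]) (auto intro!: sum.neutral)
  moreover have "poly (Q k) k \<noteq> 0"
    unfolding Q_def poly_prod using F(1) by auto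
  ultimately have "(\<Sum>k\<in>F. smult (c k) (Q k)) \<noteq> 0" using k by auto
  then show False using poly_eval_not_in_prime[OF q u no] in_q by blast
qed

text \<open>A Nullstellensatz for countable dimension. An ideal \<open>q\<close> that contains
  \<open>J\<close> and is maximal among those disjoint from \<open>S\<close> is prime, and modulo
  \<open>q\<close> every element outside it divides an element of \<open>S\<close>. By
  \<open>scalar_mod_prime\<close> every element is then congruent to a scalar, and that scalar is
  its value under the character.\<close>

theorem exists_character:
  assumes dep: "uncountable_dependent R" and J: "ideal J R"
    and S: "countable S" "S \<subseteq> carrier R" "\<one> \<in> S" "\<And>s t. s \<in> S \<Longrightarrow> t \<in> S \<Longrightarrow> s \<otimes> t \<in> S" "S \<inter> J = {}"
  shows "\<exists>\<chi>. character R \<chi> \<and> (\<forall>a\<in>J. \<chi> a = 0) \<and> (\<forall>s\<in>S. \<chi> s \<noteq> 0)"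
proof -
  let ?P = "{I. ideal I R \<and> J \<subseteq> I \<and> S \<inter> I = {}}"
  have "\<exists>q\<in>?P. \<forall>I\<in>?P. q \<subseteq> I \<longrightarrow> I = q"
  proof (rule subset_Zorn_nonempty)
    show "?P \<noteq> {}" using J S by auto
    fix C assume C: "C \<noteq> {}" "subset.chain ?P C"
    then have "subset.chain {I. ideal I R} C" by (auto simp: pred_on.chain_def)
    then have "ideal (\<Union>C) R" using chain_Union_is_ideal[of C] C(1) by simp
    then show "\<Union>C \<in> ?P" using C by (auto simp: pred_on.chain_def)
  qed
  then obtain q where "q \<in> ?P" and q_max: "\<forall>I\<in>?P. q \<subseteq> I \<longrightarrow> I = q" ..
  then have q: "ideal q R" "J \<subseteq> q" "S \<inter> q = {}" by simp_all
  have max: "I = q" if "ideal I R" "q \<subseteq> I" "S \<inter> I = {}" for I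
    using q_max that q(2) by (simp add: subset_trans[OF q(2)])
  interpret q: ideal q R by fact
  have inv: "\<exists>i\<in>q. \<exists>v\<in>carrier R. i \<oplus> v \<otimes> u \<in> S" if u: "u \<in> carrier R" "u \<notin> q" for u
  proof -
    \<comment> \<open>The ideal generated by \<open>q\<close> and \<open>u\<close> is strictly
      larger than \<open>q\<close>, so by maximality it meets \<open>S\<close>.\<close>
    let ?I = "q <+>\<^bsub>R\<^esub> PIdl u"
    have I: "ideal ?I R" by (rule add_ideals[OF q(1) cgenideal_ideal[OF u(1)]])
    have "i \<oplus> \<zero> \<otimes> u \<in> ?I" if "i \<in> q" for i
      using that by (auto simp: set_add_def' cgenideal_def)
    then have sub: "q \<subseteq> ?I" using u q.Icarr by fastforce
    have "\<zero> \<oplus> \<one> \<otimes> u \<in> ?I"  unfolding set_add_def' cgenideal_def using q.zero_closed by blast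
    then have "u \<in> ?I" using u by simp
    then have "S \<inter> ?I \<noteq> {}" using max[OF I sub] u(2) by blast
    then show ?thesis by (auto simp: set_add_def' cgenideal_def)
  qed
  have one_nq: "\<one> \<notin> q" using S(3) q(3) by blast
  have prime: "primeideal q R"
  proof (rule primeidealI[OF q(1) is_cring])
    show "carrier R \<noteq> q" using one_nq by auto
    fix a b assume a: "a \<in> carrier R" and b: "b \<in> carrier R" and ab: "a \<otimes> b \<in> q"
    show "a \<in> q \<or> b \<in> q"
    proof (rule ccontr)
      assume "\<not> ?thesis"
      then obtain i v j w where i: "i \<in> q" "v \<in> carrier R" "i \<oplus> v \<otimes> a \<in> S"
        and j: "j \<in> q" "w \<in> carrier R" "j \<oplus> w \<otimes> b \<in> S"
        using inv[OF a] inv[OF b] by blast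
      have c: "i \<in> carrier R" "j \<in> carrier R" using i j q.Icarr by auto
      have "(i \<oplus> v \<otimes> a) \<otimes> (j \<oplus> w \<otimes> b) = (j \<oplus> w \<otimes> b) \<otimes> i \<oplus> (v \<otimes> a) \<otimes> j \<oplus> (v \<otimes> w) \<otimes> (a \<otimes> b)"
        using a b c i(2) j(2) by algebra
      also have "\<dots> \<in> q"
        using q.I_l_closed[OF i(1), of "j \<oplus> w \<otimes> b"] q.I_l_closed[OF j(1), of "v \<otimes> a"]
          q.I_l_closed[OF ab, of "v \<otimes> w"] a b c i(2) j(2) by (simp add: q.a_closed)
      finally show False using S(4)[OF i(3) j(3)] q(3) by blast
    qed
  qed
  define \<chi> where "\<chi> u = (SOME l. u \<ominus> l \<odot> \<one> \<in> q)" for u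
  have chi: "u \<ominus> \<chi> u \<odot> \<one> \<in> q" if "u \<in> carrier R" for u
    unfolding \<chi>_def by (rule someI_ex) (rule scalar_mod_prime[OF prime dep S(1) q(3) S(2) inv that])
  \<comment> \<open>Two different scalars for one \<open>u\<close> would put a nonzero constant,
    hence a unit, into \<open>q\<close>. So any scalar congruent to \<open>u\<close> may be used to
    compute \<open>\<chi> u\<close>.\<close>
  have eq: "\<chi> u = l" if u: "u \<in> carrier R" and l: "u \<ominus> l \<odot> \<one> \<in> q" for u l
  proof (rule ccontr)
    assume ne: "\<chi> u \<noteq> l"
    define d where "d = l - \<chi> u"
    have "(u \<ominus> \<chi> u \<odot> \<one>) \<ominus> (u \<ominus> l \<odot> \<one>) \<in> q"
      using chi[OF u] l by (simp add: a_minus_def q.a_closed q.a_inv_closed)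
    also have "(u \<ominus> \<chi> u \<odot> \<one>) \<ominus> (u \<ominus> l \<odot> \<one>) = l \<odot> \<one> \<ominus> \<chi> u \<odot> \<one>"
    proof -
      define x where "x = \<chi> u \<odot> \<one>"
      define y where "y = l \<odot> \<one>"
      have "x \<in> carrier R" "y \<in> carrier R" by (simp_all add: x_def y_def)
      then show ?thesis unfolding x_def[symmetric] y_def[symmetric] using u by algebra
    qed
    finally have "d \<odot> \<one> \<in> q" by (simp add: d_def scalar_diff)
    then have "(inverse d \<odot> \<one>) \<otimes> (d \<odot> \<one>) \<in> q" by (simp add: q.I_l_closed)
    then show False using ne one_nq scalar_mult[of "inverse d" d] by (simp add: d_def)
  qed
  have zero: "\<chi> a = 0" if "a \<in> q" for a
  proof (rule eq)
    show "a \<in> carrier R" using that q.Icarr by simp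
    then show "a \<ominus> 0 \<odot> \<one> \<in> q" using that by (simp add: a_minus_def)
  qed
  have one: "\<chi> \<one> = 1" by (rule eq) (simp_all add: a_minus_def r_neg)
  have add: "\<chi> (a \<oplus> b) = \<chi> a + \<chi> b" and mult: "\<chi> (a \<otimes> b) = \<chi> a * \<chi> b"
    if a: "a \<in> carrier R" and b: "b \<in> carrier R" for a b
  proof -
    define x where "x = \<chi> a \<odot> \<one>"
    define y where "y = \<chi> b \<odot> \<one>"
    have xy: "x \<in> carrier R" "y \<in> carrier R" by (simp_all add: x_def y_def)
    have q: "a \<ominus> x \<in> q" "b \<ominus> y \<in> q" using chi a b by (simp_all add: x_def y_def)
    have "a \<oplus> b \<ominus> (x \<oplus> y) = (a \<ominus> x) \<oplus> (b \<ominus> y)" using a b xy by algebra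
    also have "\<dots> \<in> q" using q by (rule q.a_closed)
    finally show "\<chi> (a \<oplus> b) = \<chi> a + \<chi> b"
      using a b by (intro eq) (simp_all add: x_def y_def c_smult_add_left)
    have "a \<otimes> b \<ominus> (x \<otimes> y) = a \<otimes> (b \<ominus> y) \<oplus> y \<otimes> (a \<ominus> x)" using a b xy by algebra
    also have "\<dots> \<in> q" using q a xy by (intro q.a_closed q.I_l_closed)
    finally show "\<chi> (a \<otimes> b) = \<chi> a * \<chi> b"
      using a b by (intro eq) (simp_all add: x_def y_def scalar_mult)
  qed
  have smult: "\<chi> (c \<odot> a) = c * \<chi> a" if a: "a \<in> carrier R" for c a
  proof -
    have "\<chi> (c \<odot> \<one>) = c" by (rule eq) (simp_all add: a_minus_def r_neg)
    then show ?thesis using mult[of "c \<odot> \<one>" a] a c_smult_eq_mult[of a c] by simp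
  qed
  have "\<chi> s \<noteq> 0" if "s \<in> S" for s
  proof
    assume "\<chi> s = 0"
    moreover have "s \<in> carrier R" using that S by auto
    ultimately have "s \<in> q" using chi[of s] by (simp add: a_minus_def)
    then show False using that q(3) by blast
  qed
  then show ?thesis using zero q(2) one add mult smult
    by (intro exI[of _ \<chi>]) (auto simp: character_def)
qed

end


section \<open>Generic extension of characters\<close>

lemma (in c_algebra) c_algebra_sub_alg:
  assumes "c_subalgebra T A"
  shows "c_algebra (sub_alg A T)"
proof -
  have T: "subring T A" "submodule T complex_ring A" using assms by (auto simp: c_subalgebra_def)
  have "T \<subseteq> carrier A" using subringE(1)[OF T(1)] .
  then show ?thesis
    using submodule.submodule_is_module[OF T(2) module_axioms] subring_is_ring[OF T(1)]
    by (intro c_algebra.intro c_algebra_axioms.intro)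
       (auto simp: smult_mult_left smult_mult_right subset_iff)
qed

lemma (in c_algebra) comm_c_algebra_sub_alg:
  assumes "c_subalgebra T A" "\<And>x y. x \<in> T \<Longrightarrow> y \<in> T \<Longrightarrow> x \<otimes> y = y \<otimes> x"
  shows "comm_c_algebra (sub_alg A T)"
proof -
  interpret T: c_algebra "sub_alg A T" by (rule c_algebra_sub_alg[OF assms(1)])
  show ?thesis
    by (intro comm_c_algebra.intro T.c_algebra_axioms cring.intro T.ring_axioms
        comm_monoid.intro T.monoid_axioms comm_monoid_axioms.intro) (simp add: assms(2))
qed

lemma c_span_sub_alg: "c_span (sub_alg A T) B = c_span A B"
proof (intro equalityI subsetI)
  show "x \<in> c_span A B" if "x \<in> c_span (sub_alg A T) B" for x
    using that by induction (auto intro: c_span.intros)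
  show "x \<in> c_span (sub_alg A T) B" if "x \<in> c_span A B" for x
    using that
  proof induction
    case zero
    then show ?case using c_span.zero[of "sub_alg A T" B] by simp
  next
    case (add x y)
    then show ?case using c_span.add[of x "sub_alg A T" B y] by simp
  next
    case (smult x c)
    then show ?case using c_span.smult[of x "sub_alg A T" B c] by simp
  qed (rule c_span.base)
qed

definition series_alg :: "(complex, 'b series) module"
  where "series_alg = \<lparr>carrier = UNIV, monoid.mult = (*), one = 1, ring.zero = 0, add = (+),
    module.smult = (\<lambda>c f. const_series c * f)\<rparr>"

lemma series_alg_simps [simp]:
  "carrier series_alg = UNIV" "monoid.mult series_alg = (*)" "one series_alg = 1"
  "ring.zero series_alg = 0" "add series_alg = (+)"
  "module.smult series_alg c f = const_series c * f"
  by (simp_all add: series_alg_def)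

interpretation series_alg: comm_c_algebra series_alg
proof -
  have *: "cring series_alg"
  proof (rule cringI)
    show "abelian_group series_alg"
      by (rule abelian_groupI) (auto simp: algebra_simps intro: exI[of _ "- x" for x] left_minus)
    show "Group.comm_monoid series_alg" by (rule comm_monoidI) (auto simp: algebra_simps)
  qed (auto simp: algebra_simps)
  interpret cring series_alg by (rule *)
  have "module complex_ring series_alg"
    by (intro moduleI abelian_group_axioms)
       (auto simp: algebra_simps const_series_add const_series_mult
         )
  then show "comm_c_algebra series_alg"
    by (intro comm_c_algebra.intro c_algebra.intro c_algebra_axioms.intro ring_axioms *)
       (auto simp: algebra_simps)
qed

text \<open>The set \<open>N\<close> plus the combinations of the first \<open>n\<close> generators
  with coefficients in \<open>\<phi> I\<close>. With \<open>I\<close> the ideal of a point and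
  \<open>N = {0}\<close> the union over \<open>n\<close> is the extended ideal; with
  \<open>I\<close> the whole ring and \<open>N\<close> the multiples of \<open>s\<close> it is the
  module against which the next generator is tested. The filtration by \<open>n\<close> permits
  elimination from the last generator down.\<close>

primrec weighted_span :: "('a \<Rightarrow> 'r::comm_ring_1) \<Rightarrow> 'a set \<Rightarrow> 'r set \<Rightarrow> (nat \<Rightarrow> 'r) \<Rightarrow> nat \<Rightarrow> 'r set" where
  "weighted_span \<phi> I N u 0 = N"
| "weighted_span \<phi> I N u (Suc n) = {r + \<phi> a * u n |r a. r \<in> weighted_span \<phi> I N u n \<and> a \<in> I}"

lemma weighted_spanI:
  "r \<in> weighted_span \<phi> I N u n \<Longrightarrow> a \<in> I \<Longrightarrow> r + \<phi> a * u n \<in> weighted_span \<phi> I N u (Suc n)"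
  by auto

section \<open>Homomorphisms into series and the extension of characters along them\<close>

locale series_hom = comm_c_algebra R for R :: "(complex, 'a) module" (structure) +
  fixes \<phi> :: "'a \<Rightarrow> 'b series"
  assumes phi_one: "\<phi> \<one> = 1"
    and phi_add: "a \<in> carrier R \<Longrightarrow> b \<in> carrier R \<Longrightarrow> \<phi> (a \<oplus> b) = \<phi> a + \<phi> b"
    and phi_mult: "a \<in> carrier R \<Longrightarrow> b \<in> carrier R \<Longrightarrow> \<phi> (a \<otimes> b) = \<phi> a * \<phi> b"
    and phi_smult: "a \<in> carrier R \<Longrightarrow> \<phi> (c \<odot> a) = const_series c * \<phi> a"
begin

lemma phi_zero: "\<phi> \<zero> = 0"
  using phi_smult[of \<one> 0] by simp

lemma phi_minus: "a \<in> carrier R \<Longrightarrow> \<phi> (\<ominus> a) = - \<phi> a"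
  using phi_add[of "\<ominus> a" a] phi_zero by (simp add: l_neg eq_neg_iff_add_eq_0)

lemma weighted_span_zero:
  "\<zero> \<in> I \<Longrightarrow> 0 \<in> N \<Longrightarrow> 0 \<in> weighted_span \<phi> I N u n"
  by (induction n) (force simp: phi_zero)+

lemma weighted_span_add:
  assumes "\<And>x y. x \<in> N \<Longrightarrow> y \<in> N \<Longrightarrow> x + y \<in> N" "I \<subseteq> carrier R"
    and "\<And>a b. a \<in> I \<Longrightarrow> b \<in> I \<Longrightarrow> a \<oplus> b \<in> I"
  shows "x \<in> weighted_span \<phi> I N u n \<Longrightarrow> y \<in> weighted_span \<phi> I N u n \<Longrightarrow>
    x + y \<in> weighted_span \<phi> I N u n"
proof (induction n arbitrary: x y)
  case 0
  then show ?case using assms by simp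
next
  case (Suc n)
  then obtain r a s b where x: "x = r + \<phi> a * u n" "r \<in> weighted_span \<phi> I N u n" "a \<in> I"
    and y: "y = s + \<phi> b * u n" "s \<in> weighted_span \<phi> I N u n" "b \<in> I" by auto
  have "x + y = (r + s) + \<phi> (a \<oplus> b) * u n"
    using x y assms(2) by (simp add: phi_add subset_iff algebra_simps)
  then show ?case using weighted_spanI[OF Suc.IH[OF x(2) y(2)] assms(3)[OF x(3) y(3)]] by simp
qed

lemma weighted_span_mult:
  assumes "\<And>x. x \<in> N \<Longrightarrow> \<phi> z * x \<in> N" "I \<subseteq> carrier R" "z \<in> carrier R"
    and "\<And>a. a \<in> I \<Longrightarrow> z \<otimes> a \<in> I"
  shows "x \<in> weighted_span \<phi> I N u n \<Longrightarrow> \<phi> z * x \<in> weighted_span \<phi> I N u n"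
proof (induction n arbitrary: x)
  case 0
  then show ?case using assms by simp
next
  case (Suc n)
  then obtain r a where x: "x = r + \<phi> a * u n" "r \<in> weighted_span \<phi> I N u n" "a \<in> I" by auto
  have "\<phi> z * x = \<phi> z * r + \<phi> (z \<otimes> a) * u n"
    using x assms(2,3) by (simp add: phi_mult subset_iff algebra_simps)
  then show ?case using weighted_spanI[OF Suc.IH[OF x(2)] assms(4)[OF x(3)]] by simp
qed

lemma weighted_span_mono:
  assumes "N \<subseteq> N'" "I \<subseteq> I'" shows "weighted_span \<phi> I N u n \<subseteq> weighted_span \<phi> I' N' u n"
  using assms by (induction n) (simp, fastforce)

lemma weighted_span_le:
  assumes "\<zero> \<in> I" "n \<le> m" shows "weighted_span \<phi> I N u n \<subseteq> weighted_span \<phi> I N u m"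
  using assms(2)
proof (induction m rule: dec_induct)
  case (step m)
  have "x \<in> weighted_span \<phi> I N u (Suc m)" if "x \<in> weighted_span \<phi> I N u m" for x
    using that assms(1) by (force simp: phi_zero)
  then show ?case using step by blast
qed simp

text \<open>For each \<open>n\<close> such that some nonzero multiple of \<open>u n\<close> lies in the module spanned by \<open>s\<close> and
  the earlier generators, one such multiplier is put into \<open>G\<close>. At a character that is nonzero on
  \<open>G\<close> the remaining generators do not contribute to a representation of \<open>s\<close>, so that all of them
  can be eliminated from the last one down.\<close>

lemma generic_nonmembership:
  fixes u :: "nat \<Rightarrow> 'b series"
  assumes "s \<noteq> 0"
  shows "\<exists>G. countable G \<and> G \<subseteq> carrier R \<and> (\<forall>g\<in>G. \<phi> g \<noteq> 0) \<and>
    (\<forall>p. character R p \<longrightarrow> (\<forall>a\<in>carrier R. \<phi> a = 0 \<longrightarrow> p a = 0) \<longrightarrow> (\<forall>g\<in>G. p g \<noteq> 0) \<longrightarrow>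
      (\<forall>n. s \<notin> weighted_span \<phi> {a \<in> carrier R. p a = 0} {0} u n))"
proof -
  define N where "N = {\<phi> h * s |h. h \<in> carrier R}"
  define Z where "Z n = weighted_span \<phi> (carrier R) N u n" for n
  \<comment> \<open>Over the fraction field of the image, a bad \<open>u n\<close> is a combination
    of \<open>s\<close> and the earlier generators.\<close>
  define bad where "bad n \<longleftrightarrow> (\<exists>g\<in>carrier R. \<phi> g \<noteq> 0 \<and> \<phi> g * u n \<in> Z n)" for n
  define g where "g n = (SOME g. g \<in> carrier R \<and> \<phi> g \<noteq> 0 \<and> \<phi> g * u n \<in> Z n)" for n
  have g: "g n \<in> carrier R" "\<phi> (g n) \<noteq> 0" "\<phi> (g n) * u n \<in> Z n" if "bad n" for n
    using someI_ex[of "\<lambda>g. g \<in> carrier R \<and> \<phi> g \<noteq> 0 \<and> \<phi> g * u n \<in> Z n"] that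
    unfolding g_def bad_def by auto
  have N_add: "x + y \<in> N" if "x \<in> N" "y \<in> N" for x y
  proof -
    from that obtain h k where "h \<in> carrier R" "k \<in> carrier R" "x = \<phi> h * s" "y = \<phi> k * s"
      by (auto simp: N_def)
    then have "x + y = \<phi> (h \<oplus> k) * s" "h \<oplus> k \<in> carrier R" by (simp_all add: phi_add algebra_simps)
    then show ?thesis by (auto simp: N_def)
  qed
  have N_mult: "\<phi> z * x \<in> N" if "x \<in> N" "z \<in> carrier R" for x z
  proof -
    from that obtain h where "h \<in> carrier R" "x = \<phi> h * s" by (auto simp: N_def)
    then have "\<phi> z * x = \<phi> (z \<otimes> h) * s" "z \<otimes> h \<in> carrier R"
      using that by (simp_all add: phi_mult algebra_simps)
    then show ?thesis by (auto simp: N_def)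
  qed
  have N_zero: "0 \<in> N" using phi_zero by (auto simp: N_def intro!: exI[of _ \<zero>])
  have Z_add: "x + y \<in> Z n" if "x \<in> Z n" "y \<in> Z n" for x y n
    using that unfolding Z_def by (intro weighted_span_add N_add) auto
  have Z_mult: "\<phi> z * x \<in> Z n" if "x \<in> Z n" "z \<in> carrier R" for x z n
    using that unfolding Z_def by (intro weighted_span_mult N_mult) auto
  have N_Z: "N \<subseteq> Z n" for n
    using weighted_span_le[of "carrier R" 0 n N u] by (simp add: Z_def)
  \<comment> \<open>Proved for all multiples of \<open>s\<close>: eliminating a bad generator
    multiplies by \<open>g n\<close>, so \<open>s\<close> alone would not carry the induction. The
    case \<open>h = \<one>\<close> is the claim.\<close>
  have main: "p h = 0"
    if p: "character R p" and ker: "\<And>a. a \<in> carrier R \<Longrightarrow> \<phi> a = 0 \<Longrightarrow> p a = 0"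
      and pg: "\<And>n. bad n \<Longrightarrow> p (g n) \<noteq> 0"
      and "h \<in> carrier R" "\<phi> h * s \<in> weighted_span \<phi> {a \<in> carrier R. p a = 0} {0} u n" for p h n
    using that(4,5)
  proof (induction n arbitrary: h)
    case 0
    \<comment> \<open>Series form a domain, so \<open>s\<close> cancels.\<close>
    then have "\<phi> h = 0" using assms by simp
    then show ?case using ker 0 by simp
  next
    case (Suc n)
    let ?I = "{a \<in> carrier R. p a = 0}"
    let ?M = "weighted_span \<phi> ?I {0} u n"
    have p_mult: "p (a \<otimes> b) = p a * p b" and p_add: "p (a \<oplus> b) = p a + p b"
      if "a \<in> carrier R" "b \<in> carrier R" for a b
      using p that by (auto simp: character_def)
    have M_add: "x + y \<in> ?M" if "x \<in> ?M" "y \<in> ?M" for x y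
      using that by (intro weighted_span_add) (auto simp: p_add)
    have M_mult: "\<phi> z * x \<in> ?M" if "x \<in> ?M" "z \<in> carrier R" for x z
      using that by (intro weighted_span_mult) (auto simp: p_mult)
    obtain r m where r: "r \<in> ?M" and m: "m \<in> carrier R" "p m = 0" and h: "\<phi> h * s = r + \<phi> m * u n"
      using Suc.prems(2) by auto
    show ?case
    proof (cases "bad n")
      case True
      note gn = g[OF True]
      \<comment> \<open>Since \<open>p m = 0\<close>, multiplying by \<open>\<phi> m\<close> moves
        the coefficients at the generators into the ideal of \<open>p\<close>, and the multiple of
        \<open>s\<close> gains the factor \<open>m\<close>.\<close>
      have split: "\<exists>k\<in>carrier R. \<exists>r'\<in>weighted_span \<phi> ?I {0} u j. \<phi> m * t = \<phi> (m \<otimes> k) * s + r'"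
        if "t \<in> Z j" for t j
        using that
      proof (induction j arbitrary: t)
        case 0
        then obtain k where k: "k \<in> carrier R" "t = \<phi> k * s" by (auto simp: Z_def N_def)
        then show ?case using m by (auto simp: phi_mult)
      next
        case (Suc j)
        then obtain t' z where t: "t' \<in> Z j" "z \<in> carrier R" "t = t' + \<phi> z * u j" by (auto simp: Z_def)
        from Suc.IH[OF t(1)] obtain k r' where k: "k \<in> carrier R"
          "r' \<in> weighted_span \<phi> ?I {0} u j" "\<phi> m * t' = \<phi> (m \<otimes> k) * s + r'" by blast
        have "\<phi> m * t = \<phi> (m \<otimes> k) * s + (r' + \<phi> (m \<otimes> z) * u j)"
          using t m k by (simp add: phi_mult algebra_simps)
        moreover have "r' + \<phi> (m \<otimes> z) * u j \<in> weighted_span \<phi> ?I {0} u (Suc j)"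
          using k(2) by (rule weighted_spanI) (use m t(2) in \<open>simp add: p_mult\<close>)
        ultimately show ?case using k(1) by blast
      qed
      from split[OF gn(3)] obtain k r' where k: "k \<in> carrier R" "r' \<in> ?M"
        "\<phi> m * (\<phi> (g n) * u n) = \<phi> (m \<otimes> k) * s + r'" by blast
      \<comment> \<open>Multiplication by \<open>g n\<close> trades \<open>u n\<close> for
        \<open>s\<close> and earlier generators. The new multiplier of \<open>s\<close> has the
        value \<open>p (g n) * p h\<close> at \<open>p\<close>, again because
        \<open>p m = 0\<close>.\<close>
      have "\<phi> (g n \<otimes> h \<ominus> m \<otimes> k) * s = \<phi> (g n) * (\<phi> h * s) - \<phi> (m \<otimes> k) * s"
        using gn m k Suc.prems(1) by (simp add: a_minus_def phi_add phi_minus phi_mult algebra_simps)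
      also have "\<phi> (g n) * (\<phi> h * s) = \<phi> (g n) * r + \<phi> m * (\<phi> (g n) * u n)"
        unfolding h by (simp add: algebra_simps)
      also have "\<dots> - \<phi> (m \<otimes> k) * s = \<phi> (g n) * r + r'" unfolding k(3) by simp
      also have "\<dots> \<in> ?M" using M_add M_mult r k gn by blast
      finally have "p (g n \<otimes> h \<ominus> m \<otimes> k) = 0"
        using Suc.IH[of "g n \<otimes> h \<ominus> m \<otimes> k"] gn m k Suc.prems(1) by simp
      moreover have "p (g n \<otimes> h) = p (g n \<otimes> h \<ominus> m \<otimes> k) + p (m \<otimes> k)"
      proof -
        have "g n \<otimes> h = (g n \<otimes> h \<ominus> m \<otimes> k) \<oplus> m \<otimes> k"
          using gn(1) m(1) k(1) Suc.prems(1) by algebra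
        then show ?thesis using p_add[of "g n \<otimes> h \<ominus> m \<otimes> k" "m \<otimes> k"] gn m k Suc.prems(1) by simp
      qed
      ultimately have "p (g n) * p h = 0" using gn m k Suc.prems(1) by (simp add: p_mult)
      then show ?thesis using pg[OF True] by simp
    next
      case False
      \<comment> \<open>A generator that is not bad is independent of \<open>s\<close> and its
        predecessors, so its coefficient in the representation must vanish.\<close>
      have "r \<in> Z n"
        using r weighted_span_mono[of "{0}" N ?I "carrier R" u n] N_zero by (auto simp: Z_def)
      then have "\<phi> (\<ominus> \<one>) * r \<in> Z n" by (intro Z_mult) auto
      moreover have "\<phi> h * s \<in> Z n" using N_Z Suc.prems(1) by (auto simp: N_def)
      ultimately have "\<phi> (\<ominus> \<one>) * r + \<phi> h * s \<in> Z n" by (rule Z_add)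
      also have "\<phi> (\<ominus> \<one>) * r + \<phi> h * s = \<phi> m * u n"
        unfolding h by (simp add: phi_minus phi_one)
      finally have "\<phi> m = 0" using False m(1) by (auto simp: bad_def)
      then have "\<phi> h * s \<in> ?M" using h r by simp
      then show ?thesis using Suc.IH Suc.prems(1) by blast
    qed
  qed
  show ?thesis
  proof (intro exI[of _ "g ` {n. bad n}"] conjI allI impI)
    fix p n assume p: "character R p" "\<forall>a\<in>carrier R. \<phi> a = 0 \<longrightarrow> p a = 0" "\<forall>g\<in>g ` {n. bad n}. p g \<noteq> 0"
    show "s \<notin> weighted_span \<phi> {a \<in> carrier R. p a = 0} {0} u n"
    proof
      assume "s \<in> weighted_span \<phi> {a \<in> carrier R. p a = 0} {0} u n"
      then have "\<phi> \<one> * s \<in> weighted_span \<phi> {a \<in> carrier R. p a = 0} {0} u n" by (simp add: phi_one)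
      then have "p \<one> = 0" using main[of p \<one> n] p by simp
      then show False using p by (simp add: character_def)
    qed
  qed (use g in auto)
qed

text \<open>A character of \<open>T\<close> that kills the ideal \<open>M\<close> generated by the
  image of the kernel of \<open>p\<close> extends \<open>p\<close>, and by
  \<open>exists_character\<close> it can be chosen nonzero at \<open>s\<close> if no power of
  \<open>s\<close> lies in \<open>M\<close>. Each power contributes one countable set of conditions
  from \<open>generic_nonmembership\<close>.\<close>

theorem generic_extension:
  assumes B: "countable B" and T: "T = c_span series_alg B" "c_subalgebra T series_alg"
    and phi_T: "\<phi> ` carrier R \<subseteq> T" and s: "s \<in> T" "s \<noteq> 0"
  shows "\<exists>G. countable G \<and> G \<subseteq> carrier R \<and> (\<forall>g\<in>G. \<phi> g \<noteq> 0) \<and>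
    (\<forall>p. character R p \<longrightarrow> (\<forall>a\<in>carrier R. \<phi> a = 0 \<longrightarrow> p a = 0) \<longrightarrow> (\<forall>g\<in>G. p g \<noteq> 0) \<longrightarrow>
      (\<exists>\<chi>. character (sub_alg series_alg T) \<chi> \<and> \<chi> s \<noteq> 0 \<and> (\<forall>a\<in>carrier R. \<chi> (\<phi> a) = p a)))"
proof -
  define u where "u = from_nat_into (insert 0 B)"
  have range_u: "range u = insert 0 B"
    unfolding u_def by (rule range_from_nat_into) (use B in auto)
  interpret T: comm_c_algebra "sub_alg series_alg T"
    by (rule series_alg.comm_c_algebra_sub_alg[OF T(2)]) (simp add: mult.commute)
  have T_mult: "x * y \<in> T" if "x \<in> T" "y \<in> T" for x y using T.m_closed[of x y] that by simp
  have T_add: "x + y \<in> T" if "x \<in> T" "y \<in> T" for x y using T.a_closed[of x y] that by simp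
  have T_one: "1 \<in> T" and T_zero: "0 \<in> T" using T.one_closed T.zero_closed by simp_all
  have T_const: "const_series c \<in> T" for c using T.c_smult_closed[of 1 c] T_one by simp
  have u_T: "u n \<in> T" for n
  proof -
    have "u n \<in> insert 0 B" using range_u by blast
    then show ?thesis using T(1) T_zero by (auto intro: c_span.base)
  qed
  have dep: "uncountable_dependent (sub_alg series_alg T)"
    by (rule T.uncountable_dependentI[OF B]) (auto simp: T(1) c_span_sub_alg intro: c_span.base)
  have s_pow: "s ^ k \<in> T" for k by (induction k) (auto simp: T_one T_mult s)
  have "s ^ k \<noteq> 0" for k using s by simp
  from generic_nonmembership[OF this, of _ u] have "\<forall>k. \<exists>G. countable G \<and> G \<subseteq> carrier R \<and>
    (\<forall>g\<in>G. \<phi> g \<noteq> 0) \<and> (\<forall>p. character R p \<longrightarrow> (\<forall>a\<in>carrier R. \<phi> a = 0 \<longrightarrow> p a = 0) \<longrightarrow>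
      (\<forall>g\<in>G. p g \<noteq> 0) \<longrightarrow> (\<forall>n. s ^ k \<notin> weighted_span \<phi> {a \<in> carrier R. p a = 0} {0} u n))" by simp
  then obtain G where G: "\<forall>k. countable (G k) \<and> G k \<subseteq> carrier R \<and>
    (\<forall>g\<in>G k. \<phi> g \<noteq> 0) \<and> (\<forall>p. character R p \<longrightarrow> (\<forall>a\<in>carrier R. \<phi> a = 0 \<longrightarrow> p a = 0) \<longrightarrow>
      (\<forall>g\<in>G k. p g \<noteq> 0) \<longrightarrow> (\<forall>n. s ^ k \<notin> weighted_span \<phi> {a \<in> carrier R. p a = 0} {0} u n))"
    by (drule_tac choice) (erule exE, rule that)
  show ?thesis
  proof (intro exI[of _ "\<Union>k. G k"] conjI allI impI)
    fix p assume p: "character R p" "\<forall>a\<in>carrier R. \<phi> a = 0 \<longrightarrow> p a = 0" "\<forall>g\<in>\<Union>k. G k. p g \<noteq> 0"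
    have p_mult: "p (a \<otimes> b) = p a * p b" and p_add: "p (a \<oplus> b) = p a + p b"
      if "a \<in> carrier R" "b \<in> carrier R" for a b
      using p(1) that by (auto simp: character_def)
    have p_smult: "p (c \<odot> a) = c * p a" if "a \<in> carrier R" for a c
      using p(1) that by (auto simp: character_def)
    have p_zero: "p \<zero> = 0" using p_add[of \<zero> \<zero>] by simp
    let ?I = "{a \<in> carrier R. p a = 0}"
    define W where "W n = weighted_span \<phi> ?I {0} u n" for n
    \<comment> \<open>As the \<open>u n\<close> span \<open>T\<close>, this union is the whole ideal
      of \<open>T\<close> generated by the image of the kernel of \<open>p\<close>.\<close>
    define M where "M = (\<Union>n. W n)"
    have W_le: "W n \<subseteq> W m" if "n \<le> m" for n m
      unfolding W_def using that by (intro weighted_span_le) (auto simp: p_zero)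
    have W_add: "x + y \<in> W n" if "x \<in> W n" "y \<in> W n" for x y n
      using that unfolding W_def by (intro weighted_span_add) (auto simp: p_add)
    have M_add: "x + y \<in> M" if xy: "x \<in> M" "y \<in> M" for x y
    proof -
      from xy obtain n m where "x \<in> W n" "y \<in> W m" by (auto simp: M_def)
      then have "x \<in> W (max n m)" "y \<in> W (max n m)" using W_le[of n "max n m"] W_le[of m "max n m"] by auto
      then show ?thesis using W_add by (auto simp: M_def)
    qed
    have zero_W: "0 \<in> W n" for n
      unfolding W_def by (intro weighted_span_zero) (auto simp: p_zero)
    have phi_M: "\<phi> m * x \<in> M" if "x \<in> T" "m \<in> ?I" for m x
      using that unfolding T(1)
    proof (induction arbitrary: m)
      case zero
      then show ?case using zero_W by (auto simp: M_def)
    next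
      case (base b)
      then obtain k where "b = u k" using range_u by (metis insertCI rangeE)
      then have "0 + \<phi> m * b \<in> W (Suc k)"
        using base zero_W[of k] unfolding W_def weighted_span.simps by blast
      then show ?case by (auto simp: M_def)
    next
      case (add x y)
      then show ?case by (simp add: distrib_left M_add)
    next
      case (smult x c)
      then have "c \<odot> m \<in> ?I" using p_smult by simp
      then have "\<phi> (c \<odot> m) * x \<in> M" by (rule smult.IH)
      then show ?case using smult by (simp add: phi_smult algebra_simps)
    qed
    have M_mult: "x * t \<in> M" if "x \<in> M" "t \<in> T" for x t
    proof -
      have "\<forall>x\<in>W n. x * t \<in> M" for n
      proof (induction n)
        case 0
        then show ?case using zero_W by (auto simp: M_def W_def)
      next
        case (Suc n)
        show ?case
        proof
          fix x assume "x \<in> W (Suc n)"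
          then obtain r m where "r \<in> W n" "m \<in> ?I" "x = r + \<phi> m * u n" by (auto simp: W_def)
          then show "x * t \<in> M"
            using Suc phi_M[of "u n * t" m] T_mult[OF u_T that(2)]
            by (auto simp: distrib_right mult.assoc intro!: M_add)
        qed
      qed
      then show ?thesis using that by (auto simp: M_def)
    qed
    have W_T: "W n \<subseteq> T" for n
    proof (induction n)
      case (Suc n)
      then show ?case using phi_T u_T by (auto simp: W_def intro!: T_add T_mult)
    qed (use T_zero in \<open>simp add: W_def\<close>)
    have M_T: "M \<subseteq> T" using W_T by (auto simp: M_def)
    have ideal: "ideal M (sub_alg series_alg T)"
    proof (rule idealI)
      show "ring (sub_alg series_alg T)" by (rule T.ring_axioms)
      show "subgroup M (add_monoid (sub_alg series_alg T))"
      proof (rule T.add.subgroupI)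
        show "M \<subseteq> carrier (sub_alg series_alg T)" using M_T by simp
        show "M \<noteq> {}" using zero_W by (auto simp: M_def)
      next
        fix x assume x: "x \<in> M"
        then have "x * const_series (-1) \<in> M" by (rule M_mult) (rule T_const)
        moreover have "\<ominus>\<^bsub>sub_alg series_alg T\<^esub> x = const_series (-1) * x"
          using T.c_smult_minus_one[of x] x M_T by auto
        ultimately show "\<ominus>\<^bsub>sub_alg series_alg T\<^esub> x \<in> M" by (simp add: mult.commute)
      qed (simp add: M_add)
    qed (use M_mult in \<open>auto simp: mult.commute\<close>)
    have "s ^ k \<notin> M" for k
      using G[rule_format, of k, THEN conjunct2, THEN conjunct2, THEN conjunct2] p by (simp add: M_def W_def)
    then have disj: "range (\<lambda>k. s ^ k) \<inter> M = {}" by auto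
    have pows: "countable (range (\<lambda>k. s ^ k))" "range (\<lambda>k. s ^ k) \<subseteq> carrier (sub_alg series_alg T)"
      "\<one>\<^bsub>sub_alg series_alg T\<^esub> \<in> range (\<lambda>k. s ^ k)"
      using s_pow by (auto intro: range_eqI[of _ _ 0])
    have pow_mult: "x \<otimes>\<^bsub>sub_alg series_alg T\<^esub> y \<in> range (\<lambda>k. s ^ k)"
      if "x \<in> range (\<lambda>k. s ^ k)" "y \<in> range (\<lambda>k. s ^ k)" for x y
      using that by (auto simp: power_add[symmetric])
    from T.exists_character[OF dep ideal pows pow_mult disj]
    obtain \<chi> where \<chi>: "character (sub_alg series_alg T) \<chi>" "\<forall>a\<in>M. \<chi> a = 0"
      "\<forall>t\<in>range (\<lambda>k. s ^ k). \<chi> t \<noteq> 0" by blast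
    have "\<chi> s \<noteq> 0" using \<chi>(3) by (metis power_one_right rangeI)
    moreover have "\<chi> (\<phi> a) = p a" if a: "a \<in> carrier R" for a
    proof -
      \<comment> \<open>Subtracting its value at \<open>p\<close> moves \<open>a\<close> into the
        kernel of \<open>p\<close>, whose image \<open>\<chi>\<close> kills.\<close>
      define m where "m = a \<oplus> (- p a) \<odot> \<one>"
      have p1: "p \<one> = 1" using p(1) by (simp add: character_def)
      have "m \<in> ?I" using a by (simp add: m_def p_add p_smult[of \<one>] p1)
      then have "\<phi> m \<in> M" using phi_M[OF T_one, of m] by simp
      then have "\<chi> (\<phi> m) = 0" using \<chi>(2) by blast
      moreover have "\<phi> m = \<phi> a + const_series (- p a) * 1"
        using a by (simp add: m_def phi_add phi_smult phi_one)
      moreover have "\<chi> (\<phi> a + const_series (- p a) * 1) = \<chi> (\<phi> a) - p a"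
      proof -
        have "\<phi> a \<in> T" using phi_T a by auto
        then have "\<chi> (\<phi> a + const_series (- p a) * 1) = \<chi> (\<phi> a) + \<chi> (const_series (- p a) * 1)"
          using \<chi>(1) T_const[of "- p a"] unfolding character_def by simp
        also have "\<chi> (const_series (- p a) * 1) = - p a * \<chi> 1"
          using \<chi>(1) T_one unfolding character_def series_alg_simps by (simp del: mult_1_right)
        also have "\<chi> 1 = 1" using \<chi>(1) unfolding character_def by simp
        finally show ?thesis by simp
      qed
      ultimately show ?thesis by simp
    qed
    ultimately show "\<exists>\<chi>. character (sub_alg series_alg T) \<chi> \<and> \<chi> s \<noteq> 0 \<and> (\<forall>a\<in>carrier R. \<chi> (\<phi> a) = p a)"
      using \<chi>(1) by blast
  qed (use G in auto)
qed

end

context comm_c_algebra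
begin

lemma idealI_scalar:
  assumes "J \<subseteq> carrier R" "\<zero> \<in> J" "\<And>x y. x \<in> J \<Longrightarrow> y \<in> J \<Longrightarrow> x \<oplus> y \<in> J"
    and "\<And>a x. a \<in> carrier R \<Longrightarrow> x \<in> J \<Longrightarrow> a \<otimes> x \<in> J"
  shows "ideal J R"
proof (rule idealI[OF ring_axioms])
  show "subgroup J (add_monoid R)"
  proof (rule add.subgroupI)
    fix x assume x: "x \<in> J"
    then have "x \<in> carrier R" using assms(1) by auto
    then have "\<ominus> x = (\<ominus> \<one>) \<otimes> x" by (simp add: l_minus)
    also have "\<dots> \<in> J" using assms(4)[of "\<ominus> \<one>" x] x by simp
    finally show "\<ominus> x \<in> J" .
  qed (use assms in auto)
  fix a x assume a: "a \<in> J" and x: "x \<in> carrier R"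
  show "x \<otimes> a \<in> J" using assms(4) a x by blast
  then show "a \<otimes> x \<in> J" using assms(1) a x m_comm[of a x] by auto
qed

lemma character_add: "character R p \<Longrightarrow> a \<in> carrier R \<Longrightarrow> b \<in> carrier R \<Longrightarrow> p (a \<oplus> b) = p a + p b"
  and character_mult: "character R p \<Longrightarrow> a \<in> carrier R \<Longrightarrow> b \<in> carrier R \<Longrightarrow> p (a \<otimes> b) = p a * p b"
  and character_smult: "character R p \<Longrightarrow> a \<in> carrier R \<Longrightarrow> p (c \<odot> a) = c * p a"
  and character_one: "character R p \<Longrightarrow> p \<one> = 1"
  by (simp_all add: character_def)

lemma character_zero: "character R p \<Longrightarrow> p \<zero> = 0"
  using character_smult[of p \<zero> 0] by simp

lemma character_kernel_ideal: "character R p \<Longrightarrow> ideal {a \<in> carrier R. p a = 0} R"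
  by (rule idealI_scalar) (auto simp: character_zero character_add character_mult)

end

lemma (in series_hom) kernel_ideal: "ideal {a \<in> carrier R. \<phi> a = 0} R"
  by (rule idealI_scalar) (auto simp: phi_zero phi_add phi_mult)

text \<open>Series form a domain, so finite products of elements of \<open>G\<close> stay outside
  the kernel and form a countable multiplicative set. Geometrically, an irreducible complex variety
  is not covered by countably many proper hypersurfaces.\<close>

lemma (in series_hom) exists_generic_character:
  assumes dep: "uncountable_dependent R"
    and G: "countable G" "G \<subseteq> carrier R" "\<And>g. g \<in> G \<Longrightarrow> \<phi> g \<noteq> 0"
  shows "\<exists>p. character R p \<and> (\<forall>a\<in>carrier R. \<phi> a = 0 \<longrightarrow> p a = 0) \<and> (\<forall>g\<in>G. p g \<noteq> 0)"
proof -
  define mon where "mon ws = foldr (\<otimes>) ws \<one>" for ws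
  define S where "S = mon ` lists G"
  have mon_Cons: "mon (g # ws) = g \<otimes> mon ws" and mon_Nil: "mon [] = \<one>" for g ws
    by (simp_all add: mon_def)
  have mon: "mon ws \<in> carrier R \<and> \<phi> (mon ws) \<noteq> 0" if "ws \<in> lists G" for ws
    using that
  proof (induction ws)
    case (Cons g ws)
    then have "g \<in> carrier R" "\<phi> g \<noteq> 0" using G by auto
    then show ?case using Cons by (simp add: mon_Cons phi_mult)
  qed (simp add: mon_Nil phi_one)
  have mon_append: "mon (us @ vs) = mon us \<otimes> mon vs" if "us \<in> lists G" "vs \<in> lists G" for us vs
    using that
  proof (induction us)
    case (Cons g us)
    have c: "g \<in> carrier R" "mon us \<in> carrier R" "mon vs \<in> carrier R"
      using Cons G(2) mon by auto
    show ?case using Cons c by (simp add: mon_Cons m_assoc)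
  qed (simp add: mon mon_Nil)
  let ?J = "{a \<in> carrier R. \<phi> a = 0}"
  have "\<exists>p. character R p \<and> (\<forall>a\<in>?J. p a = 0) \<and> (\<forall>s\<in>S. p s \<noteq> 0)"
  proof (rule exists_character[OF dep kernel_ideal])
    show "countable S" unfolding S_def using G(1) by simp
    show "S \<subseteq> carrier R" using mon by (auto simp: S_def)
    show "\<one> \<in> S" unfolding S_def by (rule image_eqI[of _ _ "[]"]) (simp_all add: mon_Nil)
    show "s \<otimes> t \<in> S" if "s \<in> S" "t \<in> S" for s t
    proof -
      from that obtain us vs where "us \<in> lists G" "vs \<in> lists G" "s = mon us" "t = mon vs"
        by (auto simp: S_def)
      then have "s \<otimes> t = mon (us @ vs)" "us @ vs \<in> lists G" by (simp_all add: mon_append)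
      then show ?thesis by (simp add: S_def)
    qed
    show "S \<inter> ?J = {}" using mon by (auto simp: S_def)
  qed
  then obtain p where p: "character R p" "\<forall>a\<in>?J. p a = 0" "\<forall>s\<in>S. p s \<noteq> 0" by blast
  have "g \<in> S" if "g \<in> G" for g
    unfolding S_def
  proof (rule image_eqI)
    show "g = mon [g]" using that G(2) by (auto simp: mon_Cons mon_Nil)
  qed (use that in simp)
  then show ?thesis using p by (intro exI[of _ p]) simp
qed


section \<open>Matrices\<close>

text \<open>At the empty word the matrix is the identity, so its determinant \<open>s\<close> has
  constant coefficient 1; \<open>B\<close> is the adjugate. Division by \<open>s\<close> is
  postponed until a character is applied, and then only the value of \<open>s\<close> has to be
  nonzero.\<close>

lemma adjugate_series:
  fixes M :: "nat \<Rightarrow> nat \<Rightarrow> 'a series"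
  assumes M: "\<And>i j. i < d \<Longrightarrow> j < d \<Longrightarrow> coeff_at (M i j) [] = (if i = j then 1 else 0)"
  shows "\<exists>B s. coeff_at s [] = 1 \<and>
    (\<forall>k<d. \<forall>j<d. (\<Sum>i<d. B k i * M i j) = (if k = j then s else 0))"
proof -
  define U where "U = mat d d (\<lambda>(i, j). M i j)"
  have U: "U \<in> carrier_mat d d" by (simp add: U_def)
  define B where "B = adj_mat U"
  have B: "B \<in> carrier_mat d d" "B * U = det U \<cdot>\<^sub>m 1\<^sub>m d"
    using adj_mat[OF U] by (auto simp: B_def)
  interpret h: comm_ring_hom "\<lambda>f :: 'a series. coeff_at f []"
    by unfold_locales simp_all
  have "map_mat (\<lambda>f. coeff_at f []) U = 1\<^sub>m d"
    by (rule eq_matI) (auto simp: U_def M)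
  then have "coeff_at (det U) [] = 1" using h.hom_det[of U] by simp
  moreover have "(\<Sum>i<d. B $$ (k, i) * M i j) = (if k = j then det U else 0)" if "k < d" "j < d" for k j
  proof -
    have "(B * U) $$ (k, j) = (\<Sum>i<d. B $$ (k, i) * M i j)"
      using carrier_matD[OF B(1)] that by (simp add: scalar_prod_def U_def atLeast0LessThan)
    then show ?thesis using that unfolding B(2) by auto
  qed
  ultimately show ?thesis by (intro exI[of _ "\<lambda>k i. B $$ (k, i)"] exI[of _ "det U"]) simp
qed

text \<open>A left inverse of a square matrix is also a right inverse, so multiplying the
  annihilated row vector by \<open>B\<close> recovers it and shows it to be zero.\<close>

lemma left_inverse_independent:
  fixes N B :: "nat \<Rightarrow> nat \<Rightarrow> complex"
  assumes B: "\<And>k j. k < d \<Longrightarrow> j < d \<Longrightarrow> (\<Sum>i<d. B k i * N i j) = (if k = j then 1 else 0)"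
    and c: "\<And>j. j < d \<Longrightarrow> (\<Sum>i<d. c i * N i j) = 0" and "i < d"
  shows "c i = 0"
proof -
  define U where "U = mat d d (\<lambda>(i, j). N i j)"
  define V where "V = mat d d (\<lambda>(i, j). B i j)"
  have UV: "U \<in> carrier_mat d d" "V \<in> carrier_mat d d" by (simp_all add: U_def V_def)
  have "V * U = 1\<^sub>m d"
    by (rule eq_matI) (auto simp: U_def V_def scalar_prod_def atLeast0LessThan B)
  then have "U * V = 1\<^sub>m d" using mat_mult_left_right_inverse UV by blast
  then have NB: "(\<Sum>k<d. N l k * B k i) = (if l = i then 1 else 0)" if "l < d" for l
  proof -
    have "(U * V) $$ (l, i) = (\<Sum>k<d. N l k * B k i)"
      using that \<open>i < d\<close> by (simp add: U_def V_def scalar_prod_def atLeast0LessThan)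
    then show ?thesis using \<open>U * V = 1\<^sub>m d\<close> that \<open>i < d\<close> by simp
  qed
  have "c i = (\<Sum>l<d. c l * (if l = i then 1 else 0))"
    using \<open>i < d\<close> by (simp add: sum.delta' if_distrib[of "\<lambda>x. _ * x"] cong: if_cong)
  also have "\<dots> = (\<Sum>l<d. \<Sum>k<d. c l * N l k * B k i)"
    by (rule sum.cong) (simp_all add: NB[symmetric] sum_distrib_left mult.assoc)
  also have "\<dots> = (\<Sum>k<d. (\<Sum>l<d. c l * N l k) * B k i)"
    by (subst sum.swap) (simp add: sum_distrib_right)
  also have "\<dots> = 0" using c by simp
  finally show ?thesis .
qed


section \<open>Quotients in coordinates\<close>

context c_algebra
begin

definition linear_form :: "('a \<Rightarrow> complex) \<Rightarrow> bool"
  where "linear_form f \<longleftrightarrow> (\<forall>x\<in>carrier A. \<forall>y\<in>carrier A. f (x \<oplus> y) = f x + f y) \<and>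
    (\<forall>c. \<forall>x\<in>carrier A. f (c \<odot> x) = c * f x)"

lemma linear_form_add: "linear_form f \<Longrightarrow> x \<in> carrier A \<Longrightarrow> y \<in> carrier A \<Longrightarrow> f (x \<oplus> y) = f x + f y"
  and linear_form_smult: "linear_form f \<Longrightarrow> x \<in> carrier A \<Longrightarrow> f (c \<odot> x) = c * f x"
  by (simp_all add: linear_form_def)

lemma linear_form_zero: "linear_form f \<Longrightarrow> f \<zero> = 0"
  using linear_form_smult[of f \<zero> 0] by simp

lemma linear_form_diff:
  "linear_form f \<Longrightarrow> x \<in> carrier A \<Longrightarrow> y \<in> carrier A \<Longrightarrow> f (x \<ominus> y) = f x - f y"
  using linear_form_smult[of f y "-1"]
  by (simp add: a_minus_def linear_form_add c_smult_minus_one[symmetric])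

lemma linear_form_lincomb:
  assumes "linear_form f" "range e \<subseteq> carrier A"
  shows "f (lincomb e n q) = (\<Sum>i<n. q i * f (e i))"
proof (induction n)
  case 0
  then show ?case using linear_form_zero[OF assms(1)] by (simp add: lincomb_def)
next
  case (Suc n)
  have "e n \<in> carrier A" using assms(2) by auto
  then show ?case using Suc assms
    by (simp add: lincomb_Suc linear_form_add linear_form_smult)
qed

definition c_subspace :: "'a set \<Rightarrow> bool"
  where "c_subspace V \<longleftrightarrow> V \<subseteq> carrier A \<and> \<zero> \<in> V \<and> (\<forall>x\<in>V. \<forall>y\<in>V. x \<oplus> y \<in> V) \<and>
    (\<forall>c. \<forall>x\<in>V. c \<odot> x \<in> V)"

lemma c_subspace_diff: "c_subspace V \<Longrightarrow> x \<in> V \<Longrightarrow> y \<in> V \<Longrightarrow> x \<ominus> y \<in> V"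
proof -
  assume V: "c_subspace V" "x \<in> V" "y \<in> V"
  then have "x \<oplus> (-1) \<odot> y \<in> V" "y \<in> carrier A" by (auto simp: c_subspace_def)
  then show "x \<ominus> y \<in> V" by (simp add: a_minus_def c_smult_minus_one)
qed

lemma c_subspace_lincomb:
  assumes "c_subspace V" "range e \<subseteq> carrier A" "\<And>i. i < n \<Longrightarrow> e i \<in> V"
  shows "lincomb e n q \<in> V"
  using assms(3)
proof (induction n)
  case 0
  then show ?case using assms(1) by (simp add: lincomb_def c_subspace_def)
next
  case (Suc n)
  then show ?case using assms(1) by (simp add: lincomb_Suc[OF assms(2)] c_subspace_def)
qed

lemma ideal_c_subspace:
  assumes "ideal J A" shows "c_subspace J"
proof -
  interpret J: ideal J A by fact
  have sub: "J \<subseteq> carrier A" by (rule J.a_subset)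
  have smult: "c \<odot> x \<in> J" if "x \<in> J" for c x
  proof -
    have x: "x \<in> carrier A" using that sub by auto
    have "(c \<odot> \<one>) \<otimes> x \<in> J" by (rule J.I_l_closed[OF that]) simp
    then show ?thesis unfolding c_smult_eq_mult[OF x, of c] .
  qed
  show ?thesis
    unfolding c_subspace_def using sub smult J.zero_closed J.a_closed by simp
qed

text \<open>A basis of A / V with its coordinate forms, expressed on representatives so that no
  quotient space is formed.\<close>

definition dual_system :: "'a set \<Rightarrow> nat \<Rightarrow> (nat \<Rightarrow> 'a) \<Rightarrow> (nat \<Rightarrow> 'a \<Rightarrow> complex) \<Rightarrow> bool"
  where "dual_system V d e \<kappa> \<longleftrightarrow> range e \<subseteq> carrier A \<and>
    (\<forall>i<d. linear_form (\<kappa> i) \<and> (\<forall>v\<in>V. \<kappa> i v = 0) \<and> (\<forall>j<d. \<kappa> i (e j) = (if i = j then 1 else 0))) \<and>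
    (\<forall>a\<in>carrier A. (\<forall>i<d. \<kappa> i a = 0) \<longrightarrow> a \<in> V)"

lemma dual_system_expand:
  assumes "dual_system V d e \<kappa>" "a \<in> carrier A"
  shows "a \<ominus> lincomb e d (\<lambda>i. \<kappa> i a) \<in> V"
proof -
  have e: "range e \<subseteq> carrier A" using assms by (simp add: dual_system_def)
  have "\<kappa> j (a \<ominus> lincomb e d (\<lambda>i. \<kappa> i a)) = 0" if "j < d" for j
  proof -
    have lin: "linear_form (\<kappa> j)" using assms(1) that by (simp add: dual_system_def)
    have "\<kappa> j (lincomb e d (\<lambda>i. \<kappa> i a)) = (\<Sum>i<d. \<kappa> i a * (if j = i then 1 else 0))"
      unfolding linear_form_lincomb[OF lin e]
      by (rule sum.cong) (use assms(1) that in \<open>auto simp: dual_system_def\<close>)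
    also have "\<dots> = \<kappa> j a" using that by (simp add: if_distrib[of "\<lambda>x. _ * x"] cong: if_cong)
    finally show ?thesis using linear_form_diff[OF lin assms(2)] lincomb_closed[OF e] by simp
  qed
  moreover have "a \<ominus> lincomb e d (\<lambda>i. \<kappa> i a) \<in> carrier A"
    using assms(2) lincomb_closed[OF e] by simp
  ultimately show ?thesis
    using assms(1)[unfolded dual_system_def, THEN conjunct2, THEN conjunct2] by blast
qed

text \<open>Induction on a list that spans modulo \<open>V\<close>, for all \<open>V\<close> at
  once: the first vector is absorbed into a larger subspace \<open>V'\<close>, and one further
  coordinate separates \<open>V\<close> from \<open>V'\<close>.\<close>

lemma exists_dual_system:
  assumes "c_subspace V" "set es \<subseteq> carrier A"
    and "\<And>W. c_subspace W \<Longrightarrow> V \<subseteq> W \<Longrightarrow> set es \<subseteq> W \<Longrightarrow> W = carrier A"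
  shows "\<exists>d e \<kappa>. dual_system V d e \<kappa>"
  using assms
proof (induction es arbitrary: V)
  case Nil
  then have "V = carrier A" by simp
  then show ?case by (intro exI[of _ 0] exI[of _ "\<lambda>_. \<zero>"]) (auto simp: dual_system_def)
next
  case (Cons e0 es)
  note V = Cons.prems(1)
  have Vc: "V \<subseteq> carrier A" and V0: "\<zero> \<in> V" and Va: "\<And>x y. x \<in> V \<Longrightarrow> y \<in> V \<Longrightarrow> x \<oplus> y \<in> V"
    and Vs: "\<And>c x. x \<in> V \<Longrightarrow> c \<odot> x \<in> V" using V by (auto simp: c_subspace_def)
  have e0: "e0 \<in> carrier A" using Cons.prems by simp
  show ?case
  proof (cases "e0 \<in> V")
    case True
    show ?thesis
      by (rule Cons.IH[OF V]) (use Cons.prems True in auto)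
  next
    case False
    define V' where "V' = {v \<oplus> c \<odot> e0 |v c. v \<in> V}"
    have V': "c_subspace V'"
      unfolding c_subspace_def
    proof (intro conjI ballI allI)
      show "V' \<subseteq> carrier A" using Vc e0 by (auto simp: V'_def)
      have "\<zero> \<oplus> 0 \<odot> e0 \<in> V'" using V0 unfolding V'_def by blast
      then show "\<zero> \<in> V'" using e0 by simp
    next
      fix x y assume "x \<in> V'" "y \<in> V'"
      then obtain v c w b where vw: "v \<in> V" "w \<in> V" "x = v \<oplus> c \<odot> e0" "y = w \<oplus> b \<odot> e0"
        by (auto simp: V'_def)
      then have "v \<in> carrier A" "w \<in> carrier A" using Vc by auto
      then have "x \<oplus> y = (v \<oplus> w) \<oplus> (c + b) \<odot> e0"
        using vw e0 by (simp add: c_smult_add_left a_ac)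
      then show "x \<oplus> y \<in> V'" using Va[OF vw(1,2)] by (auto simp: V'_def)
    next
      fix b x assume "x \<in> V'"
      then obtain v c where v: "v \<in> V" "x = v \<oplus> c \<odot> e0" by (auto simp: V'_def)
      then have "v \<in> carrier A" using Vc by auto
      then have "b \<odot> x = b \<odot> v \<oplus> (b * c) \<odot> e0" using v e0 by (simp add: c_smult_add_right c_smult_smult)
      then show "b \<odot> x \<in> V'" using Vs[OF v(1)] by (auto simp: V'_def)
    qed
    have V_V': "V \<subseteq> V'"
    proof
      fix v assume v: "v \<in> V"
      then have "v \<oplus> 0 \<odot> e0 \<in> V'" unfolding V'_def by blast
      moreover have "v \<in> carrier A" using v Vc by auto
      ultimately show "v \<in> V'" using e0 by simp
    qed
    have "\<zero> \<oplus> 1 \<odot> e0 \<in> V'" using V0 unfolding V'_def by blast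
    then have e0_V': "e0 \<in> V'" using e0 by simp
    have "\<exists>d e \<kappa>. dual_system V' d e \<kappa>"
    proof (rule Cons.IH[OF V'])
      show "set es \<subseteq> carrier A" using Cons.prems(2) by simp
      show "W = carrier A" if "c_subspace W" "V' \<subseteq> W" "set es \<subseteq> W" for W
        using Cons.prems(3)[of W] that V_V' e0_V' by auto
    qed
    then obtain d e \<kappa> where dual: "dual_system V' d e \<kappa>" by blast
    have e: "range e \<subseteq> carrier A" using dual by (simp add: dual_system_def)
    have e_c: "e j \<in> carrier A" for j using e by auto
    have \<kappa>_lin: "linear_form (\<kappa> i)" and \<kappa>_V': "\<And>v. v \<in> V' \<Longrightarrow> \<kappa> i v = 0"
      and \<kappa>_e: "\<And>j. j < d \<Longrightarrow> \<kappa> i (e j) = (if i = j then 1 else 0)" if "i < d" for i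
      using dual that by (auto simp: dual_system_def)
    \<comment> \<open>The coordinate at \<open>e0\<close> on \<open>V'\<close>, the direct sum of
      \<open>V\<close> and the line of \<open>e0\<close>; it is unique because \<open>e0\<close>
      lies outside \<open>V\<close>.\<close>
    define t where "t x = (THE c. \<exists>v\<in>V. x = v \<oplus> c \<odot> e0)" for x
    have t: "t (v \<oplus> c \<odot> e0) = c" if v: "v \<in> V" for v c
      unfolding t_def
    proof (rule the_equality)
      show "\<exists>w\<in>V. v \<oplus> c \<odot> e0 = w \<oplus> c \<odot> e0" using v by blast
      fix b assume "\<exists>w\<in>V. v \<oplus> c \<odot> e0 = w \<oplus> b \<odot> e0"
      then obtain w where w: "w \<in> V" "v \<oplus> c \<odot> e0 = w \<oplus> b \<odot> e0" by blast
      have vw: "v \<in> carrier A" "w \<in> carrier A" using v w Vc by auto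
      show "b = c"
      proof (rule ccontr)
        assume ne: "b \<noteq> c"
        define x where "x = b \<odot> e0"
        define y where "y = c \<odot> e0"
        have xy: "x \<in> carrier A" "y \<in> carrier A" using e0 by (simp_all add: x_def y_def)
        have "v \<ominus> w = (v \<oplus> y) \<ominus> y \<ominus> w" using vw xy by algebra
        then have "v \<ominus> w = (w \<oplus> x) \<ominus> y \<ominus> w" using w(2) by (simp only: x_def y_def)
        moreover have "(w \<oplus> x) \<ominus> y \<ominus> w = x \<ominus> y" using vw xy by algebra
        moreover have "x \<ominus> y = (b - c) \<odot> e0"
        proof -
          have "(b - c) \<odot> e0 = (b + - c) \<odot> e0" by simp
          also have "\<dots> = x \<oplus> (- c) \<odot> e0" unfolding x_def by (rule c_smult_add_left[OF e0])
          also have "(- c) \<odot> e0 = \<ominus> y"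
            unfolding y_def c_smult_minus_one[OF c_smult_closed[OF e0], symmetric] by (simp add: c_smult_smult e0)
          finally show ?thesis by (simp add: a_minus_def)
        qed
        ultimately have "(b - c) \<odot> e0 \<in> V" using c_subspace_diff[OF V v w(1)] by (simp only:)
        then have "inverse (b - c) \<odot> ((b - c) \<odot> e0) \<in> V" by (rule Vs)
        then show False using False ne e0 by (simp add: c_smult_smult)
      qed
    qed
    \<comment> \<open>The projection onto \<open>V'\<close> along the old basis. It extends
      \<open>t\<close> to the whole carrier so that the new form vanishes on the old basis
      vectors.\<close>
    define r where "r a = a \<ominus> lincomb e d (\<lambda>i. \<kappa> i a)" for a
    have r_V': "r a \<in> V'" if "a \<in> carrier A" for a
      unfolding r_def by (rule dual_system_expand[OF dual that])
    have r_V'_id: "r a = a" if "a \<in> V'" for a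
    proof -
      have "lincomb e d (\<lambda>i. \<kappa> i a) = \<zero>"
        using lincomb_cong[OF e, of d "\<lambda>i. \<kappa> i a" "\<lambda>_. 0"] \<kappa>_V' that lincomb_zero[OF e] by simp
      moreover have "a \<in> carrier A" using that V' by (auto simp: c_subspace_def)
      ultimately show ?thesis by (simp add: r_def a_minus_def)
    qed
    have r_add: "r (a \<oplus> b) = r a \<oplus> r b" if a: "a \<in> carrier A" and b: "b \<in> carrier A" for a b
    proof -
      have "lincomb e d (\<lambda>i. \<kappa> i (a \<oplus> b)) = lincomb e d (\<lambda>i. \<kappa> i a) \<oplus> lincomb e d (\<lambda>i. \<kappa> i b)"
        unfolding lincomb_add[OF e, symmetric]
        by (rule lincomb_cong[OF e]) (simp add: linear_form_add[OF \<kappa>_lin a b])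
      then show ?thesis
        using a b lincomb_closed[OF e] by (simp add: r_def a_minus_def minus_add a_ac)
    qed
    have r_smult: "r (c \<odot> a) = c \<odot> r a" if a: "a \<in> carrier A" for a c
    proof -
      have *: "lincomb e d (\<lambda>i. \<kappa> i (c \<odot> a)) = c \<odot> lincomb e d (\<lambda>i. \<kappa> i a)"
        unfolding lincomb_smult[OF e, symmetric]
        by (rule lincomb_cong[OF e]) (simp add: linear_form_smult[OF \<kappa>_lin a])
      show ?thesis
        using a lincomb_closed[OF e]
        by (simp add: r_def * a_minus_def c_smult_add_right c_smult_minus_one[symmetric] c_smult_smult)
    qed
    have r_e: "r (e j) = \<zero>" if "j < d" for j
    proof -
      have "lincomb e d (\<lambda>i. \<kappa> i (e j)) = lincomb e d (\<lambda>i. if i = j then 1 else 0)"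
        by (rule lincomb_cong[OF e]) (use \<kappa>_e that in simp)
      also have "\<dots> = e j" by (rule lincomb_unit[OF e that])
      finally have "lincomb e d (\<lambda>i. \<kappa> i (e j)) = e j" .
      then show ?thesis using e_c by (simp add: r_def a_minus_def r_neg)
    qed
    define \<kappa>' where "\<kappa>' i = (if i = d then \<lambda>a. t (r a) else \<kappa> i)" for i
    define e' where "e' = e(d := e0)"
    have lin_d: "linear_form (\<lambda>a. t (r a))"
      unfolding linear_form_def
    proof (intro conjI ballI allI)
      fix a b assume a: "a \<in> carrier A" and b: "b \<in> carrier A"
      obtain v c w k where vw: "v \<in> V" "w \<in> V" "r a = v \<oplus> c \<odot> e0" "r b = w \<oplus> k \<odot> e0"
        using r_V'[OF a] r_V'[OF b] by (auto simp: V'_def)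
      then have "v \<in> carrier A" "w \<in> carrier A" using Vc by auto
      then have "r (a \<oplus> b) = (v \<oplus> w) \<oplus> (c + k) \<odot> e0"
        using vw e0 r_add[OF a b] by (simp add: c_smult_add_left a_ac)
      then show "t (r (a \<oplus> b)) = t (r a) + t (r b)" using vw t Va by simp
    next
      fix b a assume a: "a \<in> carrier A"
      obtain v c where v: "v \<in> V" "r a = v \<oplus> c \<odot> e0" using r_V'[OF a] by (auto simp: V'_def)
      then have "v \<in> carrier A" using Vc by auto
      then have "r (b \<odot> a) = b \<odot> v \<oplus> (b * c) \<odot> e0"
        using v e0 r_smult[OF a] by (simp add: c_smult_add_right c_smult_smult)
      then show "t (r (b \<odot> a)) = b * t (r a)" using v t Vs by simp
    qed
    have t_V: "t v = 0" if "v \<in> V" for v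
    proof -
      have "v \<in> carrier A" using that Vc by auto
      then show ?thesis using t[OF that, of 0] e0 by simp
    qed
    have t_e0: "t e0 = 1" using t[OF V0, of 1] e0 by simp
    have "dual_system V (Suc d) e' \<kappa>'"
      unfolding dual_system_def
    proof (intro conjI allI impI ballI)
      show "range e' \<subseteq> carrier A" using e e0 by (auto simp: e'_def)
    next
      fix i assume "i < Suc d"
      then show "linear_form (\<kappa>' i)" using lin_d \<kappa>_lin by (auto simp: \<kappa>'_def)
    next
      fix i v assume "i < Suc d" "v \<in> V"
      then show "\<kappa>' i v = 0" using \<kappa>_V' V_V' t_V r_V'_id[of v] by (auto simp: \<kappa>'_def)
    next
      fix i j assume "i < Suc d" "j < Suc d"
      then show "\<kappa>' i (e' j) = (if i = j then 1 else 0)"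
        using \<kappa>_V'[OF _ e0_V'] \<kappa>_e r_e r_V'_id[OF e0_V'] t_e0 t_V[OF V0]
        by (auto simp: \<kappa>'_def e'_def less_Suc_eq)
    next
      fix a assume a: "a \<in> carrier A" and z: "\<forall>i<Suc d. \<kappa>' i a = 0"
      have "\<kappa> i a = 0" if "i < d" for i using z[rule_format, of i] that by (simp add: \<kappa>'_def)
      then have aV': "a \<in> V'"
        using dual[unfolded dual_system_def, THEN conjunct2, THEN conjunct2] a by blast
      then obtain v c where v: "v \<in> V" "a = v \<oplus> c \<odot> e0" by (auto simp: V'_def)
      have "t (r a) = 0" using z[rule_format, of d] by (simp add: \<kappa>'_def)
      then have "c = 0" using r_V'_id[OF aV'] t[OF v(1), of c] v(2) by simp
      moreover have "v \<in> carrier A" using v Vc by auto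
      ultimately show "a \<in> V" using v e0 by simp
    qed
    then show ?thesis by blast
  qed
qed

text \<open>Both families of forms identify a quotient with complex d-space and transport its
  product to the same constants \<open>c\<close> and its unit to the same vector. Matching
  coordinates is the isomorphism.\<close>

lemma quot_isomorphic:
  fixes \<kappa> \<psi> :: "nat \<Rightarrow> 'a \<Rightarrow> complex"
  assumes I: "ideal I A" and J: "ideal J A"
    and lin: "\<And>k. k < d \<Longrightarrow> linear_form (\<kappa> k)" "\<And>k. k < d \<Longrightarrow> linear_form (\<psi> k)"
    and ker: "\<And>a. a \<in> carrier A \<Longrightarrow> (\<forall>k<d. \<kappa> k a = 0) \<longleftrightarrow> a \<in> I"
      "\<And>a. a \<in> carrier A \<Longrightarrow> (\<forall>k<d. \<psi> k a = 0) \<longleftrightarrow> a \<in> J"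
    and surj: "\<And>v. \<exists>a\<in>carrier A. \<forall>k<d. \<kappa> k a = v k" "\<And>v. \<exists>a\<in>carrier A. \<forall>k<d. \<psi> k a = v k"
    and mult: "\<And>a b k. a \<in> carrier A \<Longrightarrow> b \<in> carrier A \<Longrightarrow> k < d \<Longrightarrow>
        \<kappa> k (a \<otimes> b) = (\<Sum>i<d. \<Sum>j<d. \<kappa> i a * \<kappa> j b * c i j k)"
      "\<And>a b k. a \<in> carrier A \<Longrightarrow> b \<in> carrier A \<Longrightarrow> k < d \<Longrightarrow>
        \<psi> k (a \<otimes> b) = (\<Sum>i<d. \<Sum>j<d. \<psi> i a * \<psi> j b * c i j k)"
    and one: "\<And>k. k < d \<Longrightarrow> \<kappa> k \<one> = \<psi> k \<one>"
  shows "c_alg_isomorphic (quot_alg A J) (quot_alg A I)"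
proof -
  interpret I: ideal I A by fact
  interpret J: ideal J A by fact
  have coset_I: "I +> a = I +> b \<longleftrightarrow> (\<forall>k<d. \<kappa> k a = \<kappa> k b)"
    if "a \<in> carrier A" "b \<in> carrier A" for a b
    using quotient_eq_iff_same_a_r_cos[OF I that] ker(1)[of "a \<ominus> b"] that lin(1)
    by (auto simp: linear_form_diff)
  have coset_J: "J +> a = J +> b \<longleftrightarrow> (\<forall>k<d. \<psi> k a = \<psi> k b)"
    if "a \<in> carrier A" "b \<in> carrier A" for a b
    using quotient_eq_iff_same_a_r_cos[OF J that] ker(2)[of "a \<ominus> b"] that lin(2)
    by (auto simp: linear_form_diff)
  \<comment> \<open>Any \<open>b\<close> with the coordinates of \<open>a\<close> will do, because
    the coordinates determine the coset.\<close>
  define h where "h U = (SOME V. \<exists>a\<in>carrier A. \<exists>b\<in>carrier A. U = J +> a \<and> V = I +> b \<and>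
    (\<forall>k<d. \<kappa> k b = \<psi> k a))" for U
  have h: "h (J +> a) = I +> b" if a: "a \<in> carrier A" and b: "b \<in> carrier A" and ab: "\<forall>k<d. \<kappa> k b = \<psi> k a" for a b
    unfolding h_def
  proof (rule some_equality)
    show "\<exists>a'\<in>carrier A. \<exists>b'\<in>carrier A. J +> a = J +> a' \<and> I +> b = I +> b' \<and> (\<forall>k<d. \<kappa> k b' = \<psi> k a')"
      using that by blast
    fix V assume "\<exists>a'\<in>carrier A. \<exists>b'\<in>carrier A. J +> a = J +> a' \<and> V = I +> b' \<and> (\<forall>k<d. \<kappa> k b' = \<psi> k a')"
    then obtain a' b' where ab': "a' \<in> carrier A" "b' \<in> carrier A" "J +> a = J +> a'" "V = I +> b'"
      "\<forall>k<d. \<kappa> k b' = \<psi> k a'" by blast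
    then have "\<forall>k<d. \<kappa> k b' = \<kappa> k b" using coset_J[OF a ab'(1)] ab by simp
    then show "V = I +> b" using coset_I[OF ab'(2) b] ab'(4) by simp
  qed
  have ex: "\<exists>b\<in>carrier A. \<forall>k<d. \<kappa> k b = \<psi> k a" for a using surj(1)[of "\<lambda>k. \<psi> k a"] .
  have carr: "carrier (A Quot K) = (\<lambda>a. K +> a) ` carrier A" for K
    by (auto simp: FactRing_def A_RCOSETS_def')
  note I_hom = I.rcos_ring_hom and J_hom = J.rcos_ring_hom
  have "h \<in> c_alg_iso (quot_alg A J) (quot_alg A I)"
    unfolding c_alg_iso_def ring_iso_def
  proof (intro CollectI conjI ballI allI)
    show "h \<in> Ring.ring_hom (quot_alg A J) (quot_alg A I)"
    proof (rule ring_hom_memI)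
      fix U assume "U \<in> carrier (quot_alg A J)"
      then obtain a where a: "a \<in> carrier A" "U = J +> a" by (auto simp: quot_alg_simps carr)
      obtain b where b: "b \<in> carrier A" "\<forall>k<d. \<kappa> k b = \<psi> k a" using ex by blast
      show "h U \<in> carrier (quot_alg A I)" using h[OF a(1) b] a b by (simp add: quot_alg_simps carr)
      fix V assume "V \<in> carrier (quot_alg A J)"
      then obtain a' where a': "a' \<in> carrier A" "V = J +> a'" by (auto simp: quot_alg_simps carr)
      obtain b' where b': "b' \<in> carrier A" "\<forall>k<d. \<kappa> k b' = \<psi> k a'" using ex by blast
      have "h (J +> (a \<otimes> a')) = I +> (b \<otimes> b')"
      proof (rule h)
        show "\<forall>k<d. \<kappa> k (b \<otimes> b') = \<psi> k (a \<otimes> a')"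
          using a a' b b' by (auto simp: mult intro!: sum.cong)
      qed (use a a' b b' in auto)
      then show "h (U \<otimes>\<^bsub>quot_alg A J\<^esub> V) = h U \<otimes>\<^bsub>quot_alg A I\<^esub> h V"
        using h[OF a(1) b] h[OF a'(1) b'] a a' b b'
          ring_hom_mult[OF I_hom, of b b'] ring_hom_mult[OF J_hom, of a a']
        by (simp add: quot_alg_simps)
      have "h (J +> (a \<oplus> a')) = I +> (b \<oplus> b')"
      proof (rule h)
        show "\<forall>k<d. \<kappa> k (b \<oplus> b') = \<psi> k (a \<oplus> a')"
          using a a' b b' lin by (auto simp: linear_form_add)
      qed (use a a' b b' in auto)
      then show "h (U \<oplus>\<^bsub>quot_alg A J\<^esub> V) = h U \<oplus>\<^bsub>quot_alg A I\<^esub> h V"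
        using h[OF a(1) b] h[OF a'(1) b'] a a' b b'
          ring_hom_add[OF I_hom, of b b'] ring_hom_add[OF J_hom, of a a']
        by (simp add: quot_alg_simps)
    next
      have "h (J +> \<one>) = I +> \<one>" by (rule h) (use one in auto)
      then show "h \<one>\<^bsub>quot_alg A J\<^esub> = \<one>\<^bsub>quot_alg A I\<^esub>"
        using ring_hom_one[OF I_hom] ring_hom_one[OF J_hom] by (simp add: quot_alg_simps)
    qed
    show "bij_betw h (carrier (quot_alg A J)) (carrier (quot_alg A I))"
      unfolding bij_betw_def
    proof
      show "inj_on h (carrier (quot_alg A J))"
      proof (rule inj_onI)
        fix U V assume "U \<in> carrier (quot_alg A J)" "V \<in> carrier (quot_alg A J)" and eq: "h U = h V"
        then obtain a a' where a: "a \<in> carrier A" "U = J +> a" "a' \<in> carrier A" "V = J +> a'"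
          by (auto simp: quot_alg_simps carr)
        obtain b where b: "b \<in> carrier A" "\<forall>k<d. \<kappa> k b = \<psi> k a" using ex by blast
        obtain b' where b': "b' \<in> carrier A" "\<forall>k<d. \<kappa> k b' = \<psi> k a'" using ex by blast
        have "I +> b = I +> b'" using eq h[OF a(1) b] h[OF a(3) b'] a by simp
        then show "U = V" using coset_I[OF b(1) b'(1)] coset_J[OF a(1,3)] a b b' by simp
      qed
      show "h ` carrier (quot_alg A J) = carrier (quot_alg A I)"
      proof (intro equalityI subsetI)
        fix V assume "V \<in> h ` carrier (quot_alg A J)"
        then obtain a where a: "a \<in> carrier A" "V = h (J +> a)" by (auto simp: quot_alg_simps carr)
        obtain b where b: "b \<in> carrier A" "\<forall>k<d. \<kappa> k b = \<psi> k a" using ex by blast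
        show "V \<in> carrier (quot_alg A I)" using h[OF a(1) b] a b by (simp add: quot_alg_simps carr)
      next
        fix V assume "V \<in> carrier (quot_alg A I)"
        then obtain b where b: "b \<in> carrier A" "V = I +> b" by (auto simp: quot_alg_simps carr)
        obtain a where a: "a \<in> carrier A" "\<forall>k<d. \<psi> k a = \<kappa> k b" using surj(2)[of "\<lambda>k. \<kappa> k b"] by blast
        have "V = h (J +> a)" using h[OF a(1) b(1)] a b by simp
        then show "V \<in> h ` carrier (quot_alg A J)" using a by (auto simp: quot_alg_simps carr)
      qed
    qed
    fix z U assume "U \<in> carrier (quot_alg A J)"
    then obtain a where a: "a \<in> carrier A" "U = J +> a" by (auto simp: quot_alg_simps carr)
    obtain b where b: "b \<in> carrier A" "\<forall>k<d. \<kappa> k b = \<psi> k a" using ex by blast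
    have "h (J +> (z \<odot> a)) = I +> (z \<odot> b)"
    proof (rule h)
      show "\<forall>k<d. \<kappa> k (z \<odot> b) = \<psi> k (z \<odot> a)" using a b lin by (auto simp: linear_form_smult)
    qed (use a b in auto)
    then show "h (z \<odot>\<^bsub>quot_alg A J\<^esub> U) = z \<odot>\<^bsub>quot_alg A I\<^esub> h U"
      using h[OF a(1) b] a b quot_alg_smult[OF I, of b z] quot_alg_smult[OF J, of a z] by simp
  qed
  then show ?thesis by (auto simp: c_alg_isomorphic_def)
qed

end

lemma c_alg_isomorphic_trans:
  assumes "c_alg_isomorphic A B" "c_alg_isomorphic B C"
  shows "c_alg_isomorphic A C"
proof -
  obtain f g where fg: "f \<in> c_alg_iso A B" "g \<in> c_alg_iso B C"
    using assms by (auto simp: c_alg_isomorphic_def)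
  have "g \<circ> f \<in> ring_iso A C"
    using fg by (intro ring_iso_set_trans[of f A B]) (auto simp: c_alg_iso_def)
  moreover have "f a \<in> carrier B" if "a \<in> carrier A" for a
    using fg(1) ring_hom_closed[OF _ that, of f B] by (auto simp: c_alg_iso_def ring_iso_def)
  ultimately have "g \<circ> f \<in> c_alg_iso A C" using fg by (simp add: c_alg_iso_def)
  then show ?thesis by (auto simp: c_alg_isomorphic_def)
qed


section \<open>Poisson orders at a point of the centre\<close>

sublocale poisson_order \<subseteq> c_algebra A
  using affine by (simp add: affine_c_algebra_def)

context poisson_order
begin

lemma Z_subset: "Z \<subseteq> carrier A"
  and Z_central: "z \<in> Z \<Longrightarrow> a \<in> carrier A \<Longrightarrow> z \<otimes> a = a \<otimes> z"
  using central_Z by (auto simp: central_subset_def)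

lemma Z_carrier: "z \<in> Z \<Longrightarrow> z \<in> carrier A"
  using Z_subset by blast

end

sublocale poisson_order \<subseteq> Z: comm_c_algebra "sub_alg A Z"
  using comm_c_algebra_sub_alg[OF subalgebra_Z] Z_central Z_carrier by blast

context poisson_order
begin

lemma Z_one: "\<one> \<in> Z" and Z_zero: "\<zero> \<in> Z"
  and Z_add: "x \<in> Z \<Longrightarrow> y \<in> Z \<Longrightarrow> x \<oplus> y \<in> Z"
  and Z_mult: "x \<in> Z \<Longrightarrow> y \<in> Z \<Longrightarrow> x \<otimes> y \<in> Z"
  and Z_smult: "x \<in> Z \<Longrightarrow> c \<odot> x \<in> Z"
  using Z.one_closed Z.zero_closed Z.a_closed[of x y] Z.m_closed[of x y] Z.c_smult_closed[of x c]
  by simp_all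

lemma Z_diff: "x \<in> Z \<Longrightarrow> y \<in> Z \<Longrightarrow> x \<ominus> y \<in> Z"
  using Z_add[of x "(-1) \<odot> y"] Z_smult[of y "-1"] c_smult_minus_one[of y] Z_carrier[of y]
  by (simp add: a_minus_def)

lemma uncountable_dependent_A: "uncountable_dependent A"
  and countable_spanning: "\<exists>B. countable B \<and> B \<subseteq> carrier A \<and> carrier A = c_span A B"
proof -
  obtain S where S: "finite S" "S \<subseteq> carrier A" "\<And>B. c_subalgebra B A \<Longrightarrow> S \<subseteq> B \<Longrightarrow> B = carrier A"
    using affine unfolding affine_c_algebra_def by blast
  obtain B where B: "countable B" "B \<subseteq> carrier A" "S \<subseteq> c_span A B" "c_subalgebra (c_span A B) A"
    using countable_generated_subalgebra[OF countable_finite[OF S(1)] S(2)] by blast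
  have eq: "c_span A B = carrier A" by (rule S(3)[OF B(4,3)])
  show "uncountable_dependent A" by (rule uncountable_dependentI[OF B(1,2)]) (simp add: eq)
  show "\<exists>B. countable B \<and> B \<subseteq> carrier A \<and> carrier A = c_span A B" using B eq by blast
qed

lemma uncountable_dependent_Z: "uncountable_dependent (sub_alg A Z)"
  by (rule uncountable_dependent_subalgebra[OF subalgebra_Z uncountable_dependent_A])

text \<open>\<open>Z.exists_character\<close> with \<open>S = {\<one>}\<close> supplies a character
  that vanishes on \<open>m\<close>; its kernel is proper and hence equal to
  \<open>m\<close>.\<close>

lemma exists_point:
  assumes "maximalideal m (sub_alg A Z)"
  shows "\<exists>ev. character (sub_alg A Z) ev \<and> m = {z \<in> Z. ev z = 0}"
proof -
  interpret m: maximalideal m "sub_alg A Z" by fact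
  have one: "\<one> \<notin> m" using m.one_imp_carrier m.I_notcarr by auto
  have "\<exists>ev. character (sub_alg A Z) ev \<and> (\<forall>a\<in>m. ev a = 0) \<and> (\<forall>s\<in>{\<one>}. ev s \<noteq> 0)"
    by (rule Z.exists_character[OF uncountable_dependent_Z m.is_ideal]) (use one Z_one in auto)
  then obtain ev where ev: "character (sub_alg A Z) ev" "\<forall>a\<in>m. ev a = 0" by blast
  let ?K = "{z \<in> carrier (sub_alg A Z). ev z = 0}"
  have K: "ideal ?K (sub_alg A Z)" by (rule Z.character_kernel_ideal[OF ev(1)])
  have "m \<subseteq> ?K" using ev(2) m.a_subset by auto
  moreover have "?K \<subseteq> carrier (sub_alg A Z)" by auto
  ultimately have "?K = m \<or> ?K = carrier (sub_alg A Z)" by (rule m.I_maximal[OF K])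
  moreover have "\<one> \<notin> ?K" using Z.character_one[OF ev(1)] by simp
  then have "?K \<noteq> carrier (sub_alg A Z)" using Z_one by auto
  ultimately have "m = {z \<in> Z. ev z = 0}" by auto
  then show ?thesis using ev(1) by blast
qed

section \<open>Submodules over \<open>Z\<close>, words of derivations and Taylor series\<close>

definition z_submodule :: "'a set \<Rightarrow> bool"
  where "z_submodule N \<longleftrightarrow> N \<subseteq> carrier A \<and> \<zero> \<in> N \<and> (\<forall>x\<in>N. \<forall>y\<in>N. x \<oplus> y \<in> N) \<and>
    (\<forall>z\<in>Z. \<forall>x\<in>N. z \<otimes> x \<in> N)"

lemma z_submoduleD:
  assumes "z_submodule N"
  shows "x \<in> N \<Longrightarrow> x \<in> carrier A" "\<zero> \<in> N" "x \<in> N \<Longrightarrow> y \<in> N \<Longrightarrow> x \<oplus> y \<in> N"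
    "z \<in> Z \<Longrightarrow> x \<in> N \<Longrightarrow> z \<otimes> x \<in> N"
  using assms by (auto simp: z_submodule_def)

text \<open>Generation is phrased as a test for submodules, so that a property stable under the
  module operations needs to be checked on the list only.\<close>

lemma finite_generators:
  "\<exists>es. set es \<subseteq> carrier A \<and> (\<forall>N. z_submodule N \<longrightarrow> set es \<subseteq> N \<longrightarrow> N = carrier A)"
proof -
  obtain S where S: "finite S" "S \<subseteq> carrier A"
    "\<And>a. a \<in> carrier A \<Longrightarrow> \<exists>f\<in>S \<rightarrow> Z. a = (\<Oplus>s\<in>S. f s \<otimes> s)"
    using fg_over_Z unfolding fg_module_over_def by blast
  obtain es where es: "set es = S" using finite_list[OF S(1)] by blast
  have "N = carrier A" if N: "z_submodule N" "S \<subseteq> N" for N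
  proof
    note Nd = z_submoduleD[OF N(1)]
    show "N \<subseteq> carrier A" using Nd(1) by blast
    have "(\<Oplus>s\<in>F. f s \<otimes> s) \<in> N" if "f \<in> S \<rightarrow> Z" "F \<subseteq> S" for f F
      using finite_subset[OF that(2) S(1)] that
    proof (induction F)
      case empty
      then show ?case using Nd(2) by simp
    next
      case (insert s F)
      have fs: "f s \<otimes> s \<in> N" using insert N(2) Nd(4) by blast
      have "f t \<otimes> t \<in> carrier A" if "t \<in> F" for t
      proof -
        have "t \<in> S" using that insert.prems by auto
        then show ?thesis using insert.prems(1) S(2) Z_carrier by (auto intro!: m_closed)
      qed
      then have "(\<Oplus>s\<in>insert s F. f s \<otimes> s) = f s \<otimes> s \<oplus> (\<Oplus>s\<in>F. f s \<otimes> s)"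
        using insert.hyps Nd(1)[OF fs] by (intro finsum_insert) auto
      moreover have "(\<Oplus>s\<in>F. f s \<otimes> s) \<in> N" using insert by simp
      ultimately show ?case using fs Nd(3) by simp
    qed
    then show "carrier A \<subseteq> N" using S(3) by blast
  qed
  then show ?thesis using es S(2) by (intro exI[of _ es]) simp
qed

text \<open>Extended by zero outside \<open>Z\<close>, so that words over the whole type act.\<close>

definition der :: "'a \<Rightarrow> 'a \<Rightarrow> 'a"
  where "der z a = (if z \<in> Z then D z a else \<zero>)"

lemma der_closed: "a \<in> carrier A \<Longrightarrow> der z a \<in> carrier A"
  and der_add: "a \<in> carrier A \<Longrightarrow> b \<in> carrier A \<Longrightarrow> der z (a \<oplus> b) = der z a \<oplus> der z b"
  and der_smult: "a \<in> carrier A \<Longrightarrow> der z (c \<odot> a) = c \<odot> der z a"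
  and der_mult: "a \<in> carrier A \<Longrightarrow> b \<in> carrier A \<Longrightarrow> der z (a \<otimes> b) = der z a \<otimes> b \<oplus> a \<otimes> der z b"
  and der_Z: "a \<in> Z \<Longrightarrow> der z a \<in> Z"
  using D_derivation D_stable Z_zero by (auto simp: der_def c_derivations_def Pi_def)

lemma der_one: "der z \<one> = \<zero>"
proof -
  have "der z \<one> = der z \<one> \<oplus> der z \<one>"
    using der_mult[of \<one> \<one> z] der_closed[of \<one> z] by simp
  then show ?thesis using der_closed[of \<one> z] by (metis add.r_cancel_one' one_closed)
qed

lemma der_zero: "der z \<zero> = \<zero>"
  using der_smult[of \<zero> z 0] der_closed[of \<zero> z] by simp

text \<open>The head of the word acts first, so that prefixing a letter corresponds to
  \<open>shift\<close>.\<close>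

primrec act :: "'a list \<Rightarrow> 'a \<Rightarrow> 'a" where
  "act [] a = a"
| "act (z # w) a = act w (der z a)"

lemma act_closed: "a \<in> carrier A \<Longrightarrow> act w a \<in> carrier A"
  by (induction w arbitrary: a) (simp_all add: der_closed)

lemma act_Z: "a \<in> Z \<Longrightarrow> act w a \<in> Z"
  by (induction w arbitrary: a) (simp_all add: der_Z)

lemma act_add: "a \<in> carrier A \<Longrightarrow> b \<in> carrier A \<Longrightarrow> act w (a \<oplus> b) = act w a \<oplus> act w b"
  by (induction w arbitrary: a b) (simp_all add: der_closed der_add)

lemma act_smult: "a \<in> carrier A \<Longrightarrow> act w (c \<odot> a) = c \<odot> act w a"
  by (induction w arbitrary: a) (simp_all add: der_closed der_smult)

lemma act_zero: "act w \<zero> = \<zero>"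
  by (induction w) (simp_all add: der_zero)

text \<open>The expansion of \<open>f\<close> along the formal flows. It serves both for
  \<open>ev\<close>, which is additive on \<open>Z\<close> only, and for the fibre coordinates on
  all of \<open>A\<close>.\<close>

definition taylor :: "('a \<Rightarrow> complex) \<Rightarrow> 'a \<Rightarrow> 'a series"
  where "taylor f a = Series (\<lambda>w. f (act w a))"

lemma coeff_at_taylor: "coeff_at (taylor f a) w = f (act w a)"
  by (simp add: taylor_def)

lemma shift_taylor: "shift z (taylor f a) = taylor f (der z a)"
  by (rule series_eqI) (simp add: coeff_at_taylor)

lemma taylor_one: "f \<zero> = 0 \<Longrightarrow> taylor f \<one> = const_series (f \<one>)"
proof (rule series_eqI)
  fix w assume "f \<zero> = 0"
  then show "coeff_at (taylor f \<one>) w = coeff_at (const_series (f \<one>)) w"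
    by (cases w) (simp_all add: coeff_at_taylor der_one act_zero)
qed

lemma taylor_add:
  assumes "linear_form f" "a \<in> carrier A" "b \<in> carrier A"
  shows "taylor f (a \<oplus> b) = taylor f a + taylor f b"
  by (rule series_eqI)
     (simp add: coeff_at_taylor act_add[OF assms(2,3)]
       linear_form_add[OF assms(1) act_closed[OF assms(2)] act_closed[OF assms(3)]])

lemma taylor_smult:
  assumes "linear_form f" "a \<in> carrier A"
  shows "taylor f (c \<odot> a) = const_series c * taylor f a"
  by (rule series_eqI)
     (simp add: coeff_at_taylor act_smult[OF assms(2)]
       linear_form_smult[OF assms(1) act_closed[OF assms(2)]])

end

locale order_point = poisson_order +
  fixes ev :: "'a \<Rightarrow> complex"
  assumes ev: "character (sub_alg A Z) ev"
begin

lemma ev_add: "a \<in> Z \<Longrightarrow> b \<in> Z \<Longrightarrow> ev (a \<oplus> b) = ev a + ev b"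
  and ev_mult: "a \<in> Z \<Longrightarrow> b \<in> Z \<Longrightarrow> ev (a \<otimes> b) = ev a * ev b"
  and ev_smult: "a \<in> Z \<Longrightarrow> ev (c \<odot> a) = c * ev a"
  and ev_one: "ev \<one> = 1" and ev_zero: "ev \<zero> = 0"
  using Z.character_add[OF ev] Z.character_mult[OF ev] Z.character_smult[OF ev]
    Z.character_one[OF ev] Z.character_zero[OF ev] by simp_all

lemma ev_diff: "a \<in> Z \<Longrightarrow> b \<in> Z \<Longrightarrow> ev (a \<ominus> b) = ev a - ev b"
proof -
  assume a: "a \<in> Z" and b: "b \<in> Z"
  have "ev a = ev ((a \<ominus> b) \<oplus> b)"
    using Z_carrier[OF a] Z_carrier[OF b] by (simp add: a_minus_def a_assoc l_neg)
  then show ?thesis using ev_add[OF Z_diff[OF a b] b] by simp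
qed

definition point_ideal :: "'a set"
  where "point_ideal = {z \<in> Z. ev z = 0}"

definition fibre_kernel :: "'a set"
  where "fibre_kernel = ideal_prod A point_ideal (carrier A)"

lemma point_ideal_ideal: "ideal point_ideal (sub_alg A Z)"
  using Z.character_kernel_ideal[OF ev] by (simp add: point_ideal_def)

lemma fibre_kernel_ideal: "ideal fibre_kernel A"
  unfolding fibre_kernel_def by (rule fibre_ideal[OF point_ideal_ideal])

lemma fibre_kernel_Z_mult:
  assumes z: "z \<in> Z" and a: "a \<in> carrier A"
  shows "z \<otimes> a \<ominus> ev z \<odot> a \<in> fibre_kernel"
proof -
  have s: "ev z \<odot> \<one> \<in> Z" by (rule Z_smult[OF Z_one])
  have "z \<ominus> ev z \<odot> \<one> \<in> point_ideal"
    using z s Z_diff[OF z s] by (simp add: point_ideal_def ev_diff ev_smult[OF Z_one] ev_one)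
  then have "(z \<ominus> ev z \<odot> \<one>) \<otimes> a \<in> fibre_kernel"
    unfolding fibre_kernel_def using a by (rule ideal_prod.prod)
  also have "(z \<ominus> ev z \<odot> \<one>) \<otimes> a = z \<otimes> a \<ominus> ev z \<odot> a"
    using Z_carrier[OF z] a by (simp add: a_minus_def l_distr l_minus smult_mult_left)
  finally show ?thesis .
qed

sublocale jet: series_hom "sub_alg A Z" "taylor ev"
proof
  show "taylor ev \<one>\<^bsub>sub_alg A Z\<^esub> = 1" using taylor_one[of ev] ev_zero ev_one by simp
  fix a assume "a \<in> carrier (sub_alg A Z)"
  then have a: "a \<in> Z" by simp
  show "taylor ev (c \<odot>\<^bsub>sub_alg A Z\<^esub> a) = const_series c * taylor ev a" for c
    by (rule series_eqI)
       (simp add: coeff_at_taylor act_smult[OF Z_carrier[OF a]] ev_smult[OF act_Z[OF a]])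
  fix b assume "b \<in> carrier (sub_alg A Z)"
  then have b: "b \<in> Z" by simp
  have add: "taylor ev (a \<oplus> b) = taylor ev a + taylor ev b" if "a \<in> Z" "b \<in> Z" for a b
    by (rule series_eqI)
       (simp add: coeff_at_taylor act_add[OF Z_carrier[OF that(1)] Z_carrier[OF that(2)]]
         ev_add[OF act_Z[OF that(1)] act_Z[OF that(2)]])
  show "taylor ev (a \<oplus>\<^bsub>sub_alg A Z\<^esub> b) = taylor ev a + taylor ev b" using add[OF a b] by simp
  \<comment> \<open>At the empty word this is multiplicativity of \<open>ev\<close>; longer words
    follow because \<open>der x\<close> and \<open>shift x\<close> obey the same Leibniz
    rule.\<close>
  have "coeff_at (taylor ev (a \<otimes> b)) w = coeff_at (taylor ev a * taylor ev b) w"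
    if "a \<in> Z" "b \<in> Z" for w a b
    using that
  proof (induction w arbitrary: a b)
    case Nil
    then show ?case by (simp add: coeff_at_taylor ev_mult)
  next
    case (Cons x w)
    have "coeff_at (taylor ev (a \<otimes> b)) (x # w) = coeff_at (taylor ev (der x (a \<otimes> b))) w"
      by (simp add: coeff_at_taylor)
    also have "der x (a \<otimes> b) = der x a \<otimes> b \<oplus> a \<otimes> der x b"
      using Cons.prems by (simp add: der_mult Z_carrier)
    also have "taylor ev \<dots> = taylor ev (der x a \<otimes> b) + taylor ev (a \<otimes> der x b)"
      using Cons.prems by (intro add Z_mult der_Z)
    finally show ?case
      using Cons.prems by (simp add: Cons.IH der_Z shift_taylor)
  qed
  then show "taylor ev (a \<otimes>\<^bsub>sub_alg A Z\<^esub> b) = taylor ev a * taylor ev b"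
    using a b by (intro series_eqI) simp
qed

text \<open>The kernel is Poisson because the expansion of \<open>D z j\<close> is a shift of that
  of \<open>j\<close>. Conversely, an element of a Poisson ideal inside \<open>point_ideal\<close>
  stays there under every word of derivations, so all its coefficients vanish.\<close>

lemma poisson_core_point:
  "poisson_core (sub_alg A Z) D point_ideal = {z \<in> Z. taylor ev z = 0}" (is "?P = ?K")
proof
  interpret P: poisson_algebra "sub_alg A Z" D by (rule D_poisson)
  have K: "ideal ?K (sub_alg A Z)" using jet.kernel_ideal by simp
  have "D z j \<in> ?K" if "z \<in> Z" "j \<in> ?K" for z j
  proof -
    have j: "j \<in> Z" "taylor ev j = 0" using that by simp_all
    have "taylor ev (D z j) = shift z (taylor ev j)" using that(1) by (simp add: shift_taylor der_def)
    also have "\<dots> = 0" unfolding j(2) by simp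
    finally show ?thesis using that(1) j(1) D_stable by simp
  qed
  then have "poisson_ideal (sub_alg A Z) D ?K" using K by (simp add: poisson_ideal_def)
  moreover have "?K \<subseteq> point_ideal"
  proof
    fix z assume "z \<in> ?K"
    then have "z \<in> Z" "coeff_at (taylor ev z) [] = 0" by simp_all
    then show "z \<in> point_ideal" by (simp add: point_ideal_def coeff_at_taylor)
  qed
  ultimately show "?K \<subseteq> ?P" by (rule P.poisson_core_greatest(3)[OF point_ideal_ideal])
  show "?P \<subseteq> ?K"
  proof
    fix z assume z: "z \<in> ?P"
    have sub: "?P \<subseteq> point_ideal" by (rule P.poisson_core_greatest(2)[OF point_ideal_ideal])
    have pois: "D x y \<in> ?P" if "x \<in> Z" "y \<in> ?P" for x y
      using P.poisson_core_greatest(1)[OF point_ideal_ideal] that by (simp add: poisson_ideal_def)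
    have "ideal ?P (sub_alg A Z)"
      using P.poisson_core_greatest(1)[OF point_ideal_ideal] by (simp add: poisson_ideal_def)
    then have "\<zero>\<^bsub>sub_alg A Z\<^esub> \<in> ?P"
      by (intro additive_subgroup.zero_closed ideal.axioms(1))
    then have zero: "\<zero> \<in> ?P" by simp
    have der_P: "der x y \<in> ?P" if "y \<in> ?P" for x y
      using that pois zero by (simp add: der_def)
    have act_P: "act w z \<in> ?P" if "z \<in> ?P" for w z
      using that by (induction w arbitrary: z) (simp_all add: der_P)
    have "taylor ev z = 0"
    proof (rule series_eqI)
      fix w
      have "act w z \<in> point_ideal" using act_P[OF z] sub by blast
      then show "coeff_at (taylor ev z) w = coeff_at 0 w" by (simp add: coeff_at_taylor point_ideal_def)
    qed
    moreover have "z \<in> Z" using z sub by (auto simp: point_ideal_def)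
    ultimately show "z \<in> ?K" by simp
  qed
qed

text \<open>For generators of \<open>A\<close> this is N + mA, with m the ideal of the point. The
  recursion lets \<open>nakayama\<close> remove one generator at a time.\<close>

primrec msum :: "'a set \<Rightarrow> 'a list \<Rightarrow> 'a set" where
  "msum N [] = N"
| "msum N (e # es) = {n \<oplus> x \<otimes> e |n x. n \<in> msum N es \<and> x \<in> point_ideal}"

lemma msumI: "n \<in> msum N es \<Longrightarrow> x \<in> point_ideal \<Longrightarrow> n \<oplus> x \<otimes> e \<in> msum N (e # es)"
  by auto

lemma point_ideal_Z: "x \<in> point_ideal \<Longrightarrow> x \<in> Z"
  and point_ideal_zero: "\<zero> \<in> point_ideal"
  and point_ideal_add: "x \<in> point_ideal \<Longrightarrow> y \<in> point_ideal \<Longrightarrow> x \<oplus> y \<in> point_ideal"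
  and point_ideal_mult: "z \<in> Z \<Longrightarrow> x \<in> point_ideal \<Longrightarrow> z \<otimes> x \<in> point_ideal"
  by (simp_all add: point_ideal_def Z_zero ev_zero Z_add ev_add Z_mult ev_mult)

lemma msum_submodule:
  assumes "z_submodule N" "set es \<subseteq> carrier A"
  shows "z_submodule (msum N es)"
  using assms(2)
proof (induction es)
  case Nil
  then show ?case using assms(1) by simp
next
  case (Cons e es)
  then have IH: "z_submodule (msum N es)" and e: "e \<in> carrier A" by simp_all
  note IHd = z_submoduleD[OF IH]
  show ?case
    unfolding z_submodule_def
  proof (intro conjI ballI)
    show "msum N (e # es) \<subseteq> carrier A"
      using IHd(1) e point_ideal_Z Z_carrier by auto
    show "\<zero> \<in> msum N (e # es)"
      using msumI[OF IHd(2) point_ideal_zero, of e] e by simp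
  next
    fix a b assume "a \<in> msum N (e # es)" "b \<in> msum N (e # es)"
    then obtain n x k y where ab: "a = n \<oplus> x \<otimes> e" "b = k \<oplus> y \<otimes> e" "n \<in> msum N es" "k \<in> msum N es"
      "x \<in> point_ideal" "y \<in> point_ideal" by auto
    have c: "n \<in> carrier A" "k \<in> carrier A" "x \<in> carrier A" "y \<in> carrier A"
      using ab IHd(1) point_ideal_Z Z_carrier by auto
    have "a \<oplus> b = (n \<oplus> k) \<oplus> (x \<oplus> y) \<otimes> e" unfolding ab(1,2) using c e by (simp add: l_distr a_ac)
    then show "a \<oplus> b \<in> msum N (e # es)"
      using msumI[OF IHd(3)[OF ab(3,4)] point_ideal_add[OF ab(5,6)], of e] by simp
  next
    fix z a assume z: "z \<in> Z" and "a \<in> msum N (e # es)"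
    then obtain n x where a: "a = n \<oplus> x \<otimes> e" "n \<in> msum N es" "x \<in> point_ideal" by auto
    have c: "n \<in> carrier A" "x \<in> carrier A" "z \<in> carrier A"
      using a z IHd(1) point_ideal_Z Z_carrier by auto
    have "z \<otimes> a = z \<otimes> n \<oplus> (z \<otimes> x) \<otimes> e" unfolding a(1) using c e by (simp add: r_distr m_assoc)
    then show "z \<otimes> a \<in> msum N (e # es)"
      using msumI[OF IHd(4)[OF z a(2)] point_ideal_mult[OF z a(3)], of e] by simp
  qed
qed

lemma msum_base:
  assumes "z_submodule N" "set es \<subseteq> carrier A"
  shows "N \<subseteq> msum N es"
  using assms(2)
proof (induction es)
  case (Cons e es)
  show ?case
  proof
    fix n assume n: "n \<in> N"
    then have "n \<oplus> \<zero> \<otimes> e \<in> msum N (e # es)" using Cons by (intro msumI point_ideal_zero) auto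
    then show "n \<in> msum N (e # es)" using z_submoduleD(1)[OF assms(1) n] Cons.prems by simp
  qed
qed simp

lemma msum_gen:
  assumes "z_submodule N" "set es \<subseteq> carrier A" "e \<in> set es" "x \<in> point_ideal"
  shows "x \<otimes> e \<in> msum N es"
  using assms(2,3)
proof (induction es)
  case (Cons e' es)
  have sub: "z_submodule (msum N es)" by (rule msum_submodule[OF assms(1)]) (use Cons.prems in simp)
  have x: "x \<in> carrier A" using assms(4) point_ideal_Z Z_carrier by auto
  show ?case
  proof (cases "e = e'")
    case True
    have "\<zero> \<oplus> x \<otimes> e \<in> msum N (e' # es)"
      unfolding True by (rule msumI[OF z_submoduleD(2)[OF sub] assms(4)])
    moreover have "\<zero> \<oplus> x \<otimes> e = x \<otimes> e" using x Cons.prems True by simp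
    ultimately show ?thesis by (simp only:)
  next
    case False
    then have xe: "x \<otimes> e \<in> msum N es" using Cons by simp
    then have "x \<otimes> e \<oplus> \<zero> \<otimes> e' \<in> msum N (e' # es)" by (rule msumI[OF _ point_ideal_zero])
    then show ?thesis using z_submoduleD(1)[OF sub xe] Cons.prems by simp
  qed
qed simp

text \<open>Nakayama's lemma without localisation: the elements \<open>\<one> \<ominus> x\<close>
  that would be inverted in the local ring are multiplied together into \<open>f\<close>.\<close>

lemma nakayama:
  assumes N: "z_submodule N" and "set es \<subseteq> carrier A" "\<And>e. e \<in> set es \<Longrightarrow> e \<in> msum N es"
  shows "\<exists>f\<in>Z. ev f = 1 \<and> (\<forall>e\<in>set es. f \<otimes> e \<in> N)"
  using assms(2,3)
proof (induction es)
  case Nil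
  then show ?case using Z_one ev_one by auto
next
  case (Cons e es)
  have es: "set es \<subseteq> carrier A" and e: "e \<in> carrier A" using Cons.prems(1) by simp_all
  have M: "z_submodule (msum N es)" by (rule msum_submodule[OF N es])
  note Md = z_submoduleD[OF M]
  have "e \<in> msum N (e # es)" by (rule Cons.prems(2)) simp
  then obtain n x where e_eq: "e = n \<oplus> x \<otimes> e" and n: "n \<in> msum N es" and x: "x \<in> point_ideal" by auto
  \<comment> \<open>Moving \<open>x \<otimes> e\<close> to the left-hand side expresses
    \<open>u \<otimes> e\<close> by \<open>N\<close> and the remaining generators.\<close>
  define u where "u = \<one> \<ominus> x"
  have u: "u \<in> Z" "ev u = 1"
    using x point_ideal_Z[OF x] Z_one by (simp_all add: u_def Z_diff ev_diff ev_one point_ideal_def)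
  have c: "n \<in> carrier A" "x \<in> carrier A" "u \<in> carrier A"
    using Md(1)[OF n] Z_carrier[OF point_ideal_Z[OF x]] Z_carrier[OF u(1)] .
  have ue: "u \<otimes> e = n"
  proof -
    have "u \<otimes> e = e \<ominus> x \<otimes> e" using c e by (simp add: u_def a_minus_def l_distr l_minus)
    also have "\<dots> = (n \<oplus> x \<otimes> e) \<ominus> x \<otimes> e" using e_eq by simp
    also have "\<dots> = n" using c e by (simp add: a_minus_def a_assoc r_neg)
    finally show ?thesis .
  qed
  \<comment> \<open>The shorter list satisfies the hypothesis: \<open>e'\<close> is
    \<open>u \<otimes> e' \<oplus> x \<otimes> e'\<close>, where \<open>u \<otimes> e\<close> can be
    replaced by \<open>n\<close> in the first summand and the second is an admissible term.\<close>
  have mem: "e' \<in> msum N es" if e': "e' \<in> set es" for e'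
  proof -
    have e'c: "e' \<in> carrier A" using e' es by blast
    have "e' \<in> msum N (e # es)" by (rule Cons.prems(2)) (use e' in simp)
    then obtain n' x' where e'_eq: "e' = n' \<oplus> x' \<otimes> e" and n': "n' \<in> msum N es" and x': "x' \<in> point_ideal"
      by auto
    have c': "n' \<in> carrier A" "x' \<in> carrier A"
      using Md(1)[OF n'] Z_carrier[OF point_ideal_Z[OF x']] .
    have "u \<otimes> e' = u \<otimes> n' \<oplus> u \<otimes> (x' \<otimes> e)" using e'_eq c c' e by (metis m_closed r_distr)
    also have "u \<otimes> (x' \<otimes> e) = x' \<otimes> n"
      using c c' e Z_central[OF u(1) c'(2)] by (simp add: ue[symmetric] m_assoc[symmetric])
    finally have "u \<otimes> e' \<in> msum N es"
      using Md(3)[OF Md(4)[OF u(1) n'] Md(4)[OF point_ideal_Z[OF x'] n]] by simp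
    then have "u \<otimes> e' \<oplus> x \<otimes> e' \<in> msum N es" by (rule Md(3)[OF _ msum_gen[OF N es e' x]])
    also have "u \<otimes> e' \<oplus> x \<otimes> e' = e'"
      using c e'c by (simp add: u_def a_minus_def l_distr l_minus a_assoc l_neg)
    finally show ?thesis .
  qed
  from Cons.IH[OF es mem] obtain f where f: "f \<in> Z" "ev f = 1" "\<forall>e\<in>set es. f \<otimes> e \<in> N" by blast
  have fc: "f \<in> carrier A" using f(1) by (rule Z_carrier)
  have f_msum: "f \<otimes> a \<in> N" if "a \<in> msum N gs" "set gs \<subseteq> set es" for a gs
    using that
  proof (induction gs arbitrary: a)
    case Nil
    then show ?case using z_submoduleD(4)[OF N f(1)] by simp
  next
    case (Cons g gs)
    then obtain k y where a: "a = k \<oplus> y \<otimes> g" and k: "k \<in> msum N gs" and y: "y \<in> point_ideal" by auto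
    have g: "g \<in> carrier A" "f \<otimes> g \<in> N" using Cons.prems(2) es f(3) by auto
    have kN: "f \<otimes> k \<in> N" using Cons k by simp
    have "z_submodule (msum N gs)" by (rule msum_submodule[OF N]) (use Cons.prems es in auto)
    then have kc: "k \<in> carrier A" using k by (rule z_submoduleD(1))
    have yc: "y \<in> carrier A" using y point_ideal_Z Z_carrier by blast
    have "f \<otimes> a = f \<otimes> k \<oplus> y \<otimes> (f \<otimes> g)"
      unfolding a using kc yc g fc Z_central[OF f(1) yc] by (simp add: r_distr m_assoc[symmetric])
    then show ?case
      using z_submoduleD(3)[OF N kN z_submoduleD(4)[OF N point_ideal_Z[OF y] g(2)]] by simp
  qed
  show ?case
  proof (intro bexI[of _ "f \<otimes> u"] conjI ballI)
    show "f \<otimes> u \<in> Z" by (rule Z_mult[OF f(1) u(1)])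
    show "ev (f \<otimes> u) = 1" using f u by (simp add: ev_mult)
    fix g assume g: "g \<in> set (e # es)"
    show "f \<otimes> u \<otimes> g \<in> N"
    proof (cases "g = e")
      case True
      have "f \<otimes> u \<otimes> g = f \<otimes> n" unfolding True using fc c e ue by (simp add: m_assoc)
      then show ?thesis using f_msum[OF n] by simp
    next
      case False
      then have g': "g \<in> set es" using g by simp
      then have gc: "g \<in> carrier A" using es by blast
      have "f \<otimes> u \<otimes> g = u \<otimes> (f \<otimes> g)"
        using fc c gc Z_central[OF u(1) fc] by (simp add: m_assoc[symmetric])
      then show ?thesis using z_submoduleD(4)[OF N u(1)] f(3) g' by simp
    qed
  qed
qed

end


section \<open>Fibres are generically constant\<close>

lemma (in poisson_order) z_submodule_c_subspace:
  assumes "z_submodule N" shows "c_subspace N"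
proof -
  have "c \<odot> x \<in> N" if "x \<in> N" for c x
    using z_submoduleD(4)[OF assms Z_smult[OF Z_one] that, of c]
      c_smult_eq_mult[OF z_submoduleD(1)[OF assms that], of c] by simp
  moreover have "N \<subseteq> carrier A" using z_submoduleD(1)[OF assms] by blast
  ultimately show ?thesis
    using z_submoduleD(2,3)[OF assms] by (simp add: c_subspace_def)
qed

context order_point
begin

text \<open>Modulo \<open>fibre_kernel\<close> the ring \<open>Z\<close> acts by scalars, so a
  subspace containing \<open>fibre_kernel\<close> is a \<open>Z\<close>-submodule, and the finitely
  many module generators span the fibre linearly.\<close>

lemma exists_fibre_frame: "\<exists>d e \<kappa>. dual_system fibre_kernel d e \<kappa>"
proof -
  obtain es where es: "set es \<subseteq> carrier A" "\<And>N. z_submodule N \<Longrightarrow> set es \<subseteq> N \<Longrightarrow> N = carrier A"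
    using finite_generators by blast
  show ?thesis
  proof (rule exists_dual_system[OF ideal_c_subspace[OF fibre_kernel_ideal] es(1)])
    fix W assume W: "c_subspace W" "fibre_kernel \<subseteq> W" "set es \<subseteq> W"
    have Wc: "W \<subseteq> carrier A" and W_add: "\<And>x y. x \<in> W \<Longrightarrow> y \<in> W \<Longrightarrow> x \<oplus> y \<in> W"
      and W_smult: "\<And>c x. x \<in> W \<Longrightarrow> c \<odot> x \<in> W" and W0: "\<zero> \<in> W"
      using W(1) by (auto simp: c_subspace_def)
    have "z \<otimes> x \<in> W" if z: "z \<in> Z" and x: "x \<in> W" for z x
    proof -
      have xc: "x \<in> carrier A" "z \<in> carrier A" using x Wc Z_carrier[OF z] by auto
      have "(z \<otimes> x \<ominus> ev z \<odot> x) \<oplus> ev z \<odot> x \<in> W"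
        using fibre_kernel_Z_mult[OF z xc(1)] W(2) W_add W_smult[OF x] by blast
      then show ?thesis using xc by (simp add: a_minus_def a_assoc l_neg)
    qed
    then have "z_submodule W" using Wc W0 W_add by (simp add: z_submodule_def)
    then show "W = carrier A" using W(3) by (rule es(2))
  qed
qed

end

locale framed_point = order_point +
  fixes d :: nat and e :: "nat \<Rightarrow> 'a" and \<kappa> :: "nat \<Rightarrow> 'a \<Rightarrow> complex"
  assumes frame: "dual_system fibre_kernel d e \<kappa>"
begin

lemma e_range: "range e \<subseteq> carrier A"
  and kappa_linear: "k < d \<Longrightarrow> linear_form (\<kappa> k)"
  and kappa_kernel: "k < d \<Longrightarrow> a \<in> fibre_kernel \<Longrightarrow> \<kappa> k a = 0"
  and kappa_e: "k < d \<Longrightarrow> j < d \<Longrightarrow> \<kappa> k (e j) = (if k = j then 1 else 0)"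
  using frame by (simp_all add: dual_system_def)

lemma e_carrier: "e i \<in> carrier A"
  using e_range by auto

lemma kernel_iff: "a \<in> carrier A \<Longrightarrow> (\<forall>k<d. \<kappa> k a = 0) \<longleftrightarrow> a \<in> fibre_kernel"
  using frame[unfolded dual_system_def, THEN conjunct2, THEN conjunct2] kappa_kernel by blast

lemma kappa_Z_mult:
  assumes "k < d" "z \<in> Z" "a \<in> carrier A"
  shows "\<kappa> k (z \<otimes> a) = ev z * \<kappa> k a"
proof -
  have "\<kappa> k (z \<otimes> a \<ominus> ev z \<odot> a) = 0"
    by (rule kappa_kernel[OF assms(1) fibre_kernel_Z_mult[OF assms(2,3)]])
  then show ?thesis
    using assms Z_carrier[OF assms(2)]
    by (simp add: linear_form_diff[OF kappa_linear] linear_form_smult[OF kappa_linear])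
qed

definition structure_const :: "nat \<Rightarrow> nat \<Rightarrow> nat \<Rightarrow> complex"
  where "structure_const i j k = \<kappa> k (e i \<otimes> e j)"

text \<open>Each factor may be replaced by its expansion in the frame, because the error lies in the
  two-sided ideal \<open>fibre_kernel\<close>.\<close>

lemma kappa_mult:
  assumes a: "a \<in> carrier A" and b: "b \<in> carrier A" and k: "k < d"
  shows "\<kappa> k (a \<otimes> b) = (\<Sum>i<d. \<Sum>j<d. \<kappa> i a * \<kappa> j b * structure_const i j k)"
proof -
  interpret I: ideal fibre_kernel A by (rule fibre_kernel_ideal)
  have left: "\<kappa> k (a \<otimes> b) = (\<Sum>i<d. \<kappa> i a * \<kappa> k (e i \<otimes> b))" if a: "a \<in> carrier A" and b: "b \<in> carrier A" for a b
  proof -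
    let ?l = "lincomb e d (\<lambda>i. \<kappa> i a)"
    have l: "?l \<in> carrier A" by (rule lincomb_closed[OF e_range])
    have "(a \<ominus> ?l) \<otimes> b \<in> fibre_kernel" by (rule I.I_r_closed[OF dual_system_expand[OF frame a] b])
    then have "\<kappa> k (a \<otimes> b \<ominus> ?l \<otimes> b) = 0"
      using kappa_kernel[OF k] a b l by (simp add: a_minus_def l_distr l_minus)
    then have "\<kappa> k (a \<otimes> b) = \<kappa> k (?l \<otimes> b)"
      using a b l by (simp add: linear_form_diff[OF kappa_linear[OF k]])
    moreover have "linear_form (\<lambda>x. \<kappa> k (x \<otimes> b))"
      unfolding linear_form_def
      using b linear_form_add[OF kappa_linear[OF k]] linear_form_smult[OF kappa_linear[OF k]]
      by (simp add: l_distr smult_mult_left)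
    ultimately show ?thesis using linear_form_lincomb[OF _ e_range, of "\<lambda>x. \<kappa> k (x \<otimes> b)"] by simp
  qed
  have right: "\<kappa> k (a \<otimes> b) = (\<Sum>j<d. \<kappa> j b * \<kappa> k (a \<otimes> e j))" if a: "a \<in> carrier A" and b: "b \<in> carrier A" for a b
  proof -
    let ?l = "lincomb e d (\<lambda>i. \<kappa> i b)"
    have l: "?l \<in> carrier A" by (rule lincomb_closed[OF e_range])
    have "a \<otimes> (b \<ominus> ?l) \<in> fibre_kernel" by (rule I.I_l_closed[OF dual_system_expand[OF frame b] a])
    then have "\<kappa> k (a \<otimes> b \<ominus> a \<otimes> ?l) = 0"
      using kappa_kernel[OF k] a b l by (simp add: a_minus_def r_distr r_minus)
    then have "\<kappa> k (a \<otimes> b) = \<kappa> k (a \<otimes> ?l)"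
      using a b l by (simp add: linear_form_diff[OF kappa_linear[OF k]])
    moreover have "linear_form (\<lambda>x. \<kappa> k (a \<otimes> x))"
      unfolding linear_form_def
      using a linear_form_add[OF kappa_linear[OF k]] linear_form_smult[OF kappa_linear[OF k]]
      by (simp add: r_distr smult_mult_right)
    ultimately show ?thesis using linear_form_lincomb[OF _ e_range, of "\<lambda>x. \<kappa> k (a \<otimes> x)"] by simp
  qed
  show ?thesis
    unfolding left[OF a b] right[OF e_carrier b] structure_const_def
    by (simp add: sum_distrib_left mult.assoc)
qed

text \<open>The trivialisation along the flow: each \<open>der x\<close> is a derivation of
  \<open>A\<close>, so differentiating the product law in coordinates reproduces it with the
  structure constants of the fibre unchanged.\<close>

lemma taylor_mult:
  assumes "a \<in> carrier A" "b \<in> carrier A" "k < d"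
  shows "taylor (\<kappa> k) (a \<otimes> b) =
    (\<Sum>i<d. \<Sum>j<d. const_series (structure_const i j k) * (taylor (\<kappa> i) a * taylor (\<kappa> j) b))"
    (is "_ = ?R a b")
proof (rule series_eqI)
  fix w
  show "coeff_at (taylor (\<kappa> k) (a \<otimes> b)) w = coeff_at (?R a b) w"
    using assms(1,2)
  proof (induction w arbitrary: a b)
    case Nil
    then show ?case using kappa_mult[OF Nil assms(3)]
      by (simp add: coeff_at_taylor mult.commute)
  next
    case (Cons x w)
    have c: "der x a \<in> carrier A" "der x b \<in> carrier A" using Cons.prems by (simp_all add: der_closed)
    have "coeff_at (taylor (\<kappa> k) (a \<otimes> b)) (x # w) = coeff_at (taylor (\<kappa> k) (der x a \<otimes> b \<oplus> a \<otimes> der x b)) w"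
      using Cons.prems by (simp add: coeff_at_taylor der_mult)
    also have "\<dots> = coeff_at (taylor (\<kappa> k) (der x a \<otimes> b)) w + coeff_at (taylor (\<kappa> k) (a \<otimes> der x b)) w"
      using Cons.prems c by (simp add: taylor_add[OF kappa_linear[OF assms(3)]])
    also have "\<dots> = coeff_at (?R (der x a) b) w + coeff_at (?R a (der x b)) w"
      using Cons.IH[OF c(1) Cons.prems(2)] Cons.IH[OF Cons.prems(1) c(2)] by (simp only:)
    also have "\<dots> = coeff_at (?R a b) (x # w)"
      by (simp add: shift_taylor sum.distrib[symmetric] distrib_left)
    finally show ?case .
  qed
qed

text \<open>With \<open>taylor_mult\<close> this makes the coordinate series a homomorphism from
  \<open>A\<close> into the fibre with series coefficients, semilinear along
  \<open>taylor ev\<close>.\<close>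

lemma taylor_Z_mult:
  assumes "z \<in> Z" "a \<in> carrier A" "k < d"
  shows "taylor (\<kappa> k) (z \<otimes> a) = taylor ev z * taylor (\<kappa> k) a"
proof (rule series_eqI)
  fix w
  show "coeff_at (taylor (\<kappa> k) (z \<otimes> a)) w = coeff_at (taylor ev z * taylor (\<kappa> k) a) w"
    using assms(1,2)
  proof (induction w arbitrary: z a)
    case Nil
    then show ?case using assms(3) by (simp add: coeff_at_taylor kappa_Z_mult)
  next
    case (Cons x w)
    have z: "z \<in> carrier A" by (rule Z_carrier[OF Cons.prems(1)])
    have c: "der x z \<in> Z" "der x z \<in> carrier A" "der x a \<in> carrier A"
      using Cons.prems der_Z[OF Cons.prems(1)] Z_carrier[OF der_Z[OF Cons.prems(1)]]
      by (simp_all add: der_closed)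
    have "coeff_at (taylor (\<kappa> k) (z \<otimes> a)) (x # w) = coeff_at (taylor (\<kappa> k) (der x z \<otimes> a \<oplus> z \<otimes> der x a)) w"
      using Cons.prems z by (simp add: coeff_at_taylor der_mult)
    also have "\<dots> = coeff_at (taylor (\<kappa> k) (der x z \<otimes> a)) w + coeff_at (taylor (\<kappa> k) (z \<otimes> der x a)) w"
      using Cons.prems c z by (simp add: taylor_add[OF kappa_linear[OF assms(3)]])
    also have "\<dots> = coeff_at (taylor ev (der x z) * taylor (\<kappa> k) a) w + coeff_at (taylor ev z * taylor (\<kappa> k) (der x a)) w"
      using Cons.IH[OF c(1) Cons.prems(2)] Cons.IH[OF Cons.prems(1) c(3)] by (simp only:)
    finally show ?case by (simp add: shift_taylor)
  qed
qed

definition frame_span :: "'a set"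
  where "frame_span = \<Inter> {N. z_submodule N \<and> e ` {..<d} \<subseteq> N}"

lemma frame_span_minimal: "z_submodule N \<Longrightarrow> (\<And>i. i < d \<Longrightarrow> e i \<in> N) \<Longrightarrow> frame_span \<subseteq> N"
  unfolding frame_span_def by blast

lemma frame_span_e: "i < d \<Longrightarrow> e i \<in> frame_span"
  by (auto simp: frame_span_def)

lemma z_submodule_carrier: "z_submodule (carrier A)"
  using Z_carrier by (simp add: z_submodule_def)

lemma z_submodule_frame_span: "z_submodule frame_span"
  unfolding z_submodule_def
proof (intro conjI)
  show "frame_span \<subseteq> carrier A" by (rule frame_span_minimal[OF z_submodule_carrier e_carrier])
qed (auto simp: frame_span_def dest: z_submoduleD)

text \<open>The frame spans \<open>A\<close> modulo the point ideal, so Nakayama applies to its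
  \<open>Z\<close>-span. Wherever \<open>f\<close> is nonzero the frame still spans the
  fibre.\<close>

lemma generic_frame: "\<exists>f\<in>Z. ev f = 1 \<and> (\<forall>a\<in>carrier A. f \<otimes> a \<in> frame_span)"
proof -
  obtain es where es: "set es \<subseteq> carrier A" "\<And>N. z_submodule N \<Longrightarrow> set es \<subseteq> N \<Longrightarrow> N = carrier A"
    using finite_generators by blast
  note N = z_submodule_frame_span
  have M: "z_submodule (msum frame_span es)" by (rule msum_submodule[OF N es(1)])
  \<comment> \<open>The elements with this property form a submodule, so it suffices to look at the
    generators.\<close>
  have "{a \<in> carrier A. \<forall>x\<in>point_ideal. x \<otimes> a \<in> msum frame_span es} = carrier A" (is "?W = _")
  proof (rule es(2))
    show "set es \<subseteq> ?W" using msum_gen[OF N es(1)] es(1) by blast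
    show "z_submodule ?W"
      unfolding z_submodule_def
    proof (intro conjI ballI)
      show "\<zero> \<in> ?W" using z_submoduleD(2)[OF M] Z_carrier[OF point_ideal_Z] by simp
    next
      fix a b assume "a \<in> ?W" "b \<in> ?W"
      then show "a \<oplus> b \<in> ?W"
        using z_submoduleD(3)[OF M] Z_carrier[OF point_ideal_Z] by (simp add: r_distr)
    next
      fix z a assume z: "z \<in> Z" and a: "a \<in> ?W"
      have "x \<otimes> (z \<otimes> a) \<in> msum frame_span es" if x: "x \<in> point_ideal" for x
      proof -
        have c: "x \<in> carrier A" "z \<in> carrier A" "a \<in> carrier A"
          using Z_carrier[OF point_ideal_Z[OF x]] Z_carrier[OF z] a by simp_all
        have "x \<otimes> (z \<otimes> a) = z \<otimes> (x \<otimes> a)"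
          using c Z_central[OF z c(1)] by (simp add: m_assoc[symmetric])
        then show ?thesis using z_submoduleD(4)[OF M z] a x by simp
      qed
      then show "z \<otimes> a \<in> ?W" using a Z_carrier[OF z] by simp
    qed blast
  qed
  then have prod: "x \<otimes> a \<in> msum frame_span es" if "x \<in> point_ideal" "a \<in> carrier A" for x a
    using that by blast
  have kernel: "a \<in> msum frame_span es" if "a \<in> fibre_kernel" for a
    using that unfolding fibre_kernel_def
    by (induction rule: ideal_prod.induct) (use prod z_submoduleD(3)[OF M] in blast)+
  have mem: "a \<in> msum frame_span es" if a: "a \<in> carrier A" for a
  proof -
    let ?l = "lincomb e d (\<lambda>i. \<kappa> i a)"
    have l: "?l \<in> carrier A" by (rule lincomb_closed[OF e_range])
    have "?l \<in> frame_span"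
      by (rule c_subspace_lincomb[OF z_submodule_c_subspace[OF N] e_range frame_span_e])
    then have "(a \<ominus> ?l) \<oplus> ?l \<in> msum frame_span es"
      using kernel[OF dual_system_expand[OF frame a]] msum_base[OF N es(1)] z_submoduleD(3)[OF M] by blast
    then show ?thesis using a l by (simp add: a_minus_def a_assoc l_neg)
  qed
  obtain f where f: "f \<in> Z" "ev f = 1" "\<forall>a\<in>set es. f \<otimes> a \<in> frame_span"
    using nakayama[OF N es(1)] mem es(1) by blast
  have fc: "f \<in> carrier A" by (rule Z_carrier[OF f(1)])
  have "{a \<in> carrier A. f \<otimes> a \<in> frame_span} = carrier A" (is "?V = _")
  proof (rule es(2))
    show "set es \<subseteq> ?V" using f(3) es(1) by blast
    show "z_submodule ?V"
      unfolding z_submodule_def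
    proof (intro conjI ballI)
      show "\<zero> \<in> ?V" using z_submoduleD(2)[OF N] fc by simp
    next
      fix a b assume "a \<in> ?V" "b \<in> ?V"
      then show "a \<oplus> b \<in> ?V" using z_submoduleD(3)[OF N] fc by (simp add: r_distr)
    next
      fix z a assume z: "z \<in> Z" and a: "a \<in> ?V"
      have "f \<otimes> (z \<otimes> a) = z \<otimes> (f \<otimes> a)"
        using fc a Z_carrier[OF z] Z_central[OF z fc] by (simp add: m_assoc[symmetric])
      then show "z \<otimes> a \<in> ?V" using z_submoduleD(4)[OF N z] a Z_carrier[OF z] by simp
    qed blast
  qed
  then show ?thesis using f(1,2) by blast
qed

text \<open>If the fibre vanished, the frame would be empty and \<open>generic_frame\<close> would
  give \<open>f = \<zero>\<close>, against \<open>ev f = 1\<close>.\<close>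

lemma one_notin_fibre_kernel: "\<one> \<notin> fibre_kernel"
proof
  assume one: "\<one> \<in> fibre_kernel"
  interpret I: ideal fibre_kernel A by (rule fibre_kernel_ideal)
  have all: "a \<in> fibre_kernel" if "a \<in> carrier A" for a using I.I_l_closed[OF one that] that by simp
  have "d = 0"
  proof (rule ccontr)
    assume "d \<noteq> 0"
    then show False using kappa_e[of 0 0] kappa_kernel[of 0, OF _ all[OF e_carrier]] by simp
  qed
  moreover have "z_submodule {\<zero>}" using Z_carrier by (simp add: z_submodule_def)
  ultimately have zero: "frame_span \<subseteq> {\<zero>}" by (intro frame_span_minimal) auto
  obtain f where f: "f \<in> Z" "ev f = 1" "\<forall>a\<in>carrier A. f \<otimes> a \<in> frame_span" using generic_frame by blast
  then have "f \<otimes> \<one> \<in> {\<zero>}" using zero one_closed by blast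
  then have "f = \<zero>" using Z_carrier[OF f(1)] by simp
  then show False using f(2) ev_zero by simp
qed

text \<open>A lift \<open>\<chi>\<close> of \<open>p\<close> turns the coordinate series into linear
  forms \<open>\<psi> k\<close> with the structure constants of the given fibre. They are
  coordinates of the fibre at \<open>p\<close>: \<open>\<chi> s \<noteq> 0\<close> makes them
  jointly surjective, and \<open>p f \<noteq> 0\<close> keeps their common kernel from being too
  large. Both directions of the isomorphism are recorded so that transitivity can join two points
  through \<open>p\<close>.\<close>

theorem fibre_generically_constant:
  "\<exists>G. countable G \<and> G \<subseteq> Z \<and> (\<forall>g\<in>G. taylor ev g \<noteq> 0) \<and>
    (\<forall>p. character (sub_alg A Z) p \<longrightarrow> (\<forall>a\<in>Z. taylor ev a = 0 \<longrightarrow> p a = 0) \<longrightarrow> (\<forall>g\<in>G. p g \<noteq> 0) \<longrightarrow>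
      c_alg_isomorphic (fibre_alg A {z \<in> Z. p z = 0}) (fibre_alg A point_ideal) \<and>
      c_alg_isomorphic (fibre_alg A point_ideal) (fibre_alg A {z \<in> Z. p z = 0}))"
proof -
  obtain B0 where B0: "countable B0" "B0 \<subseteq> carrier A" "carrier A = c_span A B0"
    using countable_spanning by blast
  have "\<exists>B s. coeff_at s [] = 1 \<and>
    (\<forall>k<d. \<forall>j<d. (\<Sum>i<d. B k i * taylor (\<kappa> j) (e i)) = (if k = j then s else 0))"
    by (rule adjugate_series) (simp add: coeff_at_taylor kappa_e)
  then obtain B s where s: "coeff_at s [] = 1"
    and B: "\<And>k j. k < d \<Longrightarrow> j < d \<Longrightarrow> (\<Sum>i<d. B k i * taylor (\<kappa> j) (e i)) = (if k = j then s else 0)"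
    by blast
  \<comment> \<open>\<open>T\<close> has to contain everything that \<open>\<chi>\<close> is applied
    to: the coordinate series of a spanning set of \<open>A\<close>, the adjugate and the
    determinant. The series of \<open>Z\<close> then lie in it by \<open>jet_T\<close>.\<close>
  define Gen where "Gen = (\<lambda>(k, b). taylor (\<kappa> k) b) ` ({..<d} \<times> B0) \<union>
    (\<lambda>(k, i). B k i) ` ({..<d} \<times> {..<d}) \<union> {s}"
  have "countable Gen" unfolding Gen_def using B0(1) by (intro countable_Un countable_image countable_SIGMA) auto
  then obtain B1 where B1: "countable B1" "Gen \<subseteq> c_span series_alg B1"
    "c_subalgebra (c_span series_alg B1) series_alg"
    using series_alg.countable_generated_subalgebra[of Gen] by auto
  define T where "T = c_span series_alg B1"
  interpret T: comm_c_algebra "sub_alg series_alg T"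
    unfolding T_def by (rule series_alg.comm_c_algebra_sub_alg[OF B1(3)]) (simp add: mult.commute)
  have T_mult: "x * y \<in> T" if "x \<in> T" "y \<in> T" for x y using T.m_closed[of x y] that by simp
  have T_add: "x + y \<in> T" if "x \<in> T" "y \<in> T" for x y using T.a_closed[of x y] that by simp
  have T_zero: "0 \<in> T" using T.zero_closed by simp
  have T_const: "const_series c * x \<in> T" if "x \<in> T" for c x using T.c_smult_closed[of x c] that by simp
  have s_T: "s \<in> T" and B_T: "\<And>k i. k < d \<Longrightarrow> i < d \<Longrightarrow> B k i \<in> T"
    using B1(2) by (auto simp: Gen_def T_def)
  have taylor_B0: "taylor (\<kappa> k) b \<in> T" if "k < d" "b \<in> B0" for k b
    using B1(2) that by (auto simp: Gen_def T_def)
  have taylor_T: "taylor (\<kappa> k) a \<in> T" if k: "k < d" and a: "a \<in> carrier A" for k a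
    using a unfolding B0(3)
  proof induction
    case zero
    have "taylor (\<kappa> k) \<zero> = 0"
      using taylor_smult[OF kappa_linear[OF k] zero_closed, of 0] by simp
    then show ?case using T_zero by simp
  next
    case (base b)
    then show ?case using taylor_B0[OF k] by simp
  next
    case (add x y)
    then show ?case using B0(3) T_add by (simp add: taylor_add[OF kappa_linear[OF k]])
  next
    case (smult x c)
    then show ?case using B0(3) T_const by (simp add: taylor_smult[OF kappa_linear[OF k]])
  qed
  obtain k0 where k0: "k0 < d" "\<kappa> k0 \<one> \<noteq> 0"
    using one_notin_fibre_kernel kernel_iff[OF one_closed] by blast
  have taylor_kappa_one: "taylor (\<kappa> k) \<one> = const_series (\<kappa> k \<one>)" if "k < d" for k
    by (rule taylor_one) (rule linear_form_zero[OF kappa_linear[OF that]])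
  \<comment> \<open>Since the unit of the fibre is nonzero, the series of \<open>z\<close> is read off from a coordinate of
    \<open>z \<otimes> \<one>\<close>.\<close>
  have jet_T: "taylor ev z \<in> T" if z: "z \<in> Z" for z
  proof -
    have "taylor (\<kappa> k0) (z \<otimes> \<one>) = taylor ev z * const_series (\<kappa> k0 \<one>)"
      using taylor_Z_mult[OF z one_closed k0(1)] taylor_kappa_one[OF k0(1)] by simp
    then have "const_series (inverse (\<kappa> k0 \<one>)) * taylor (\<kappa> k0) (z \<otimes> \<one>) =
        (const_series (inverse (\<kappa> k0 \<one>)) * const_series (\<kappa> k0 \<one>)) * taylor ev z"
      by (simp add: mult_ac)
    also have "\<dots> = taylor ev z" using k0(2) by (simp add: const_series_mult[symmetric])
    finally have "taylor ev z = const_series (inverse (\<kappa> k0 \<one>)) * taylor (\<kappa> k0) (z \<otimes> \<one>)" ..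
    then show ?thesis using T_const[OF taylor_T[OF k0(1), of "z \<otimes> \<one>"]] Z_carrier[OF z] by simp
  qed
  have "s \<noteq> 0" using s by auto
  have jets_T: "taylor ev ` carrier (sub_alg A Z) \<subseteq> T" using jet_T by auto
  from jet.generic_extension[OF B1(1) T_def B1(3)[folded T_def] jets_T s_T \<open>s \<noteq> 0\<close>]
  obtain G where G: "countable G" "G \<subseteq> Z" "\<forall>g\<in>G. taylor ev g \<noteq> 0"
    and ext: "\<forall>p. character (sub_alg A Z) p \<longrightarrow> (\<forall>a\<in>Z. taylor ev a = 0 \<longrightarrow> p a = 0) \<longrightarrow> (\<forall>g\<in>G. p g \<noteq> 0) \<longrightarrow>
      (\<exists>\<chi>. character (sub_alg series_alg T) \<chi> \<and> \<chi> s \<noteq> 0 \<and> (\<forall>a\<in>Z. \<chi> (taylor ev a) = p a))"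
    by auto
  obtain f where f: "f \<in> Z" "ev f = 1" "\<forall>a\<in>carrier A. f \<otimes> a \<in> frame_span" using generic_frame by blast
  have "coeff_at (taylor ev f) [] = 1" using f(2) by (simp add: coeff_at_taylor)
  then have f_jet: "taylor ev f \<noteq> 0" by auto
  show ?thesis
  \<comment> \<open>Joining \<open>f\<close> to \<open>G\<close> excludes the points at which the
    frame might fail to span the fibre.\<close>
  proof (rule exI[of _ "insert f G"], intro conjI allI impI)
    show "countable (insert f G)" using G(1) by simp
    show "insert f G \<subseteq> Z" using G(2) f(1) by simp
    show "\<forall>g\<in>insert f G. taylor ev g \<noteq> 0" using G(3) f_jet by simp
    fix p assume p: "character (sub_alg A Z) p" "\<forall>a\<in>Z. taylor ev a = 0 \<longrightarrow> p a = 0"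
      "\<forall>g\<in>insert f G. p g \<noteq> 0"
    interpret P: order_point A Z D p by unfold_locales (rule p(1))
    have pf: "p f \<noteq> 0" "\<forall>g\<in>G. p g \<noteq> 0" using p(3) by simp_all
    from ext[rule_format, OF p(1), OF p(2)[rule_format] pf(2)[rule_format]]
    obtain \<chi> where \<chi>: "character (sub_alg series_alg T) \<chi>" "\<chi> s \<noteq> 0" "\<forall>a\<in>Z. \<chi> (taylor ev a) = p a"
      by blast
    have chi_add: "\<chi> (x + y) = \<chi> x + \<chi> y" and chi_mult: "\<chi> (x * y) = \<chi> x * \<chi> y" if "x \<in> T" "y \<in> T" for x y
      using T.character_add[OF \<chi>(1), of x y] T.character_mult[OF \<chi>(1), of x y] that by simp_all
    have chi_const: "\<chi> (const_series c * x) = c * \<chi> x" if "x \<in> T" for c x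
      using T.character_smult[OF \<chi>(1), of x c] that by simp
    have chi_one: "\<chi> 1 = 1" using T.character_one[OF \<chi>(1)] by simp
    have chi_zero: "\<chi> 0 = 0" using T.character_zero[OF \<chi>(1)] by simp
    have T_sum: "(\<Sum>i<n. g i) \<in> T" if "\<And>i. i < n \<Longrightarrow> g i \<in> T" for g and n :: nat
      using that by (induction n) (simp_all add: T_zero T_add)
    have chi_sum: "\<chi> (\<Sum>i<n. g i) = (\<Sum>i<n. \<chi> (g i))" if "\<And>i. i < n \<Longrightarrow> g i \<in> T" for g and n :: nat
      using that by (induction n) (simp_all add: chi_zero chi_add T_sum)
    define \<psi> where "\<psi> k a = \<chi> (taylor (\<kappa> k) a)" for k a
    have psi_linear: "linear_form (\<psi> k)" if k: "k < d" for k
      unfolding linear_form_def \<psi>_def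
      by (simp add: taylor_add[OF kappa_linear[OF k]] taylor_smult[OF kappa_linear[OF k]]
          chi_add chi_const taylor_T[OF k])
    have psi_mult: "\<psi> k (a \<otimes> b) = (\<Sum>i<d. \<Sum>j<d. \<psi> i a * \<psi> j b * structure_const i j k)"
      if a: "a \<in> carrier A" and b: "b \<in> carrier A" and k: "k < d" for a b k
    proof -
      have t: "const_series (structure_const i j k) * (taylor (\<kappa> i) a * taylor (\<kappa> j) b) \<in> T"
        if "i < d" "j < d" for i j
        using that a b by (intro T_const T_mult taylor_T)
      have "\<psi> k (a \<otimes> b) = (\<Sum>i<d. \<Sum>j<d. \<chi> (const_series (structure_const i j k) * (taylor (\<kappa> i) a * taylor (\<kappa> j) b)))"
        unfolding \<psi>_def taylor_mult[OF a b k] by (simp add: chi_sum T_sum t)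
      also have "\<dots> = (\<Sum>i<d. \<Sum>j<d. \<psi> i a * \<psi> j b * structure_const i j k)"
        by (intro sum.cong refl)
           (use a b in \<open>simp add: chi_const chi_mult T_mult taylor_T \<psi>_def mult.commute\<close>)
      finally show ?thesis .
    qed
    have psi_one: "\<kappa> k \<one> = \<psi> k \<one>" if k: "k < d" for k
      using chi_const[of 1 "\<kappa> k \<one>"] chi_one T.one_closed
      by (simp add: \<psi>_def taylor_kappa_one[OF k])
    have psi_Z: "\<psi> k (z \<otimes> a) = p z * \<psi> k a" if "k < d" "z \<in> Z" "a \<in> carrier A" for k z a
      using that \<chi>(3) by (simp add: \<psi>_def taylor_Z_mult chi_mult jet_T taylor_T)
    \<comment> \<open>The inverse of the matrix of the new forms on the frame, the one place where
      \<open>\<chi> s\<close> is divided by.\<close>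
    define M where "M k i = \<chi> (B k i) / \<chi> s" for k i
    have left_inv: "(\<Sum>i<d. M k i * \<psi> j (e i)) = (if k = j then 1 else 0)" if k: "k < d" and j: "j < d" for k j
    proof -
      have "(\<Sum>i<d. \<chi> (B k i) * \<psi> j (e i)) = \<chi> (\<Sum>i<d. B k i * taylor (\<kappa> j) (e i))"
        using k j e_carrier by (simp add: chi_sum T_mult B_T taylor_T chi_mult \<psi>_def)
      also have "\<dots> = (if k = j then \<chi> s else 0)" using B[OF k j] chi_zero by simp
      finally have "(\<Sum>i<d. \<chi> (B k i) * \<psi> j (e i)) / \<chi> s = (if k = j then 1 else 0)"
        using \<chi>(2) by simp
      then show ?thesis by (simp add: M_def sum_divide_distrib)
    qed
    have kappa_surj: "\<exists>a\<in>carrier A. \<forall>k<d. \<kappa> k a = v k" for v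
    proof (rule bexI[of _ "lincomb e d v"])
      show "\<forall>k<d. \<kappa> k (lincomb e d v) = v k"
        by (simp add: linear_form_lincomb[OF kappa_linear e_range] kappa_e if_distrib[of "\<lambda>x. _ * x"] cong: if_cong)
    qed (rule lincomb_closed[OF e_range])
    have psi_surj: "\<exists>a\<in>carrier A. \<forall>k<d. \<psi> k a = v k" for v
    proof (rule bexI[of _ "lincomb e d (\<lambda>i. \<Sum>k<d. v k * M k i)"], intro allI impI)
      fix j assume j: "j < d"
      have "\<psi> j (lincomb e d (\<lambda>i. \<Sum>k<d. v k * M k i)) = (\<Sum>i<d. \<Sum>k<d. v k * (M k i * \<psi> j (e i)))"
        by (simp add: linear_form_lincomb[OF psi_linear[OF j] e_range] sum_distrib_right mult.assoc)
      also have "\<dots> = (\<Sum>k<d. v k * (\<Sum>i<d. M k i * \<psi> j (e i)))"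
        by (subst sum.swap) (simp add: sum_distrib_left)
      also have "\<dots> = (\<Sum>k<d. v k * (if k = j then 1 else 0))" by (simp add: left_inv j)
      also have "\<dots> = v j" using j by (simp add: if_distrib[of "\<lambda>x. _ * x"] cong: if_cong)
      finally show "\<psi> j (lincomb e d (\<lambda>i. \<Sum>k<d. v k * M k i)) = v j" .
    qed (rule lincomb_closed[OF e_range])
    interpret J: ideal P.fibre_kernel A by (rule P.fibre_kernel_ideal)
    have J_carrier: "j \<in> carrier A" if "j \<in> P.fibre_kernel" for j using J.Icarr[OF that] .
    have J_psi: "\<forall>k<d. \<psi> k a = 0" if "a \<in> P.fibre_kernel" for a
      using that unfolding P.fibre_kernel_def
    proof (induction rule: ideal_prod.induct)
      case (prod i j)
      then show ?case using psi_Z[of _ i j] by (simp add: P.point_ideal_def)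
    next
      case (sum a b)
      then have "a \<in> carrier A" "b \<in> carrier A"
        using J_carrier by (simp_all add: P.fibre_kernel_def)
      then show ?case using sum linear_form_add[OF psi_linear] by simp
    qed
    \<comment> \<open>On the fibre at \<open>p\<close> the elements of \<open>Z\<close> act by
      scalars, so the \<open>Z\<close>-span of the frame collapses to its linear span.\<close>
    have frame_J: "\<exists>c. \<exists>j\<in>P.fibre_kernel. a = lincomb e d c \<oplus> j" if a: "a \<in> frame_span" for a
    proof -
      let ?W = "{lincomb e d c \<oplus> j |c j. j \<in> P.fibre_kernel}"
      have l: "lincomb e d c \<in> carrier A" for c by (rule lincomb_closed[OF e_range])
      have "frame_span \<subseteq> ?W"
      proof (rule frame_span_minimal)
        show "e i \<in> ?W" if "i < d" for i
          using lincomb_unit[OF e_range that] e_carrier[of i] J.zero_closed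
          by (intro CollectI exI[of _ "\<lambda>j. if j = i then 1 else 0"] exI[of _ \<zero>]) simp
        show "z_submodule ?W"
          unfolding z_submodule_def
        proof (intro conjI ballI)
          show "?W \<subseteq> carrier A" using l J_carrier by auto
          show "\<zero> \<in> ?W"
            using lincomb_zero[OF e_range] J.zero_closed
            by (intro CollectI exI[of _ "\<lambda>_. 0"] exI[of _ \<zero>]) simp
        next
          fix x y assume "x \<in> ?W" "y \<in> ?W"
          then obtain c i b j where xy: "x = lincomb e d c \<oplus> i" "y = lincomb e d b \<oplus> j"
            "i \<in> P.fibre_kernel" "j \<in> P.fibre_kernel" by blast
          have "x \<oplus> y = lincomb e d (\<lambda>i. c i + b i) \<oplus> (i \<oplus> j)"
            unfolding xy(1,2) lincomb_add[OF e_range]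
            using l J_carrier[OF xy(3)] J_carrier[OF xy(4)] by (simp add: a_ac)
          then show "x \<oplus> y \<in> ?W" using J.a_closed[OF xy(3,4)] by blast
        next
          fix z x assume z: "z \<in> Z" and "x \<in> ?W"
          then obtain c i where x: "x = lincomb e d c \<oplus> i" "i \<in> P.fibre_kernel" by blast
          have zc: "z \<in> carrier A" by (rule Z_carrier[OF z])
          let ?l = "lincomb e d c"
          define r where "r = (z \<otimes> ?l \<ominus> p z \<odot> ?l) \<oplus> z \<otimes> i"
          have "z \<otimes> x = p z \<odot> ?l \<oplus> r"
          proof -
            define u where "u = p z \<odot> ?l"
            define v where "v = z \<otimes> ?l"
            have uv: "u \<in> carrier A" "v \<in> carrier A" "z \<otimes> i \<in> carrier A"
              using l zc J_carrier[OF x(2)] by (simp_all add: u_def v_def)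
            have "z \<otimes> x = v \<oplus> z \<otimes> i" unfolding x(1) v_def using l zc J_carrier[OF x(2)] by (simp add: r_distr)
            also have "\<dots> = u \<oplus> ((v \<ominus> u) \<oplus> z \<otimes> i)" using uv by algebra
            finally show ?thesis by (simp add: u_def v_def r_def)
          qed
          then have "z \<otimes> x = lincomb e d (\<lambda>i. p z * c i) \<oplus> r"
            by (simp only: lincomb_smult[OF e_range])
          moreover have "r \<in> P.fibre_kernel"
            unfolding r_def by (intro J.a_closed P.fibre_kernel_Z_mult[OF z l] J.I_l_closed[OF x(2) zc])
          ultimately show "z \<otimes> x \<in> ?W" by blast
        qed
      qed
      then show ?thesis using a by blast
    qed
    \<comment> \<open>The frame reaches \<open>f \<otimes> a\<close>, with coefficients that vanish
      because the forms are independent on the frame. So \<open>f \<otimes> a\<close> lies in the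
      kernel, and dividing by the scalar \<open>p f\<close> gives \<open>a\<close>.\<close>
    have psi_J: "a \<in> P.fibre_kernel" if a: "a \<in> carrier A" and zero: "\<forall>k<d. \<psi> k a = 0" for a
    proof -
      have fa: "f \<otimes> a \<in> frame_span" using f(3) a by blast
      obtain c j where c: "f \<otimes> a = lincomb e d c \<oplus> j" "j \<in> P.fibre_kernel" using frame_J[OF fa] by blast
      have l: "lincomb e d c \<in> carrier A" by (rule lincomb_closed[OF e_range])
      have c_zero: "c i = 0" if "i < d" for i
      proof (rule left_inverse_independent[OF left_inv _ that])
        fix k assume k: "k < d"
        have "\<psi> k (f \<otimes> a) = 0" using psi_Z[OF k f(1) a] zero k by simp
        then have "\<psi> k (lincomb e d c) = 0"
          unfolding c(1) linear_form_add[OF psi_linear[OF k] l J_carrier[OF c(2)]]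
          using J_psi[OF c(2)] k by simp
        then show "(\<Sum>i<d. c i * \<psi> k (e i)) = 0"
          by (simp add: linear_form_lincomb[OF psi_linear[OF k] e_range])
      qed
      have "lincomb e d c = \<zero>"
        using lincomb_cong[OF e_range, of d c "\<lambda>_. 0"] c_zero lincomb_zero[OF e_range] by simp
      then have faJ: "f \<otimes> a \<in> P.fibre_kernel" using c J_carrier[OF c(2)] by simp
      note subsp = ideal_c_subspace[OF P.fibre_kernel_ideal]
      have fac: "f \<otimes> a \<in> carrier A" using Z_carrier[OF f(1)] a by simp
      have "f \<otimes> a \<ominus> (f \<otimes> a \<ominus> p f \<odot> a) \<in> P.fibre_kernel"
        by (rule c_subspace_diff[OF subsp faJ P.fibre_kernel_Z_mult[OF f(1) a]])
      also have "f \<otimes> a \<ominus> (f \<otimes> a \<ominus> p f \<odot> a) = p f \<odot> a"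
      proof -
        define u where "u = p f \<odot> a"
        have "u \<in> carrier A" using a by (simp add: u_def)
        then show ?thesis unfolding u_def[symmetric] using fac by algebra
      qed
      finally have "inverse (p f) \<odot> (p f \<odot> a) \<in> P.fibre_kernel"
        using subsp unfolding c_subspace_def by blast
      then show ?thesis using a pf(1) by (simp add: c_smult_smult)
    qed
    have psi_iff: "(\<forall>k<d. \<psi> k a = 0) \<longleftrightarrow> a \<in> P.fibre_kernel" if "a \<in> carrier A" for a
      using psi_J[OF that] J_psi by blast
    have eqs: "fibre_alg A {z \<in> Z. p z = 0} = quot_alg A P.fibre_kernel"
      "fibre_alg A point_ideal = quot_alg A fibre_kernel"
      by (simp_all add: fibre_alg_def P.fibre_kernel_def P.point_ideal_def fibre_kernel_def)
    show "c_alg_isomorphic (fibre_alg A {z \<in> Z. p z = 0}) (fibre_alg A point_ideal)"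
      unfolding eqs
      by (rule quot_isomorphic[OF fibre_kernel_ideal P.fibre_kernel_ideal kappa_linear psi_linear
          kernel_iff psi_iff kappa_surj psi_surj kappa_mult psi_mult psi_one])
    show "c_alg_isomorphic (fibre_alg A point_ideal) (fibre_alg A {z \<in> Z. p z = 0})"
      unfolding eqs
      by (rule quot_isomorphic[OF P.fibre_kernel_ideal fibre_kernel_ideal psi_linear kappa_linear
          psi_iff kernel_iff psi_surj kappa_surj psi_mult kappa_mult psi_one[symmetric]])
  qed
qed

end

section \<open>Comparison of two points of one core through a generic third point\<close>

theorem theorem4p2:
  fixes A :: "(complex, 'a) module"
    and Z :: "'a set"
    and D :: "'a \<Rightarrow> 'a \<Rightarrow> 'a"
    and C :: "'a set set"
    and x y :: "'a set"
  assumes "poisson_order A Z D"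
    and "C \<in> symplectic_cores (sub_alg A Z) D"
    and "x \<in> C" and "y \<in> C"
  shows "c_alg_isomorphic (fibre_alg A x) (fibre_alg A y)"
proof -
  interpret poisson_order A Z D by fact
  have "(x, y) \<in> core_rel (sub_alg A Z) D"
    using quotient_eq_iff[OF equiv_core_rel, of C _ D C x y] assms(2-4)
    by (simp add: symplectic_cores_def)
  then have xy: "maximalideal x (sub_alg A Z)" "maximalideal y (sub_alg A Z)"
    "poisson_core (sub_alg A Z) D x = poisson_core (sub_alg A Z) D y"
    by (auto simp: core_rel_def maxspec_def)
  obtain ex ey where ex: "character (sub_alg A Z) ex" "x = {z \<in> Z. ex z = 0}"
    and ey: "character (sub_alg A Z) ey" "y = {z \<in> Z. ey z = 0}"
    using exists_point[OF xy(1)] exists_point[OF xy(2)] by blast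
  interpret x: order_point A Z D ex by unfold_locales (rule ex(1))
  interpret y: order_point A Z D ey by unfold_locales (rule ey(1))
  have px: "x.point_ideal = x" and py: "y.point_ideal = y"
    using ex(2) ey(2) by (simp_all add: x.point_ideal_def y.point_ideal_def)
  \<comment> \<open>By \<open>poisson_core_point\<close> both kernels are the common core.\<close>
  have "{z \<in> Z. taylor ex z = 0} = {z \<in> Z. taylor ey z = 0}"
    using xy(3) x.poisson_core_point y.poisson_core_point by (simp add: px py)
  then have jets: "taylor ex z = 0 \<longleftrightarrow> taylor ey z = 0" if "z \<in> Z" for z using that by blast
  obtain dx e\<^sub>x \<kappa>x where frame_x: "dual_system x.fibre_kernel dx e\<^sub>x \<kappa>x" using x.exists_fibre_frame by blast
  obtain dy e\<^sub>y \<kappa>y where frame_y: "dual_system y.fibre_kernel dy e\<^sub>y \<kappa>y" using y.exists_fibre_frame by blast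
  interpret fx: framed_point A Z D ex dx e\<^sub>x \<kappa>x by unfold_locales (rule frame_x)
  interpret fy: framed_point A Z D ey dy e\<^sub>y \<kappa>y by unfold_locales (rule frame_y)
  from fx.fibre_generically_constant obtain Gx where
    Gx: "countable Gx" "Gx \<subseteq> Z" "\<forall>g\<in>Gx. taylor ex g \<noteq> 0"
    and iso_x: "\<forall>p. character (sub_alg A Z) p \<longrightarrow> (\<forall>a\<in>Z. taylor ex a = 0 \<longrightarrow> p a = 0) \<longrightarrow> (\<forall>g\<in>Gx. p g \<noteq> 0) \<longrightarrow>
      c_alg_isomorphic (fibre_alg A {z \<in> Z. p z = 0}) (fibre_alg A x) \<and>
      c_alg_isomorphic (fibre_alg A x) (fibre_alg A {z \<in> Z. p z = 0})"
    unfolding px by blast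
  from fy.fibre_generically_constant obtain Gy where
    Gy: "countable Gy" "Gy \<subseteq> Z" "\<forall>g\<in>Gy. taylor ey g \<noteq> 0"
    and iso_y: "\<forall>p. character (sub_alg A Z) p \<longrightarrow> (\<forall>a\<in>Z. taylor ey a = 0 \<longrightarrow> p a = 0) \<longrightarrow> (\<forall>g\<in>Gy. p g \<noteq> 0) \<longrightarrow>
      c_alg_isomorphic (fibre_alg A {z \<in> Z. p z = 0}) (fibre_alg A y) \<and>
      c_alg_isomorphic (fibre_alg A y) (fibre_alg A {z \<in> Z. p z = 0})"
    unfolding py by blast
  define G where "G = Gx \<union> Gy"
  \<comment> \<open>Because the kernels agree, the hypersurfaces found for \<open>y\<close> are also
    proper as seen from \<open>x\<close>, and one \<open>p\<close> can avoid both families.\<close>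
  have G: "G \<subseteq> Z" "\<And>g. g \<in> G \<Longrightarrow> taylor ex g \<noteq> 0" using Gx Gy jets by (auto simp: G_def)
  from x.jet.exists_generic_character[OF uncountable_dependent_Z, of G]
  obtain p where p: "character (sub_alg A Z) p" "\<forall>a\<in>Z. taylor ex a = 0 \<longrightarrow> p a = 0" "\<forall>g\<in>G. p g \<noteq> 0"
    using G Gx(1) Gy(1) by (auto simp: G_def)
  note kx = p(2)
  have ky: "\<forall>a\<in>Z. taylor ey a = 0 \<longrightarrow> p a = 0" using kx jets by blast
  have "\<forall>g\<in>Gx. p g \<noteq> 0" "\<forall>g\<in>Gy. p g \<noteq> 0" using p(3) by (auto simp: G_def)
  then have "c_alg_isomorphic (fibre_alg A x) (fibre_alg A {z \<in> Z. p z = 0})"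
    "c_alg_isomorphic (fibre_alg A {z \<in> Z. p z = 0}) (fibre_alg A y)"
    using iso_x[rule_format, OF p(1) kx[rule_format]] iso_y[rule_format, OF p(1) ky[rule_format]] by blast+
  then show ?thesis by (rule c_alg_isomorphic_trans)
qed

end
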